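(* In the sum-intersection-rule setting described in the context, assume that $$\min_{A\in\mathcal{G}_L,\ k\in A^c}\left(z_A+s_{A\cup\{k\}}\right)\ge\min_{A\in\mathcal{G}_L}2r_A.$$ Then $r_*=\min_{A\in\mathcal{G}_L}r_A$. Further, define $\Theta^{(SI)}=\{\beta^A:A\in\mathcal{G}_L\}\cup\{\gamma^A:A\in\mathcal{G}_L\}$. Then $\mathbb{P}_{\Theta^{(SI)}}$ is asymptotically efficient for estimating $\mathbb{P}(\tau_b^*<\tau_b^0)$.
   Context: $X_1,X_2,\ldots$ are i.i.d. $\mathbb{R}^d$-valued random vectors on $(\Omega,\mathcal{F},\mathbb{P})$ with $\mathbb{E}[X_{1,k}]<0$ for each coordinate $k\in[d]=\{1,\dots,d\}$; $S_0=0$, $S_n=\sum_{i\le n}X_i$, $\mathcal{F}_n=\sigma(X_1,\ldots,X_n)$. $\Lambda(\theta)=\log\mathbb{E}[e^{\theta\cdot X_1}]$, $\Lambda^*(x)=\sup_\theta\{\theta\cdot x-\Lambda(\theta)\}$, $I(x)=\sup\{\theta\cdot x:\Lambda(\theta)\le0\}$; $\operatorname{dom}(f)=\{f<\infty\}$, $\operatorname{cone}(A)=\{\lambda x:\lambda>0,x\in A\}$. For $\theta\in\mathbb{R}^d$, $|\theta|_{(1)}\ge\cdots\ge|\theta|_{(d)}$ is the decreasing rearrangement of $|\theta_1|,\ldots,|\theta_d|$. Sum-intersection rule: $L$ is a fixed integer with $2\le L\le d-1$. $\mathcal{G}_n=\{B\subset[d]:|B|=n\}$ and $\mathcal{S}_L=\{A\subset[d]:|A|\ge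 L\}$. For $A\subset[d]$, $$W^A=\Big\{x\in\mathbb{R}^d:x_k>0\text{ for }k\in A,\ x_{k'}<0\text{ for }k'\in A^c,\ \sum_{k\in B}|x_k|>1\text{ for every }B\in\mathcal{G}_L\Big\},$$ $\tau_b^A=\inf\{n\ge0:S_n\in bW^A\}$ ($b>0$, $\inf\emptyset=\infty$), $\tau_b^*=\min_{A\in\mathcal{S}_L}\tau_b^A$ and $\tau_b^0=\min_{A\notin\mathcal{S}_L}\tau_b^A$. Standing assumption: $\operatorname{dom}(\Lambda)$ is open and $\operatorname{int}(\operatorname{cone}(\operatorname{dom}(\Lambda^* )))\cap W^A\ne\emptyset$ for every $A\in\mathcal{S}_L$. For $A\in\mathcal{S}_L$: $r_A=\inf_{x\in W^A}I(x)$, $r_*=\min_{A\in\mathcal{S}_L}r_A$, and $\beta^A$ is the unique vector with $\Lambda(\beta^A)=0$, $W^A\subset\{v:\beta^A\cdot v\ge r_A\}$, $\{x:I(x)\le r_A\}\subset\{v:\beta^A\cdot v\le r_A\}$ (existence and uniqueness are known). For $A\in\mathcal{G}_L$, $z_A$ and $\gamma^A$ are the optimal value and solution of $$\max_{\theta\in\mathbb{R}^d}|\theta|_{(L)}\ \text{ s.t. }\ \Lambda(\theta)\le0,\ \theta_k\ge0\text{ for }k\in A,\ \theta_{k'}=0\text{ for }k'\in A^c.$$ For $B\in\mathcal{G}_{L+1}$, $s_B$ is the optimal value of $$\max_{\theta\in\mathbb{R}^d}\min_{1\le\ell\le L}\frac1\ell\sum_{i=L-\ell+1}^{L+1}|\theta|_{(i)}\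 \text{ s.t. }\ \Lambda(\theta)\le0,\ \theta_k\ge0\text{ for }k\in B,\ \theta_{k'}=0\text{ for }k'\in B^c.$$ For $\theta\in\operatorname{dom}(\Lambda)$, $\mathbb{P}_\theta$ is the probability measure with $\frac{d\mathbb{P}_\theta}{d\mathbb{P}}(\mathcal{F}_n)=\exp(\theta\cdot S_n-n\Lambda(\theta))$ for all $n$. For finite nonempty $\Theta\subset\operatorname{dom}(\Lambda)$, $\mathbb{P}_\Theta=\frac1{|\Theta|}\sum_{\theta\in\Theta}\mathbb{P}_\theta$ (expectation $\mathbb{E}_\Theta$) and $$\widehat{\mathbb{W}}_b(\Theta)=\Big(\frac1{|\Theta|}\sum_{\theta\in\Theta}\exp(\theta\cdot S_{\tau_b^*}-\tau_b^*\Lambda(\theta))\Big)^{-1}\mathbf 1\{\tau_b^*<\tau_b^0\}.$$ $\mathbb{P}_\Theta$ is asymptotically efficient for estimating $\mathbb{P}(\tau_b^*<\tau_b^0)$ if $\log\mathbb{E}_\Theta[(\widehat{\mathbb{W}}_b(\Theta))^2]\big/\big(2\log\mathbb{P}(\tau_b^*<\tau_b^0)\big)\to1$ as $b\to\infty$. *)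

theory Defs
  imports "HOL-Probability.Probability"
begin

section \<open>Large-deviation functions\<close>

definition log_mgf :: "'a measure \<Rightarrow> ('a \<Rightarrow> real^'n) \<Rightarrow> real^'n \<Rightarrow> ereal" where
  "log_mgf M Y \<theta> =
     (if integrable M (\<lambda>\<omega>. exp (\<theta> \<bullet> Y \<omega>)) then ereal (ln (\<integral>\<omega>. exp (\<theta> \<bullet> Y \<omega>) \<partial>M)) else \<infinity>)"

definition conj_fun :: "(real^'n \<Rightarrow> ereal) \<Rightarrow> real^'n \<Rightarrow> ereal" where
  "conj_fun \<Lambda> x = (SUP \<theta>. ereal (\<theta> \<bullet> x) - \<Lambda> \<theta>)"

definition rate :: "(real^'n \<Rightarrow> ereal) \<Rightarrow> real^'n \<Rightarrow> ereal" where
  "rate \<Lambda> x = (SUP \<theta>\<in>{\<theta>. \<Lambda> \<theta> \<le> 0}. ereal (\<theta> \<bullet> x))"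

definition dom_fun :: "(real^'n \<Rightarrow> ereal) \<Rightarrow> (real^'n) set" where
  "dom_fun f = {x. f x < \<infinity>}"

text \<open>Unlike the library's \<open>cone hull\<close>, this cone contains the origin only if \<open>A\<close> does.\<close>

definition pos_cone :: "(real^'n) set \<Rightarrow> (real^'n) set" where
  "pos_cone A = {c *\<^sub>R x | c x. 0 < c \<and> x \<in> A}"


section \<open>Random walk and stopping times\<close>

text \<open>The i.i.d. sequence is indexed from 0: \<open>X i\<close> stands for the increment usually
  written with index \<open>i + 1\<close>.\<close>

definition walk :: "(nat \<Rightarrow> 'a \<Rightarrow> real^'n) \<Rightarrow> nat \<Rightarrow> 'a \<Rightarrow> real^'n" where
  "walk X n \<omega> = (\<Sum>i<n. X i \<omega>)"

definition card_eq_sets :: "nat \<Rightarrow> 'n::finite set set" where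
  "card_eq_sets n = {B. card B = n}"

definition card_ge_sets :: "nat \<Rightarrow> 'n::finite set set" where
  "card_ge_sets L = {A. L \<le> card A}"

definition target :: "nat \<Rightarrow> 'n::finite set \<Rightarrow> (real^'n) set" where
  "target L A = {x. (\<forall>k\<in>A. 0 < x $ k) \<and> (\<forall>k\<in>-A. x $ k < 0) \<and>
                    (\<forall>B\<in>card_eq_sets L. 1 < (\<Sum>k\<in>B. \<bar>x $ k\<bar>))}"

definition hit_time ::
    "(nat \<Rightarrow> 'a \<Rightarrow> real^'n) \<Rightarrow> nat \<Rightarrow> real \<Rightarrow> 'n::finite set \<Rightarrow> 'a \<Rightarrow> enat" where
  "hit_time X L b A \<omega> = Inf (enat ` {n. walk X n \<omega> \<in> (\<lambda>x. b *\<^sub>R x) ` target L A})"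

definition tau_star :: "(nat \<Rightarrow> 'a \<Rightarrow> real^'n::finite) \<Rightarrow> nat \<Rightarrow> real \<Rightarrow> 'a \<Rightarrow> enat" where
  "tau_star X L b \<omega> = (MIN A\<in>card_ge_sets L. hit_time X L b A \<omega>)"

definition tau_zero :: "(nat \<Rightarrow> 'a \<Rightarrow> real^'n::finite) \<Rightarrow> nat \<Rightarrow> real \<Rightarrow> 'a \<Rightarrow> enat" where
  "tau_zero X L b \<omega> = (MIN A\<in>-card_ge_sets L. hit_time X L b A \<omega>)"


section \<open>The optimization problems\<close>

definition r_val :: "(real^'n::finite \<Rightarrow> ereal) \<Rightarrow> nat \<Rightarrow> 'n set \<Rightarrow> ereal" where
  "r_val \<Lambda> L A = (INF x\<in>target L A. rate \<Lambda> x)"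

definition beta :: "(real^'n::finite \<Rightarrow> ereal) \<Rightarrow> nat \<Rightarrow> 'n set \<Rightarrow> real^'n" where
  "beta \<Lambda> L A = (THE \<beta>. \<Lambda> \<beta> = 0 \<and>
      target L A \<subseteq> {v. r_val \<Lambda> L A \<le> ereal (\<beta> \<bullet> v)} \<and>
      {x. rate \<Lambda> x \<le> r_val \<Lambda> L A} \<subseteq> {v. ereal (\<beta> \<bullet> v) \<le> r_val \<Lambda> L A})"

text \<open>\<open>dec_abs \<theta> i\<close> is the \<open>i\<close>-th largest (counted from 1) of the absolute values of the
  coordinates of \<open>\<theta>\<close>.\<close>

definition dec_abs :: "real^'n::finite \<Rightarrow> nat \<Rightarrow> real" where
  "dec_abs \<theta> i =
     rev (sorted_list_of_multiset (image_mset (\<lambda>k. \<bar>\<theta> $ k\<bar>) (mset_set UNIV))) ! (i - 1)"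

definition feasible :: "(real^'n::finite \<Rightarrow> ereal) \<Rightarrow> 'n set \<Rightarrow> (real^'n) set" where
  "feasible \<Lambda> A = {\<theta>. \<Lambda> \<theta> \<le> 0 \<and> (\<forall>k\<in>A. 0 \<le> \<theta> $ k) \<and> (\<forall>k\<in>-A. \<theta> $ k = 0)}"

definition z_val :: "(real^'n::finite \<Rightarrow> ereal) \<Rightarrow> nat \<Rightarrow> 'n set \<Rightarrow> ereal" where
  "z_val \<Lambda> L A = (SUP \<theta>\<in>feasible \<Lambda> A. ereal (dec_abs \<theta> L))"

definition gamma_opt :: "(real^'n::finite \<Rightarrow> ereal) \<Rightarrow> nat \<Rightarrow> 'n set \<Rightarrow> real^'n" where
  "gamma_opt \<Lambda> L A = (THE \<theta>. is_arg_max (\<lambda>\<theta>. dec_abs \<theta> L) (\<lambda>\<theta>. \<theta> \<in> feasible \<Lambda> A) \<theta>)"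

definition s_val :: "(real^'n::finite \<Rightarrow> ereal) \<Rightarrow> nat \<Rightarrow> 'n set \<Rightarrow> ereal" where
  "s_val \<Lambda> L B = (SUP \<theta>\<in>feasible \<Lambda> B.
     ereal (MIN l\<in>{1..L}. (1 / real l) * (\<Sum>i = L - l + 1..L + 1. dec_abs \<theta> i)))"

definition Theta_SI :: "(real^'n::finite \<Rightarrow> ereal) \<Rightarrow> nat \<Rightarrow> (real^'n) set" where
  "Theta_SI \<Lambda> L = beta \<Lambda> L ` card_eq_sets L \<union> gamma_opt \<Lambda> L ` card_eq_sets L"


section \<open>Exponential tilting and importance sampling\<close>

definition gen_sigma :: "'a measure \<Rightarrow> (nat \<Rightarrow> 'a \<Rightarrow> real^'n) \<Rightarrow> nat set \<Rightarrow> 'a measure" where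
  "gen_sigma M X I = sigma (space M) (\<Union>i\<in>I. {X i -` B \<inter> space M | B. B \<in> sets borel})"

text \<open>The tilted measures live on the \<open>\<sigma>\<close>-algebra generated by the whole sequence, on which
  they are uniquely determined by their restrictions to the finite-time \<open>\<sigma>\<close>-algebras.\<close>

definition exp_tilted ::
    "'a measure \<Rightarrow> (nat \<Rightarrow> 'a \<Rightarrow> real^'n) \<Rightarrow> real^'n \<Rightarrow> 'a measure \<Rightarrow> bool" where
  "exp_tilted M X \<theta> Q \<longleftrightarrow>
     prob_space Q \<and> sets Q = sets (gen_sigma M X UNIV) \<and>
     (\<forall>n. restr_to_subalg Q (gen_sigma M X {..<n}) =
          density (restr_to_subalg M (gen_sigma M X {..<n}))
            (\<lambda>\<omega>. ennreal (exp (\<theta> \<bullet> walk X n \<omega> - real n * real_of_ereal (log_mgf M (X 0) \<theta>)))))"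

definition mixture ::
    "'a measure \<Rightarrow> (real^'n \<Rightarrow> 'a measure) \<Rightarrow> (real^'n) set \<Rightarrow> 'a measure" where
  "mixture N P \<Theta> = measure_of (space N) (sets N)
     (\<lambda>E. (\<Sum>\<theta>\<in>\<Theta>. emeasure (P \<theta>) E) / of_nat (card \<Theta>))"

lemma sets_mixture [simp]: "sets (mixture N P \<Theta>) = sets N"
  and space_mixture [simp]: "space (mixture N P \<Theta>) = space N"
  by (simp_all add: mixture_def)

text \<open>The set function defining \<open>mixture\<close> is indeed a measure.\<close>

lemma emeasure_mixture:
  assumes "\<And>\<theta>. \<theta> \<in> \<Theta> \<Longrightarrow> sets (P \<theta>) = sets N" and E: "E \<in> sets N"
  shows "emeasure (mixture N P \<Theta>) E = (\<Sum>\<theta>\<in>\<Theta>. emeasure (P \<theta>) E) / of_nat (card \<Theta>)"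
proof (rule emeasure_measure_of[OF mixture_def])
  show "sets N \<subseteq> Pow (space N)" by (rule sets.space_closed)
  show "E \<in> sets (mixture N P \<Theta>)" using E by simp
  show "positive (sets (mixture N P \<Theta>)) (\<lambda>E. (\<Sum>\<theta>\<in>\<Theta>. emeasure (P \<theta>) E) / of_nat (card \<Theta>))"
    by (simp add: positive_def)
  show "countably_additive (sets (mixture N P \<Theta>))
          (\<lambda>E. (\<Sum>\<theta>\<in>\<Theta>. emeasure (P \<theta>) E) / of_nat (card \<Theta>))"
  proof (rule countably_additiveI)
    fix F :: "nat \<Rightarrow> _" assume F: "range F \<subseteq> sets (mixture N P \<Theta>)" "disjoint_family F"
    have "(\<Sum>i. \<Sum>\<theta>\<in>\<Theta>. emeasure (P \<theta>) (F i)) = (\<Sum>\<theta>\<in>\<Theta>. \<Sum>i. emeasure (P \<theta>) (F i))"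
      by (rule suminf_sum) auto
    also have "\<dots> = (\<Sum>\<theta>\<in>\<Theta>. emeasure (P \<theta>) (\<Union>i. F i))"
      using F assms(1) by (intro sum.cong refl suminf_emeasure) auto
    finally show "(\<Sum>i. (\<Sum>\<theta>\<in>\<Theta>. emeasure (P \<theta>) (F i)) / of_nat (card \<Theta>)) =
        (\<Sum>\<theta>\<in>\<Theta>. emeasure (P \<theta>) (\<Union>i. F i)) / of_nat (card \<Theta>)"
      by (simp add: ennreal_suminf_divide)
  qed
qed

text \<open>The stopping time \<open>tau_star\<close> is finite wherever the indicator is nonzero, so the value
  of \<open>the_enat\<close> at \<open>\<infinity>\<close> is irrelevant.\<close>

definition IS_estimator ::
    "'a measure \<Rightarrow> (nat \<Rightarrow> 'a \<Rightarrow> real^'n::finite) \<Rightarrow> nat \<Rightarrow> real \<Rightarrow> (real^'n) set \<Rightarrow> 'a \<Rightarrow> real" where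
  "IS_estimator M X L b \<Theta> \<omega> =
     (let n = the_enat (tau_star X L b \<omega>) in
       inverse (1 / real (card \<Theta>) *
         (\<Sum>\<theta>\<in>\<Theta>. exp (\<theta> \<bullet> walk X n \<omega> - real n * real_of_ereal (log_mgf M (X 0) \<theta>)))) *
       of_bool (tau_star X L b \<omega> < tau_zero X L b \<omega>))"

text \<open>Because \<open>ln 0 = 0\<close> and \<open>x / 0 = 0\<close>, convergence of the ratio to 1 forces, for all large
  \<open>b\<close>, the probability to lie strictly between 0 and 1 and the second moment to be positive
  (hence the squared estimator to be integrable).\<close>

definition asymp_efficient ::
    "'a measure \<Rightarrow> (nat \<Rightarrow> 'a \<Rightarrow> real^'n::finite) \<Rightarrow> nat \<Rightarrow> (real^'n \<Rightarrow> 'a measure) \<Rightarrow>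
     (real^'n) set \<Rightarrow> bool" where
  "asymp_efficient M X L P \<Theta> \<longleftrightarrow>
     ((\<lambda>b. ln (\<integral>\<omega>. (IS_estimator M X L b \<Theta> \<omega>)\<^sup>2 \<partial>mixture (gen_sigma M X UNIV) P \<Theta>) /
           (2 * ln (measure M {\<omega>\<in>space M. tau_star X L b \<omega> < tau_zero X L b \<omega>})))
      \<longlongrightarrow> 1) at_top"

end

theory Submission
  imports Defs
begin

text \<open>Let \<open>K = {\<theta>. \<Lambda> \<theta> \<le> 0}\<close>, a closed strictly convex set whose support function is the rate \<open>I\<close>.

  Upper bound: with \<open>D\<^sub>n\<close> the likelihood ratio of the mixture, the second moment is the sum over \<open>n\<close> of
  \<open>\<integral> 1 / D\<^sub>n\<close> over the event that the walk stops correctly at time \<open>n\<close>. Where it stops in \<open>b W\<^sup>A\<close>,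
  one component \<open>\<theta>\<close> of the mixture gives \<open>1 / D\<^sub>n \<le> |\<Theta>| e\<^bsup>-bp\<^esup>\<close>, and a second change of measure, to
  some \<open>\<phi> \<in> K\<close>, bounds the probability by \<open>e\<^bsup>-bq\<^esup>\<close>. For \<open>|A| = L\<close> take \<open>\<theta> = \<phi> = \<beta>\<^sup>A\<close>, so that
  \<open>p + q = 2 r\<^sub>A\<close>; for \<open>|A| > L\<close> take \<open>\<gamma>\<close> of an \<open>L\<close>-subset of \<open>A\<close> and a near-optimal \<open>\<phi>\<close> for an
  \<open>(L + 1)\<close>-subset, so that \<open>p + q\<close> is nearly \<open>z + s\<close>, which is at least \<open>2 r\<close> for
  \<open>r\<close> the minimum of the \<open>r\<^sub>A\<close> with \<open>|A| = L\<close>.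

  Lower bound: the walk tilted by a maximizer of \<open>\<theta> \<bullet> x\<close> over \<open>K\<close> follows the ray through \<open>x \<in> W\<^sup>A\<close>, so
  the error probability decays at rate at most \<open>r\<^sub>A\<close>, for every \<open>A\<close> with at least \<open>L\<close> elements. As
  its square is at most the second moment, comparing the exponents yields both \<open>r \<le> r\<^sub>A\<close> for all these
  \<open>A\<close> and the asymptotic efficiency.\<close>

section \<open>The moment generating function and its sublevel set\<close>

text \<open>For nonnegative \<theta> supported on an L-set A, the objective of \<open>z_val\<close>
  is the infimum of \<open>\<theta> \<bullet> x\<close> over \<open>target L B\<close> for every B
  containing A. For nonnegative \<theta> supported on an (L + 1)-set, the objective of
  \<open>s_val\<close> is the analogous infimum, the value of a small linear program. So both
  programs maximize a guaranteed exponent over K. The two tilts play different roles: \<theta>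
  bounds the weight and must be a component of the mixture, while \<phi> only bounds a probability
  and may be any point of K. This is why (L + 1)-sets contribute nothing to \<Theta>. Two facts keep
  the stopping time out of the estimates: on K the term -n \<Lambda>(\<theta>) of the log-likelihood
  ratio is nonnegative, so exponents do not depend on n, and the events of stopping at n are
  disjoint, so their probabilities sum to at most 1. Tilted measures are accessible only through
  densities on finite-time \<sigma>-algebras. Concentration around the drift therefore comes from
  comparing a tilt with its neighbours; openness of the domain supplies the quadratic bound that
  this needs.\<close>

lemma finite_attains_max:
  fixes f :: "'i \<Rightarrow> real"
  assumes "finite B" "B \<noteq> {}"
  obtains j where "j \<in> B" "\<And>k. k \<in> B \<Longrightarrow> f k \<le> f j"
proof -
  have "Max (f ` B) \<in> f ` B" using assms by (intro Max_in) auto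
  then obtain j where j: "j \<in> B" "Max (f ` B) = f j" by auto
  show thesis
  proof (rule that[OF j(1)])
    fix k assume "k \<in> B"
    then show "f k \<le> f j" using assms by (simp flip: j(2))
  qed
qed

lemma exp_le_quadratic: "exp u \<le> 1 + u + u\<^sup>2 * exp \<bar>u\<bar>" for u :: real
proof -
  obtain t where t: "\<bar>t\<bar> \<le> \<bar>u\<bar>" "exp u = (\<Sum>m<2. u ^ m / fact m) + exp t / fact 2 * u ^ 2"
    using Maclaurin_exp_le[of u 2] by blast
  have "exp t / 2 * u\<^sup>2 \<le> exp \<bar>u\<bar> * u\<^sup>2"
  proof (rule mult_right_mono)
    have "exp t \<le> exp \<bar>u\<bar>" using t(1) by simp
    moreover have "0 \<le> exp t" by simp
    ultimately show "exp t / 2 \<le> exp \<bar>u\<bar>" by linarith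
  qed simp
  then show ?thesis using t(2) by (simp add: numeral_2_eq_2 mult.commute)
qed

locale mgf_rv = prob_space M for M :: "'a measure" +
  fixes Y :: "'a \<Rightarrow> real^'n::finite"
  assumes Y_measurable [measurable]: "Y \<in> borel_measurable M"
    and open_dom: "open (dom_fun (log_mgf M Y))"
begin

definition mgf :: "real^'n \<Rightarrow> real" where
  "mgf \<theta> = expectation (\<lambda>\<omega>. exp (\<theta> \<bullet> Y \<omega>))"

definition K :: "(real^'n) set" where
  "K = {\<theta>. log_mgf M Y \<theta> \<le> 0}"

text \<open>The gradient of \<open>mgf\<close> at \<theta>, not divided by
  \<open>mgf \<theta>\<close>; where \<open>mgf \<theta> = 1\<close> it is the mean of Y under the
  tilt.\<close>

definition tilted_mean :: "real^'n \<Rightarrow> real^'n" where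
  "tilted_mean \<theta> = expectation (\<lambda>\<omega>. exp (\<theta> \<bullet> Y \<omega>) *\<^sub>R Y \<omega>)"

lemma dom_iff: "\<theta> \<in> dom_fun (log_mgf M Y) \<longleftrightarrow> integrable M (\<lambda>\<omega>. exp (\<theta> \<bullet> Y \<omega>))"
  by (simp add: dom_fun_def log_mgf_def)

lemma mgf_pos:
  assumes "\<theta> \<in> dom_fun (log_mgf M Y)"
  shows "0 < mgf \<theta>"
proof -
  have "0 \<le> mgf \<theta>" by (simp add: mgf_def)
  moreover have "mgf \<theta> \<noteq> 0"
  proof
    assume "mgf \<theta> = 0"
    then have "AE \<omega> in M. exp (\<theta> \<bullet> Y \<omega>) = 0"
      using assms by (subst integral_nonneg_eq_0_iff_AE[symmetric]) (auto simp: dom_iff mgf_def)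
    then show False by simp
  qed
  ultimately show ?thesis by simp
qed

lemma log_mgf_eq: "\<theta> \<in> dom_fun (log_mgf M Y) \<Longrightarrow> log_mgf M Y \<theta> = ereal (ln (mgf \<theta>))"
  by (simp add: dom_iff log_mgf_def mgf_def)

lemma K_subset_dom: "K \<subseteq> dom_fun (log_mgf M Y)"
  by (auto simp: K_def dom_fun_def intro: le_less_trans)

lemma K_iff: "\<theta> \<in> K \<longleftrightarrow> \<theta> \<in> dom_fun (log_mgf M Y) \<and> mgf \<theta> \<le> 1"
  using K_subset_dom mgf_pos[of \<theta>] by (auto simp: K_def log_mgf_eq)

lemma zero_dom: "0 \<in> dom_fun (log_mgf M Y)"
  by (simp add: dom_iff)

lemma mgf_zero: "mgf 0 = 1"
  by (simp add: mgf_def prob_space)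

lemma zero_in_K: "0 \<in> K"
  by (simp add: K_iff zero_dom mgf_zero)

text \<open>An open domain contains the points \<theta> plus or minus e times a unit vector. Since
  the norm is at most d times the largest absolute coordinate, the exponential of
  \<open>e / d * norm y\<close> is dominated by the sum of the exponentials of all e y_k and -e
  y_k.\<close>

lemma integrable_exp_norm:
  assumes "\<theta> \<in> dom_fun (log_mgf M Y)"
  obtains \<delta> where "0 < \<delta>" "integrable M (\<lambda>\<omega>. exp (\<theta> \<bullet> Y \<omega>) * exp (\<delta> * norm (Y \<omega>)))"
proof -
  obtain e where e: "0 < e" "cball \<theta> e \<subseteq> dom_fun (log_mgf M Y)"
    using open_dom assms open_contains_cball by blast
  define d where "d = real CARD('n)"
  have d: "0 < d" by (simp add: d_def)
  let ?g = "\<lambda>\<omega>. \<Sum>k\<in>UNIV. exp ((\<theta> + e *\<^sub>R axis k 1) \<bullet> Y \<omega>) + exp ((\<theta> - e *\<^sub>R axis k 1) \<bullet> Y \<omega>)"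
  have "\<theta> + e *\<^sub>R axis k 1 \<in> cball \<theta> e" "\<theta> - e *\<^sub>R axis k 1 \<in> cball \<theta> e" for k
    using e by (auto simp: dist_norm)
  then have "integrable M ?g"
    using e(2) by (intro Bochner_Integration.integrable_sum Bochner_Integration.integrable_add)
      (auto simp: dom_iff[symmetric])
  then have "integrable M (\<lambda>\<omega>. exp (\<theta> \<bullet> Y \<omega>) * exp (e / d * norm (Y \<omega>)))"
  proof (rule Bochner_Integration.integrable_bound)
    show "AE \<omega> in M. norm (exp (\<theta> \<bullet> Y \<omega>) * exp (e / d * norm (Y \<omega>))) \<le> norm (?g \<omega>)"
    proof (intro always_eventually allI)
      fix \<omega>
      let ?y = "Y \<omega>"
      obtain k where k: "\<And>j. \<bar>?y $ j\<bar> \<le> \<bar>?y $ k\<bar>"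
        using finite_attains_max[of UNIV "\<lambda>j. \<bar>?y $ j\<bar>"] by auto
      have "norm ?y \<le> (\<Sum>j\<in>UNIV. \<bar>?y $ j\<bar>)" by (rule norm_le_l1_cart)
      also have "\<dots> \<le> (\<Sum>j\<in>(UNIV::'n set). \<bar>?y $ k\<bar>)" by (intro sum_mono k)
      also have "\<dots> = d * \<bar>?y $ k\<bar>" by (simp add: d_def)
      finally have "e / d * norm ?y \<le> e * \<bar>?y $ k\<bar>"
        using e d by (simp add: field_simps)
      then have "exp (e / d * norm ?y) \<le> exp (e * \<bar>?y $ k\<bar>)" by simp
      also have "\<dots> \<le> exp (e * ?y $ k) + exp (- (e * ?y $ k))"
        by (cases "?y $ k \<ge> 0") (auto simp: add_increasing add_increasing2)
      finally have "exp (\<theta> \<bullet> ?y) * exp (e / d * norm ?y)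
          \<le> exp (\<theta> \<bullet> ?y) * (exp (e * ?y $ k) + exp (- (e * ?y $ k)))"
        by (intro mult_left_mono) auto
      also have "\<dots> = exp ((\<theta> + e *\<^sub>R axis k 1) \<bullet> ?y) + exp ((\<theta> - e *\<^sub>R axis k 1) \<bullet> ?y)"
        by (simp add: inner_add_left inner_diff_left inner_axis' exp_add exp_diff exp_minus field_simps)
      also have "\<dots> \<le> ?g \<omega>"
        by (rule member_le_sum[where f = "\<lambda>k. exp ((\<theta> + e *\<^sub>R axis k 1) \<bullet> ?y) + exp ((\<theta> - e *\<^sub>R axis k 1) \<bullet> ?y)"])
          (auto intro: add_nonneg_nonneg)
      finally show "norm (exp (\<theta> \<bullet> ?y) * exp (e / d * norm ?y)) \<le> norm (?g \<omega>)"
        by (simp only: real_norm_def abs_mult abs_exp_cancel)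
    qed
  qed simp
  then show ?thesis using that[of "e / d"] e d by simp
qed

lemma integrable_tilted:
  assumes "\<theta> \<in> dom_fun (log_mgf M Y)"
  shows "integrable M (\<lambda>\<omega>. exp (\<theta> \<bullet> Y \<omega>) *\<^sub>R Y \<omega>)"
proof -
  obtain \<delta> where \<delta>: "0 < \<delta>" and int: "integrable M (\<lambda>\<omega>. exp (\<theta> \<bullet> Y \<omega>) * exp (\<delta> * norm (Y \<omega>)))"
    using integrable_exp_norm[OF assms] by blast
  show ?thesis
  proof (rule Bochner_Integration.integrable_bound)
    show "integrable M (\<lambda>\<omega>. (1 / \<delta>) * (exp (\<theta> \<bullet> Y \<omega>) * exp (\<delta> * norm (Y \<omega>))))"
      by (intro integrable_mult_right int)
    show "AE \<omega> in M. norm (exp (\<theta> \<bullet> Y \<omega>) *\<^sub>R Y \<omega>) \<le>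
        norm ((1 / \<delta>) * (exp (\<theta> \<bullet> Y \<omega>) * exp (\<delta> * norm (Y \<omega>))))"
    proof (intro always_eventually allI)
      fix \<omega>
      have "\<delta> * norm (Y \<omega>) \<le> exp (\<delta> * norm (Y \<omega>))"
        using exp_ge_add_one_self[of "\<delta> * norm (Y \<omega>)"] by linarith
      then have "exp (\<theta> \<bullet> Y \<omega>) * (\<delta> * norm (Y \<omega>)) \<le> exp (\<theta> \<bullet> Y \<omega>) * exp (\<delta> * norm (Y \<omega>))"
        by (intro mult_left_mono) auto
      then show "norm (exp (\<theta> \<bullet> Y \<omega>) *\<^sub>R Y \<omega>) \<le>
        norm ((1 / \<delta>) * (exp (\<theta> \<bullet> Y \<omega>) * exp (\<delta> * norm (Y \<omega>))))"
        using \<delta> by (simp add: field_simps abs_mult)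
    qed
  qed simp
qed

text \<open>Integrates \<open>1 + v \<le> exp v\<close> with v = (\<phi> - \<theta>) \<bullet> Y
  against the weight exp (\<theta> \<bullet> Y).\<close>

lemma mgf_tangent:
  assumes "\<theta> \<in> dom_fun (log_mgf M Y)" "\<phi> \<in> dom_fun (log_mgf M Y)"
  shows "mgf \<theta> + (\<phi> - \<theta>) \<bullet> tilted_mean \<theta> \<le> mgf \<phi>"
proof -
  have int: "integrable M (\<lambda>\<omega>. exp (\<theta> \<bullet> Y \<omega>))" "integrable M (\<lambda>\<omega>. exp (\<phi> \<bullet> Y \<omega>))"
    using assms by (auto simp: dom_iff)
  note int1 = integrable_tilted[OF assms(1)]
  have "exp (\<theta> \<bullet> Y \<omega>) + (\<phi> - \<theta>) \<bullet> (exp (\<theta> \<bullet> Y \<omega>) *\<^sub>R Y \<omega>) \<le> exp (\<phi> \<bullet> Y \<omega>)" for \<omega>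
  proof -
    have "exp (\<theta> \<bullet> Y \<omega>) * (1 + (\<phi> - \<theta>) \<bullet> Y \<omega>) \<le> exp (\<theta> \<bullet> Y \<omega>) * exp ((\<phi> - \<theta>) \<bullet> Y \<omega>)"
      by (intro mult_left_mono exp_ge_add_one_self) auto
    then show ?thesis by (simp add: mult_exp_exp inner_diff_left distrib_left)
  qed
  then have "expectation (\<lambda>\<omega>. exp (\<theta> \<bullet> Y \<omega>) + (\<phi> - \<theta>) \<bullet> (exp (\<theta> \<bullet> Y \<omega>) *\<^sub>R Y \<omega>)) \<le> mgf \<phi>"
    unfolding mgf_def using int int1
    by (intro integral_mono Bochner_Integration.integrable_add integrable_inner_right) auto
  then show ?thesis
    using int int1 by (simp add: mgf_def tilted_mean_def del: inner_scaleR_right)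
qed

text \<open>Does the work of differentiability: it justifies small steps into the interior of K and
  controls neighbouring tilts in the Chernoff bounds.\<close>

lemma mgf_quadratic_bound:
  assumes "\<theta> \<in> dom_fun (log_mgf M Y)"
  obtains \<eta> C where "0 < \<eta>" "0 \<le> C"
    "\<And>h. norm h \<le> \<eta> \<Longrightarrow> \<theta> + h \<in> dom_fun (log_mgf M Y)"
    "\<And>h. norm h \<le> \<eta> \<Longrightarrow> mgf (\<theta> + h) \<le> mgf \<theta> + h \<bullet> tilted_mean \<theta> + C * (norm h)\<^sup>2"
proof -
  obtain \<delta> where \<delta>: "0 < \<delta>" and int: "integrable M (\<lambda>\<omega>. exp (\<theta> \<bullet> Y \<omega>) * exp (\<delta> * norm (Y \<omega>)))"
    using integrable_exp_norm[OF assms] by blast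
  \<comment> \<open>Half of the available exponential moment absorbs
    \<open>exp \<bar>v\<bar>\<close>, the other half absorbs the square of the norm of Y.\<close>
  define \<eta> where "\<eta> = \<delta> / 2"
  have \<eta>: "0 < \<eta>" "2 * \<eta> = \<delta>" using \<delta> by (auto simp: \<eta>_def)
  define C where "C = 2 / \<eta>\<^sup>2 * expectation (\<lambda>\<omega>. exp (\<theta> \<bullet> Y \<omega>) * exp (\<delta> * norm (Y \<omega>)))"
  have C: "0 \<le> C" unfolding C_def by (intro mult_nonneg_nonneg integral_nonneg_AE) auto
  have int0: "integrable M (\<lambda>\<omega>. exp (\<theta> \<bullet> Y \<omega>))" using assms by (simp add: dom_iff)
  have int1: "integrable M (\<lambda>\<omega>. exp (\<theta> \<bullet> Y \<omega>) *\<^sub>R Y \<omega>)"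
    by (rule integrable_tilted[OF assms])
  have main: "\<theta> + h \<in> dom_fun (log_mgf M Y) \<and> mgf (\<theta> + h) \<le> mgf \<theta> + h \<bullet> tilted_mean \<theta> + C * (norm h)\<^sup>2"
    if h: "norm h \<le> \<eta>" for h
  proof -
    let ?u = "\<lambda>\<omega>. exp (\<theta> \<bullet> Y \<omega>) + h \<bullet> (exp (\<theta> \<bullet> Y \<omega>) *\<^sub>R Y \<omega>)
        + (norm h)\<^sup>2 * (2 / \<eta>\<^sup>2) * (exp (\<theta> \<bullet> Y \<omega>) * exp (\<delta> * norm (Y \<omega>)))"
    have ptw: "exp ((\<theta> + h) \<bullet> Y \<omega>) \<le> ?u \<omega>" for \<omega>
    proof -
      define y where "y = norm (Y \<omega>)"
      define v where "v = h \<bullet> Y \<omega>"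
      have v: "\<bar>v\<bar> \<le> norm h * y" unfolding v_def y_def by (rule Cauchy_Schwarz_ineq2)
      have y: "0 \<le> y" by (simp add: y_def)
      have vy: "\<bar>v\<bar> \<le> \<eta> * y" using v mult_right_mono[OF h y] by linarith
      have "(\<eta> * y)\<^sup>2 / 2 \<le> exp (\<eta> * y)"
        using exp_lower_Taylor_quadratic[of "\<eta> * y"] mult_nonneg_nonneg[of \<eta> y] \<eta>(1) y by linarith
      then have q: "y\<^sup>2 \<le> 2 / \<eta>\<^sup>2 * exp (\<eta> * y)"
        using \<eta> by (simp add: field_simps)
      have "v\<^sup>2 * exp \<bar>v\<bar> \<le> ((norm h)\<^sup>2 * y\<^sup>2) * exp (\<eta> * y)"
      proof (rule mult_mono)
        show "v\<^sup>2 \<le> (norm h)\<^sup>2 * y\<^sup>2"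
          using power_mono[OF v, of 2] by (simp add: power_mult_distrib)
      qed (use vy in auto)
      also have "\<dots> \<le> ((norm h)\<^sup>2 * (2 / \<eta>\<^sup>2 * exp (\<eta> * y))) * exp (\<eta> * y)"
        by (intro mult_right_mono mult_left_mono q) auto
      also have "\<dots> = (norm h)\<^sup>2 * (2 / \<eta>\<^sup>2) * exp (\<delta> * y)"
        unfolding \<eta>(2)[symmetric] by (simp add: mult_exp_exp algebra_simps)
      finally have "exp v \<le> 1 + v + (norm h)\<^sup>2 * (2 / \<eta>\<^sup>2) * exp (\<delta> * y)"
        using exp_le_quadratic[of v] by linarith
      then have "exp (\<theta> \<bullet> Y \<omega>) * exp v \<le> exp (\<theta> \<bullet> Y \<omega>) * (1 + v + (norm h)\<^sup>2 * (2 / \<eta>\<^sup>2) * exp (\<delta> * y))"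
        by (intro mult_left_mono) auto
      then show ?thesis
        by (simp add: inner_add_left exp_add v_def[symmetric] y_def[symmetric] distrib_left distrib_right mult_ac)
    qed
    have intu: "integrable M ?u"
      using int int0 int1 by (intro Bochner_Integration.integrable_add integrable_inner_right integrable_mult_right) auto
    have inth: "integrable M (\<lambda>\<omega>. exp ((\<theta> + h) \<bullet> Y \<omega>))"
      by (rule Bochner_Integration.integrable_bound[OF intu]) (simp_all only: real_norm_def abs_exp_cancel always_eventually order_trans[OF ptw abs_ge_self], simp_all)
    moreover have "mgf (\<theta> + h) \<le> expectation ?u"
      unfolding mgf_def by (rule integral_mono[OF inth intu ptw])
    moreover have "expectation ?u = mgf \<theta> + h \<bullet> tilted_mean \<theta> + C * (norm h)\<^sup>2"
      using int int0 int1 by (simp add: mgf_def tilted_mean_def C_def del: inner_scaleR_right)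
    ultimately show ?thesis by (simp add: dom_iff)
  qed
  show ?thesis using that[OF \<eta>(1) C] main by blast
qed

lemma interior_K:
  assumes "\<theta> \<in> dom_fun (log_mgf M Y)" "mgf \<theta> < 1"
  shows "\<theta> \<in> interior K"
proof -
  obtain \<eta> C where q: "0 < \<eta>" "0 \<le> C"
    "\<And>h. norm h \<le> \<eta> \<Longrightarrow> \<theta> + h \<in> dom_fun (log_mgf M Y)"
    "\<And>h. norm h \<le> \<eta> \<Longrightarrow> mgf (\<theta> + h) \<le> mgf \<theta> + h \<bullet> tilted_mean \<theta> + C * (norm h)\<^sup>2"
    using mgf_quadratic_bound[OF assms(1)] by blast
  have "((\<lambda>h. mgf \<theta> + h \<bullet> tilted_mean \<theta> + C * (norm h)\<^sup>2) \<longlongrightarrow> mgf \<theta> + 0 \<bullet> tilted_mean \<theta> + C * (norm (0::real^'n))\<^sup>2) (nhds 0)"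
    by (intro tendsto_intros filterlim_ident)
  then have "eventually (\<lambda>h. mgf \<theta> + h \<bullet> tilted_mean \<theta> + C * (norm h)\<^sup>2 < 1) (nhds 0)"
    by (rule order_tendstoD(2)) (use assms in simp)
  then obtain d where d: "0 < d" "\<And>h. dist h 0 < d \<Longrightarrow> mgf \<theta> + h \<bullet> tilted_mean \<theta> + C * (norm h)\<^sup>2 < 1"
    by (auto simp: eventually_nhds_metric)
  have "ball \<theta> (min d \<eta>) \<subseteq> K"
  proof
    fix x assume "x \<in> ball \<theta> (min d \<eta>)"
    then have n: "norm (x - \<theta>) < d" "norm (x - \<theta>) \<le> \<eta>" by (auto simp: dist_norm norm_minus_commute)
    then show "x \<in> K"
      using q(3,4)[OF n(2)] d(2)[of "x - \<theta>"] by (auto simp: K_iff)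
  qed
  then show ?thesis using d q(1) by (meson centre_in_ball interior_maximal min_less_iff_conj open_ball subset_iff)
qed

text \<open>A nonnegative integral presupposes no integrability, so Fatou's lemma can be applied at
  a limit point not yet known to lie in the domain.\<close>

lemma K_iff_nn: "\<theta> \<in> K \<longleftrightarrow> (\<integral>\<^sup>+ \<omega>. ennreal (exp (\<theta> \<bullet> Y \<omega>)) \<partial>M) \<le> 1"
proof
  assume "\<theta> \<in> K"
  then show "(\<integral>\<^sup>+ \<omega>. ennreal (exp (\<theta> \<bullet> Y \<omega>)) \<partial>M) \<le> 1"
    by (subst nn_integral_eq_integral) (auto simp: K_iff dom_iff mgf_def)
next
  assume le: "(\<integral>\<^sup>+ \<omega>. ennreal (exp (\<theta> \<bullet> Y \<omega>)) \<partial>M) \<le> 1"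
  then have int: "integrable M (\<lambda>\<omega>. exp (\<theta> \<bullet> Y \<omega>))"
    by (intro integrableI_bounded) (auto intro: le_less_trans)
  then show "\<theta> \<in> K"
    using le by (subst (asm) nn_integral_eq_integral) (auto simp: K_iff dom_iff mgf_def)
qed

lemma closed_K: "closed K"
proof (unfold closed_sequential_limits, intro allI impI)
  fix x l assume x: "(\<forall>n. x n \<in> K) \<and> x \<longlonglongrightarrow> l"
  have "(\<lambda>n. ennreal (exp (x n \<bullet> Y \<omega>))) \<longlonglongrightarrow> ennreal (exp (l \<bullet> Y \<omega>))" for \<omega>
    using x by (intro tendsto_intros) auto
  then have "(\<integral>\<^sup>+ \<omega>. ennreal (exp (l \<bullet> Y \<omega>)) \<partial>M) = (\<integral>\<^sup>+ \<omega>. liminf (\<lambda>n. ennreal (exp (x n \<bullet> Y \<omega>))) \<partial>M)"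
    by (intro nn_integral_cong lim_imp_Liminf[symmetric]) auto
  also have "\<dots> \<le> liminf (\<lambda>n. \<integral>\<^sup>+ \<omega>. ennreal (exp (x n \<bullet> Y \<omega>)) \<partial>M)"
    by (rule nn_integral_liminf) simp
  also have "\<dots> \<le> liminf (\<lambda>n. 1)"
    using x by (intro Liminf_mono always_eventually) (simp add: K_iff_nn)
  finally show "l \<in> K" by (simp add: K_iff_nn Liminf_const)
qed

lemma convex_K: "convex K"
proof (rule convexI)
  fix x y :: "real^'n" and u v :: real
  assume xy: "x \<in> K" "y \<in> K" and uv: "0 \<le> u" "0 \<le> v" "u + v = 1"
  have le: "exp ((u *\<^sub>R x + v *\<^sub>R y) \<bullet> Y \<omega>) \<le> u * exp (x \<bullet> Y \<omega>) + v * exp (y \<bullet> Y \<omega>)" for \<omega>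
  proof -
    have u: "u = 1 - v" using uv by simp
    show ?thesis unfolding u
      using convex_onD[OF exp_convex, of v "x \<bullet> Y \<omega>" "y \<bullet> Y \<omega>"] uv by (simp add: inner_add_left)
  qed
  have int: "integrable M (\<lambda>\<omega>. exp (x \<bullet> Y \<omega>))" "integrable M (\<lambda>\<omega>. exp (y \<bullet> Y \<omega>))"
    using xy by (auto simp: K_iff dom_iff)
  then have int': "integrable M (\<lambda>\<omega>. u * exp (x \<bullet> Y \<omega>) + v * exp (y \<bullet> Y \<omega>))" by simp
  have int'': "integrable M (\<lambda>\<omega>. exp ((u *\<^sub>R x + v *\<^sub>R y) \<bullet> Y \<omega>))"
    by (rule Bochner_Integration.integrable_bound[OF int']) (auto intro!: always_eventually order_trans[OF le])
  moreover have "mgf (u *\<^sub>R x + v *\<^sub>R y) \<le> u * mgf x + v * mgf y"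
    using integral_mono[OF int'' int' le] int by (simp add: mgf_def)
  moreover have "u * mgf x + v * mgf y \<le> u * 1 + v * 1"
    using xy uv by (intro add_mono mult_left_mono) (auto simp: K_iff)
  ultimately show "u *\<^sub>R x + v *\<^sub>R y \<in> K" using uv by (simp add: K_iff dom_iff)
qed

text \<open>Strict convexity without derivatives: the gap between the endpoint sum and twice the
  midpoint is the expectation of a perfect square, which vanishes only if both exponents agree
  almost surely.\<close>

lemma mgf_midpoint_less:
  assumes "a \<in> K" "b \<in> K" and nondeg: "\<not> (AE \<omega> in M. (a - b) \<bullet> Y \<omega> = 0)"
  shows "midpoint a b \<in> K" "mgf (midpoint a b) < 1"
proof -
  let ?m = "midpoint a b"
  show m: "?m \<in> K" using convexD[OF convex_K assms(1,2), of "1/2" "1/2"]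
    by (simp add: midpoint_def scaleR_add_right)
  have int: "integrable M (\<lambda>\<omega>. exp (a \<bullet> Y \<omega>))" "integrable M (\<lambda>\<omega>. exp (b \<bullet> Y \<omega>))"
      "integrable M (\<lambda>\<omega>. exp (?m \<bullet> Y \<omega>))"
    using assms m by (auto simp: K_iff dom_iff)
  let ?g = "\<lambda>\<omega>. exp (a \<bullet> Y \<omega>) + exp (b \<bullet> Y \<omega>) - 2 * exp (?m \<bullet> Y \<omega>)"
  have sq: "?g \<omega> = (exp (a \<bullet> Y \<omega> / 2) - exp (b \<bullet> Y \<omega> / 2))\<^sup>2" for \<omega>
    by (simp add: power2_diff exp_double[symmetric] midpoint_def inner_add_left add_divide_distrib exp_add)
  have intg: "integrable M ?g" using int by simp
  have eg: "expectation ?g = mgf a + mgf b - 2 * mgf ?m" using int by (simp add: mgf_def)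
  show "mgf ?m < 1"
  proof (rule ccontr)
    assume "\<not> mgf ?m < 1"
    then have "expectation ?g \<le> 0" using assms eg by (auto simp: K_iff)
    moreover have "0 \<le> expectation ?g" by (rule integral_nonneg_AE) (simp add: sq)
    ultimately have "expectation ?g = 0" by simp
    then have "AE \<omega> in M. ?g \<omega> = 0"
      by (subst integral_nonneg_eq_0_iff_AE[symmetric, OF intg]) (simp_all add: sq)
    then have "AE \<omega> in M. (a - b) \<bullet> Y \<omega> = 0"
      by eventually_elim (simp add: sq inner_diff_left)
    with nondeg show False by blast
  qed
qed

end

section \<open>Order statistics of the coordinates\<close>

text \<open>Replaces the sorted list by a sorting bijection, along which counts and sums of order
  statistics can be reindexed.\<close>

lemma dec_abs_permutation:
  fixes \<theta> :: "real^'n::finite"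
  obtains \<sigma> where "bij_betw \<sigma> {1..CARD('n)} UNIV"
    "\<And>i. i \<in> {1..CARD('n)} \<Longrightarrow> dec_abs \<theta> i = \<bar>\<theta> $ \<sigma> i\<bar>"
    "\<And>i j. \<lbrakk>1 \<le> i; i \<le> j; j \<le> CARD('n)\<rbrakk> \<Longrightarrow> dec_abs \<theta> j \<le> dec_abs \<theta> i"
proof -
  let ?f = "\<lambda>k. \<bar>\<theta> $ k\<bar>"
  obtain ks where ks: "set ks = (UNIV :: 'n set)" "distinct ks"
    using finite_distinct_list[OF finite_class.finite_UNIV] by metis
  define ls where "ls = sort_key ?f ks"
  have ls: "set ls = UNIV" "distinct ls" "sorted (map ?f ls)"
    using ks by (auto simp: ls_def)
  have len: "length ls = CARD('n)" using ls distinct_card by metis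
  have ms: "mset ls = mset_set UNIV" using ls by (metis mset_set_set)
  have "sorted_list_of_multiset (image_mset ?f (mset_set UNIV)) = map ?f ls"
    unfolding ms[symmetric] mset_map[symmetric] sorted_list_of_multiset_mset
    using ls(3) by (simp add: sorted_sort_id)
  then have dec: "dec_abs \<theta> i = rev (map ?f ls) ! (i - 1)" for i
    by (simp add: dec_abs_def)
  define \<sigma> where "\<sigma> i = rev ls ! (i - 1)" for i
  have "bij_betw ((!) (rev ls)) {..<CARD('n)} UNIV"
    using bij_betw_nth[of "rev ls"] ls len by simp
  moreover have "bij_betw (\<lambda>i. i - 1) {1..CARD('n)} {..<CARD('n)}"
    by (rule bij_betwI[where g = Suc]) auto
  ultimately have "bij_betw \<sigma> {1..CARD('n)} UNIV"
    unfolding \<sigma>_def by (rule bij_betw_trans[unfolded comp_def, rotated])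
  moreover have "dec_abs \<theta> i = \<bar>\<theta> $ \<sigma> i\<bar>" if "i \<in> {1..CARD('n)}" for i
  proof -
    have "i - 1 < length (rev ls)" using that len by auto
    then show ?thesis by (simp only: dec \<sigma>_def rev_map nth_map)
  qed
  moreover have "dec_abs \<theta> j \<le> dec_abs \<theta> i" if "1 \<le> i" "i \<le> j" "j \<le> CARD('n)" for i j
    using sorted_rev_nth_mono[of "rev (map ?f ls)" "i - 1" "j - 1"] ls(3) that len by (simp add: dec)
  ultimately show thesis by (rule that)
qed

text \<open>By monotonicity the indices j with \<open>t \<le> dec_abs \<theta> j\<close> form an
  initial segment, so only its length matters.\<close>

lemma dec_abs_ge_iff:
  fixes \<theta> :: "real^'n::finite"
  assumes "1 \<le> i" "i \<le> CARD('n)"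
  shows "t \<le> dec_abs \<theta> i \<longleftrightarrow> i \<le> card {k. t \<le> \<bar>\<theta> $ k\<bar>}"
proof -
  obtain \<sigma> where bij: "bij_betw \<sigma> {1..CARD('n)} UNIV"
    and dec: "\<And>i. i \<in> {1..CARD('n)} \<Longrightarrow> dec_abs \<theta> i = \<bar>\<theta> $ \<sigma> i\<bar>"
    and anti: "\<And>i j. \<lbrakk>1 \<le> i; i \<le> j; j \<le> CARD('n)\<rbrakk> \<Longrightarrow> dec_abs \<theta> j \<le> dec_abs \<theta> i"
    using dec_abs_permutation by metis
  have "{k. t \<le> \<bar>\<theta> $ k\<bar>} = \<sigma> ` {j \<in> {1..CARD('n)}. t \<le> dec_abs \<theta> j}"
    using bij dec by (auto simp: bij_betw_def image_iff set_eq_iff) (metis UNIV_I atLeastAtMost_iff imageE)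
  moreover have "inj_on \<sigma> {j \<in> {1..CARD('n)}. t \<le> dec_abs \<theta> j}"
    using bij by (auto simp: bij_betw_def intro: inj_on_subset)
  ultimately have card: "card {k. t \<le> \<bar>\<theta> $ k\<bar>} = card {j \<in> {1..CARD('n)}. t \<le> dec_abs \<theta> j}"
    by (simp add: card_image)
  show ?thesis
  proof
    assume "t \<le> dec_abs \<theta> i"
    then have "{1..i} \<subseteq> {j \<in> {1..CARD('n)}. t \<le> dec_abs \<theta> j}"
      using anti assms by (auto intro: order_trans)
    then have "card {1..i} \<le> card {j \<in> {1..CARD('n)}. t \<le> dec_abs \<theta> j}" by (intro card_mono) auto
    then show "i \<le> card {k. t \<le> \<bar>\<theta> $ k\<bar>}" using card by simp
  next
    assume i: "i \<le> card {k. t \<le> \<bar>\<theta> $ k\<bar>}"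
    show "t \<le> dec_abs \<theta> i"
    proof (rule ccontr)
      assume "\<not> t \<le> dec_abs \<theta> i"
      then have "{j \<in> {1..CARD('n)}. t \<le> dec_abs \<theta> j} \<subseteq> {1..<i}"
        using anti[of i] assms by (force simp: not_le)
      then have "card {j \<in> {1..CARD('n)}. t \<le> dec_abs \<theta> j} \<le> card {1..<i}" by (intro card_mono) auto
      then show False using i card assms by simp
    qed
  qed
qed

lemma dec_abs_nonneg:
  fixes \<theta> :: "real^'n::finite"
  assumes "1 \<le> i" "i \<le> CARD('n)"
  shows "0 \<le> dec_abs \<theta> i"
  using dec_abs_ge_iff[OF assms] assms by simp

text \<open>A positive t keeps the zeros outside A from being counted, so L coordinates reach t only
  if all of A do.\<close>

lemma dec_abs_ge_iff_support:
  fixes \<theta> :: "real^'n::finite"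
  assumes "card A = L" "1 \<le> L" "\<And>k. k \<notin> A \<Longrightarrow> \<theta> $ k = 0" "0 < t"
  shows "t \<le> dec_abs \<theta> L \<longleftrightarrow> (\<forall>k\<in>A. t \<le> \<bar>\<theta> $ k\<bar>)"
proof -
  have "L \<le> CARD('n)" using assms(1) card_mono[of UNIV A] by simp
  have sub: "{k. t \<le> \<bar>\<theta> $ k\<bar>} \<subseteq> A" using assms(3,4) by force
  have "t \<le> dec_abs \<theta> L \<longleftrightarrow> card A \<le> card {k. t \<le> \<bar>\<theta> $ k\<bar>}"
    using dec_abs_ge_iff[OF assms(2) \<open>L \<le> _\<close>] assms(1) by simp
  also have "\<dots> \<longleftrightarrow> A = {k. t \<le> \<bar>\<theta> $ k\<bar>}"
    using card_seteq[OF _ sub] by auto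
  also have "\<dots> \<longleftrightarrow> (\<forall>k\<in>A. t \<le> \<bar>\<theta> $ k\<bar>)" using sub by auto
  finally show ?thesis .
qed

text \<open>Both sums have m = \<open>card S\<close> terms, so the m-th largest value t may be
  subtracted from every term. After that, indices beyond m contribute nonpositive terms and indices
  up to m nonnegative ones.\<close>

lemma sum_le_dec_abs:
  fixes \<theta> :: "real^'n::finite"
  shows "(\<Sum>k\<in>S. \<bar>\<theta> $ k\<bar>) \<le> (\<Sum>i=1..card S. dec_abs \<theta> i)"
proof (cases "S = {}")
  case False
  obtain \<sigma> where bij: "bij_betw \<sigma> {1..CARD('n)} UNIV"
    and dec: "\<And>i. i \<in> {1..CARD('n)} \<Longrightarrow> dec_abs \<theta> i = \<bar>\<theta> $ \<sigma> i\<bar>"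
    and anti: "\<And>i j. \<lbrakk>1 \<le> i; i \<le> j; j \<le> CARD('n)\<rbrakk> \<Longrightarrow> dec_abs \<theta> j \<le> dec_abs \<theta> i"
    using dec_abs_permutation by metis
  define m where "m = card S"
  have m: "1 \<le> m" "m \<le> CARD('n)"
    using False card_mono[of UNIV S] by (auto simp: m_def card_gt_0_iff Suc_le_eq)
  define t where "t = dec_abs \<theta> m"
  define J where "J = {j \<in> {1..CARD('n)}. \<sigma> j \<in> S}"
  have "bij_betw \<sigma> J S"
    unfolding bij_betw_def
  proof
    show "inj_on \<sigma> J" using bij by (auto simp: J_def bij_betw_def intro: inj_on_subset)
    show "\<sigma> ` J = S"
    proof (intro equalityI subsetI)
      fix k assume "k \<in> S"
      moreover have "k \<in> \<sigma> ` {1..CARD('n)}" using bij by (simp add: bij_betw_def)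
      ultimately show "k \<in> \<sigma> ` J" by (auto simp: J_def)
    qed (auto simp: J_def)
  qed
  then have sumS: "(\<Sum>k\<in>S. \<bar>\<theta> $ k\<bar>) = (\<Sum>j\<in>J. dec_abs \<theta> j)" and cJ: "card J = m"
    using dec by (auto simp: sum.reindex_bij_betw[symmetric] J_def m_def bij_betw_same_card intro!: sum.cong)
  have fJ: "finite J" by (simp add: J_def)
  have "(\<Sum>j\<in>J. dec_abs \<theta> j - t) \<le> (\<Sum>j\<in>J \<inter> {1..m}. dec_abs \<theta> j - t)"
  proof -
    have "(\<Sum>j\<in>J. dec_abs \<theta> j - t) = (\<Sum>j\<in>J \<inter> {1..m}. dec_abs \<theta> j - t) + (\<Sum>j\<in>J - {1..m}. dec_abs \<theta> j - t)"
      by (rule sum.Int_Diff[OF fJ])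
    moreover have "(\<Sum>j\<in>J - {1..m}. dec_abs \<theta> j - t) \<le> 0"
      using anti m by (intro sum_nonpos) (auto simp: J_def t_def)
    ultimately show ?thesis by linarith
  qed
  also have "\<dots> \<le> (\<Sum>j\<in>{1..m}. dec_abs \<theta> j - t)"
    using anti m by (intro sum_mono2) (auto simp: t_def)
  finally show ?thesis using cJ by (simp add: sumS sum_subtractf m_def)
qed simp

lemma sum_dec_abs_le:
  fixes \<theta> :: "real^'n::finite"
  assumes "m \<le> CARD('n)"
  shows "(\<Sum>i=1..m. dec_abs \<theta> i) \<le> (\<Sum>k\<in>UNIV. \<bar>\<theta> $ k\<bar>)"
proof -
  obtain \<sigma> where bij: "bij_betw \<sigma> {1..CARD('n)} UNIV"
    and dec: "\<And>i. i \<in> {1..CARD('n)} \<Longrightarrow> dec_abs \<theta> i = \<bar>\<theta> $ \<sigma> i\<bar>"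
    using dec_abs_permutation by metis
  have "(\<Sum>i=1..m. dec_abs \<theta> i) \<le> (\<Sum>i=1..CARD('n). dec_abs \<theta> i)"
    using assms by (intro sum_mono2) (auto intro: dec_abs_nonneg)
  also have "\<dots> = (\<Sum>k\<in>UNIV. \<bar>\<theta> $ k\<bar>)"
    unfolding sum.reindex_bij_betw[OF bij, symmetric] by (intro sum.cong refl dec)
  finally show ?thesis .
qed

text \<open>The L + 1 largest values sum to at most the total over B, and the L - l coordinates
  outside T to at most the L - l largest values; subtracting leaves the tail of the l + 1
  smallest.\<close>

lemma sum_dec_abs_tail_le:
  fixes \<theta> :: "real^'n::finite"
  assumes B: "card B = L + 1" "\<And>k. k \<notin> B \<Longrightarrow> \<theta> $ k = 0"
    and T: "T \<subseteq> B" "card T = l + 1" "l \<le> L"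
  shows "(\<Sum>i=L - l + 1..L + 1. dec_abs \<theta> i) \<le> (\<Sum>k\<in>T. \<bar>\<theta> $ k\<bar>)"
proof -
  have cd: "L + 1 \<le> CARD('n)" using B(1) card_mono[of UNIV B] by simp
  have cBT: "card (B - T) = L - l" using B T by (simp add: card_Diff_subset finite_subset)
  have "{1..L+1} = {1..L - l} \<union> {L - l + 1..L + 1}" by auto
  then have "(\<Sum>i=1..L+1. dec_abs \<theta> i) = (\<Sum>i=1..L - l. dec_abs \<theta> i) + (\<Sum>i=L - l + 1..L + 1. dec_abs \<theta> i)"
    by (simp only:) (rule sum.union_disjoint, auto)
  moreover have "(\<Sum>i=1..L+1. dec_abs \<theta> i) \<le> (\<Sum>k\<in>B. \<bar>\<theta> $ k\<bar>)"
    using sum_dec_abs_le[OF cd, of \<theta>] B(2) sum.mono_neutral_left[of UNIV B "\<lambda>k. \<bar>\<theta> $ k\<bar>"] by simp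
  moreover have "(\<Sum>k\<in>B - T. \<bar>\<theta> $ k\<bar>) \<le> (\<Sum>i=1..L - l. dec_abs \<theta> i)"
    using sum_le_dec_abs[of \<theta> "B - T"] cBT by simp
  moreover have "(\<Sum>k\<in>B. \<bar>\<theta> $ k\<bar>) = (\<Sum>k\<in>B - T. \<bar>\<theta> $ k\<bar>) + (\<Sum>k\<in>T. \<bar>\<theta> $ k\<bar>)"
    using T by (intro sum.subset_diff) auto
  ultimately show ?thesis by linarith
qed

text \<open>Linear programming bound by peeling off layers: subtract the minimum of \<open>x\<close> on its
  support and induct on the size of the support.\<close>

lemma weighted_sum_ge:
  fixes \<theta> x :: "'i \<Rightarrow> real"
  assumes "finite B"
    and "\<And>T. \<lbrakk>T \<subseteq> B; T \<noteq> {}\<rbrakk> \<Longrightarrow> v * (real (card T) - 1) \<le> sum \<theta> T"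
    and "\<And>k. k \<in> B \<Longrightarrow> 0 \<le> x k" "j \<in> B" "\<And>k. k \<in> B \<Longrightarrow> x k \<le> x j"
  shows "v * (sum x B - x j) \<le> (\<Sum>k\<in>B. \<theta> k * x k)"
  using assms(3-)
proof (induction "card {k\<in>B. x k \<noteq> 0}" arbitrary: x rule: less_induct)
  case less
  define T where "T = {k\<in>B. x k \<noteq> 0}"
  have T: "T \<subseteq> B" "finite T" using assms(1) by (auto simp: T_def)
  show ?case
  proof (cases "T = {}")
    case True
    then have "\<And>k. k \<in> B \<Longrightarrow> x k = 0" by (auto simp: T_def)
    then show ?thesis using less.prems by simp
  next
    case False
    define m where "m = Min (x ` T)"
    have "m \<in> x ` T" unfolding m_def using T False by (intro Min_in) auto
    then obtain i where i: "i \<in> T" "x i = m" by auto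
    have m_le: "m \<le> x k" if "k \<in> T" for k using T that by (simp add: m_def)
    have jT: "j \<in> T"
      using i less.prems(1,3)[of i] \<open>j \<in> B\<close> by (auto simp: T_def)
    define y where "y k = (if k \<in> T then x k - m else 0)" for k
    have y0: "0 \<le> y k" for k using m_le by (simp add: y_def)
    have yj: "y k \<le> y j" if "k \<in> B" for k
      using less.prems(3)[OF that] jT y0[of j] by (auto simp: y_def)
    have "{k\<in>B. y k \<noteq> 0} \<subset> T" using i by (auto simp: y_def)
    then have "card {k\<in>B. y k \<noteq> 0} < card {k\<in>B. x k \<noteq> 0}"
      using T psubset_card_mono unfolding T_def by blast
    then have IH: "v * (sum y B - y j) \<le> (\<Sum>k\<in>B. \<theta> k * y k)"
      using less.hyps[of y] y0 yj less.prems(2) by blast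
    have xy: "x k = y k + (if k \<in> T then m else 0)" if "k \<in> B" for k
      using that by (auto simp: y_def T_def)
    have mpos: "0 \<le> m" using i less.prems(1) T by auto
    have "sum x B = sum y B + m * real (card T)"
      using T assms(1) by (simp add: xy sum.distrib sum.If_cases Int_absorb1 cong: sum.cong)
    moreover have "(\<Sum>k\<in>B. \<theta> k * x k) = (\<Sum>k\<in>B. \<theta> k * y k) + m * sum \<theta> T"
    proof -
      have "(\<Sum>k\<in>B. \<theta> k * x k) = (\<Sum>k\<in>B. \<theta> k * y k + (if k \<in> T then m * \<theta> k else 0))"
        by (intro sum.cong) (auto simp: xy algebra_simps)
      then show ?thesis using T assms(1)
        by (simp add: sum.distrib sum.If_cases Int_absorb1 sum_distrib_left)
    qed
    moreover have "x j = y j + m" using jT T by (simp add: y_def)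
    moreover have "m * (v * (real (card T) - 1)) \<le> m * sum \<theta> T"
      using assms(2)[OF T(1) False] mpos by (rule mult_left_mono)
    ultimately show ?thesis using IH by (simp add: algebra_simps)
  qed
qed

text \<open>Discarding the largest coordinate of x on B leaves L coordinates whose sum exceeds 1,
  which is the factor of v in \<open>weighted_sum_ge\<close>. The hypothesis there for a set T of l
  + 1 elements is the l-th term of the minimum v; for singletons it only says that \<theta> is
  nonnegative.\<close>

lemma target_inner_ge:
  fixes \<theta> :: "real^'n::finite"
  assumes "1 \<le> L" and B: "card B = L + 1" "B \<subseteq> A"
    and \<theta>: "\<And>k. k \<in> B \<Longrightarrow> 0 \<le> \<theta> $ k" "\<And>k. k \<notin> B \<Longrightarrow> \<theta> $ k = 0"
    and x: "x \<in> target L A"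
  shows "(MIN l\<in>{1..L}. (1 / real l) * (\<Sum>i = L - l + 1..L + 1. dec_abs \<theta> i)) \<le> \<theta> \<bullet> x"
proof -
  define v where "v = (MIN l\<in>{1..L}. (1 / real l) * (\<Sum>i = L - l + 1..L + 1. dec_abs \<theta> i))"
  have fB: "finite B" "B \<noteq> {}" using B by auto
  have v_le: "v \<le> (1 / real l) * (\<Sum>i = L - l + 1..L + 1. dec_abs \<theta> i)" if "l \<in> {1..L}" for l
    unfolding v_def using that by (intro Min_le) auto
  have cd: "L + 1 \<le> CARD('n)" using B(1) card_mono[of UNIV B] by simp
  have v0: "0 \<le> v"
    unfolding v_def using assms(1) cd
    by (subst Min_ge_iff) (auto simp del: sum.cl_ivl_Suc intro!: divide_nonneg_nonneg sum_nonneg dec_abs_nonneg)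
  have sub: "v * (real (card T) - 1) \<le> (\<Sum>k\<in>T. \<theta> $ k)" if T: "T \<subseteq> B" "T \<noteq> {}" for T
  proof (cases "card T = 1")
    case True
    then show ?thesis using \<theta>(1) T by (auto intro!: sum_nonneg)
  next
    case False
    define l where "l = card T - 1"
    have "0 < card T" using T by (simp add: card_gt_0_iff)
    then have cT: "card T = l + 1" "l \<in> {1..L}"
      using False B(1) card_mono[OF fB(1) T(1)] by (auto simp: l_def)
    have "(\<Sum>i = L - l + 1..L + 1. dec_abs \<theta> i) \<le> (\<Sum>k\<in>T. \<bar>\<theta> $ k\<bar>)"
      using cT by (intro sum_dec_abs_tail_le[OF B(1) \<theta>(2) T(1)]) auto
    also have "\<dots> = (\<Sum>k\<in>T. \<theta> $ k)" using \<theta>(1) T(1) by (intro sum.cong) auto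
    finally show ?thesis using v_le[OF cT(2)] cT by (simp add: field_simps)
  qed
  obtain j where j: "j \<in> B" "\<And>k. k \<in> B \<Longrightarrow> x $ k \<le> x $ j"
    using finite_attains_max[OF fB, of "($) x"] by blast
  have xpos: "0 < x $ k" if "k \<in> B" for k using x B(2) that by (auto simp: target_def)
  have "B - {j} \<in> card_eq_sets L" using B j by (simp add: card_eq_sets_def)
  then have "1 < (\<Sum>k\<in>B - {j}. \<bar>x $ k\<bar>)" using x by (simp add: target_def)
  also have "\<dots> = (\<Sum>k\<in>B - {j}. x $ k)" using xpos by (intro sum.cong) (auto simp: less_imp_le)
  also have "\<dots> = (\<Sum>k\<in>B. x $ k) - x $ j" using j fB by (simp add: sum_diff1)
  finally have "v * 1 \<le> v * ((\<Sum>k\<in>B. x $ k) - x $ j)" using v0 by (intro mult_left_mono) auto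
  also have "\<dots> \<le> (\<Sum>k\<in>B. \<theta> $ k * x $ k)"
    using weighted_sum_ge[OF fB(1) sub, of "($) x" j] j xpos by (auto simp: less_imp_le)
  also have "\<dots> = \<theta> \<bullet> x"
    unfolding inner_vec_def inner_real_def using \<theta>(2) by (intro sum.mono_neutral_left) auto
  finally show ?thesis by (simp add: v_def)
qed

section \<open>Supporting functionals of the targets\<close>

definition orthant_sign :: "'n set \<Rightarrow> 'n \<Rightarrow> real" where
  "orthant_sign A k = (if k \<in> A then 1 else -1)"

text \<open>Inside a fixed orthant the absolute values are linear, so the target is a finite
  intersection of open half-spaces; convexity and openness follow together.\<close>

lemma target_eq_halfspaces:
  fixes A :: "'n::finite set"
  shows "target L A = (\<Inter>k\<in>UNIV. {x. 0 < (orthant_sign A k *\<^sub>R axis k 1) \<bullet> x}) \<inter>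
    (\<Inter>B\<in>card_eq_sets L. {x. 1 < (\<chi> k. if k \<in> B then orthant_sign A k else 0) \<bullet> x})"
    (is "_ = ?S \<inter> ?T")
proof -
  have S: "x \<in> ?S \<longleftrightarrow> (\<forall>k\<in>A. 0 < x $ k) \<and> (\<forall>k\<in>-A. x $ k < 0)" for x
    by (auto simp: orthant_sign_def inner_axis' split: if_splits)
  have inner: "(\<chi> k. if k \<in> B then orthant_sign A k else 0) \<bullet> x = (\<Sum>k\<in>B. \<bar>x $ k\<bar>)"
    if "(\<forall>k\<in>A. 0 < x $ k) \<and> (\<forall>k\<in>-A. x $ k < 0)" for B and x :: "real^'n"
  proof -
    have "(\<chi> k. if k \<in> B then orthant_sign A k else 0) \<bullet> x = (\<Sum>k\<in>UNIV. if k \<in> B then \<bar>x $ k\<bar> else 0)"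
      unfolding inner_vec_def using that by (intro sum.cong) (force simp: orthant_sign_def abs_if)+
    then show ?thesis by (simp add: sum.If_cases)
  qed
  show ?thesis
    unfolding target_def using S inner by auto
qed

lemma convex_target: "convex (target L A)"
  unfolding target_eq_halfspaces by (intro convex_Int convex_INT convex_halfspace_gt)

lemma open_target: "open (target L (A :: 'n::finite set))"
  unfolding target_eq_halfspaces by (intro open_Int open_INT ballI open_halfspace_gt) auto

lemma target_sum_gt:
  assumes "x \<in> target L A" "card B = L" "B \<subseteq> A"
  shows "1 < (\<Sum>k\<in>B. x $ k)"
proof -
  have "(\<Sum>k\<in>B. \<bar>x $ k\<bar>) = (\<Sum>k\<in>B. x $ k)"
    using assms by (intro sum.cong) (auto simp: target_def less_imp_le subset_iff)
  then show ?thesis using assms by (auto simp: target_def card_eq_sets_def)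
qed

text \<open>Farkas' lemma for a single strict constraint. If x had a component p orthogonal to m,
  then p tilted slightly against m would violate the inclusion.\<close>

lemma parallel_if_halfspace_subset:
  fixes m x :: "'v::real_inner"
  assumes "m \<noteq> 0" "x \<noteq> 0" and le: "\<And>w. w \<bullet> m < 0 \<Longrightarrow> w \<bullet> x \<le> 0"
  obtains c where "0 < c" "x = c *\<^sub>R m"
proof -
  have mm: "0 < m \<bullet> m" using assms(1) by simp
  define c where "c = (x \<bullet> m) / (m \<bullet> m)"
  define p where "p = x - c *\<^sub>R m"
  have pm: "p \<bullet> m = 0" using mm by (simp add: p_def c_def inner_diff_left)
  have px: "p \<bullet> x = p \<bullet> p" using pm by (simp add: p_def inner_diff_right inner_commute)
  have "p = 0"
  proof (rule ccontr)
    assume "p \<noteq> 0"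
    then have pp: "0 < p \<bullet> p" by simp
    \<comment> \<open>Small enough that the tilt changes the inner product with x by less than
      \<open>p \<bullet> p\<close>; the summand 1 covers \<open>m \<bullet> x = 0\<close>.\<close>
    define \<delta> where "\<delta> = p \<bullet> p / (2 * (\<bar>m \<bullet> x\<bar> + 1))"
    have d: "0 < \<delta>" using pp by (simp add: \<delta>_def add_nonneg_pos)
    have "(p - \<delta> *\<^sub>R m) \<bullet> x \<le> 0"
      by (rule le) (use pm d mm in \<open>simp add: inner_diff_left\<close>)
    then have "p \<bullet> p \<le> \<delta> * \<bar>m \<bullet> x\<bar>"
      using px d by (simp add: inner_diff_left) (smt (verit) mult_left_mono)
    also have "\<dots> < \<delta> * (2 * (\<bar>m \<bullet> x\<bar> + 1))" using d by (intro mult_strict_left_mono) auto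
    also have "\<dots> = p \<bullet> p" by (simp add: \<delta>_def)
    finally show False by simp
  qed
  then have x: "x = c *\<^sub>R m" by (simp add: p_def)
  have "- (m \<bullet> x) \<le> 0" using le[of "- m"] mm by simp
  then have "0 \<le> c" using mm by (simp add: c_def inner_commute)
  moreover have "c \<noteq> 0" using x assms(2) by auto
  ultimately show thesis using that[of c] x by simp
qed

section \<open>The rate function and descent directions of K\<close>

context mgf_rv
begin

abbreviation "I \<equiv> rate (log_mgf M Y)"

lemma rate_upper: "\<theta> \<in> K \<Longrightarrow> ereal (\<theta> \<bullet> x) \<le> I x"
  unfolding rate_def K_def by (rule SUP_upper)

lemma rate_le_iff: "I x \<le> ereal c \<longleftrightarrow> (\<forall>\<theta>\<in>K. \<theta> \<bullet> x \<le> c)"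
  by (simp add: rate_def K_def SUP_le_iff)

lemma rate_nonneg: "0 \<le> I x"
  using rate_upper[OF zero_in_K, of x] by (simp add: zero_ereal_def)

lemma rate_finite_iff: "I x < \<infinity> \<longleftrightarrow> (\<exists>c. \<forall>\<theta>\<in>K. \<theta> \<bullet> x \<le> c)"
proof
  assume "I x < \<infinity>"
  then obtain c where "I x = ereal c" using rate_nonneg[of x] by (cases "I x") auto
  then show "\<exists>c. \<forall>\<theta>\<in>K. \<theta> \<bullet> x \<le> c" using rate_le_iff[of x c] by auto
next
  assume "\<exists>c. \<forall>\<theta>\<in>K. \<theta> \<bullet> x \<le> c"
  then obtain c where "I x \<le> ereal c" unfolding rate_le_iff by blast
  then show "I x < \<infinity>" by (rule le_less_trans) simp
qed

lemma convex_rate_finite: "convex {x. I x < \<infinity>}"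
proof (rule convexI)
  fix x y :: "real^'n" and u v :: real
  assume "x \<in> {x. I x < \<infinity>}" "y \<in> {x. I x < \<infinity>}" and uv: "0 \<le> u" "0 \<le> v" "u + v = 1"
  then obtain c d where "\<forall>\<theta>\<in>K. \<theta> \<bullet> x \<le> c" "\<forall>\<theta>\<in>K. \<theta> \<bullet> y \<le> d"
    unfolding mem_Collect_eq rate_finite_iff by auto
  then have "\<forall>\<theta>\<in>K. \<theta> \<bullet> (u *\<^sub>R x + v *\<^sub>R y) \<le> u * c + v * d"
    using uv by (auto simp: inner_add_right intro!: add_mono mult_left_mono)
  then show "u *\<^sub>R x + v *\<^sub>R y \<in> {x. I x < \<infinity>}" unfolding mem_Collect_eq rate_finite_iff by blast
qed

text \<open>On K the subtracted \<Lambda> is nonpositive, so the conjugate dominates the rate, and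
  finiteness of the rate is invariant under positive scaling. This turns the standing assumption
  into a statement about the rate alone.\<close>

lemma pos_cone_subset_rate_finite:
  "pos_cone (dom_fun (conj_fun (log_mgf M Y))) \<subseteq> {x. I x < \<infinity>}"
proof
  fix z assume "z \<in> pos_cone (dom_fun (conj_fun (log_mgf M Y)))"
  then obtain c y where z: "z = c *\<^sub>R y" "0 < c" and y: "conj_fun (log_mgf M Y) y < \<infinity>"
    by (auto simp: pos_cone_def dom_fun_def)
  have up: "ereal (\<theta> \<bullet> y) \<le> conj_fun (log_mgf M Y) y" if "\<theta> \<in> K" for \<theta>
  proof -
    have "log_mgf M Y \<theta> \<le> 0" using that by (simp add: K_def)
    then have "ereal (\<theta> \<bullet> y) \<le> ereal (\<theta> \<bullet> y) - log_mgf M Y \<theta>"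
      by (cases "log_mgf M Y \<theta>") auto
    also have "\<dots> \<le> conj_fun (log_mgf M Y) y"
      unfolding conj_fun_def by (rule SUP_upper) simp
    finally show ?thesis .
  qed
  obtain d where "conj_fun (log_mgf M Y) y = ereal d"
    using y up[OF zero_in_K] by (cases "conj_fun (log_mgf M Y) y") auto
  then have "\<forall>\<theta>\<in>K. \<theta> \<bullet> z \<le> c * d"
    using up z by (auto simp: intro: mult_left_mono)
  then show "z \<in> {x. I x < \<infinity>}" unfolding mem_Collect_eq rate_finite_iff by blast
qed

lemma descent_interior_K:
  assumes "\<theta> \<in> K" "w \<bullet> tilted_mean \<theta> < 0"
  obtains \<epsilon> where "0 < \<epsilon>" "\<theta> + \<epsilon> *\<^sub>R w \<in> interior K"
proof -
  obtain \<eta> C where q: "0 < \<eta>" "0 \<le> C"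
    "\<And>h. norm h \<le> \<eta> \<Longrightarrow> \<theta> + h \<in> dom_fun (log_mgf M Y)"
    "\<And>h. norm h \<le> \<eta> \<Longrightarrow> mgf (\<theta> + h) \<le> mgf \<theta> + h \<bullet> tilted_mean \<theta> + C * (norm h)\<^sup>2"
    using mgf_quadratic_bound[of \<theta>] assms(1) K_subset_dom by blast
  define s where "s = - (w \<bullet> tilted_mean \<theta>)"
  have s: "0 < s" using assms by (simp add: s_def)
  \<comment> \<open>The first bound keeps the step within the range of the quadratic estimate; the
    second makes the quadratic remainder smaller than the first-order decrease
    \<open>\<epsilon> * s\<close>.\<close>
  define \<epsilon> where "\<epsilon> = min (\<eta> / (norm w + 1)) (s / (2 * (C * (norm w)\<^sup>2 + 1)))"
  have den: "0 < C * (norm w)\<^sup>2 + 1" "0 < norm w + 1" using q(2) by (auto intro: add_nonneg_pos)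
  have \<epsilon>: "0 < \<epsilon>" using q(1) s den by (simp add: \<epsilon>_def)
  have "\<epsilon> * (norm w + 1) \<le> \<eta>" using den by (simp add: \<epsilon>_def pos_le_divide_eq[symmetric])
  then have n: "norm (\<epsilon> *\<^sub>R w) \<le> \<eta>" using \<epsilon> by (simp add: algebra_simps)
  have "\<epsilon> * (2 * (C * (norm w)\<^sup>2 + 1)) \<le> s"
    using den by (subst pos_le_divide_eq[symmetric]) (auto simp: \<epsilon>_def)
  then have "\<epsilon> * (\<epsilon> * (2 * (C * (norm w)\<^sup>2 + 1))) \<le> \<epsilon> * s" using \<epsilon> by (intro mult_left_mono) auto
  moreover have "0 < \<epsilon> * \<epsilon>" "0 \<le> C * (\<epsilon> * \<epsilon> * (norm w)\<^sup>2)" using \<epsilon> q(2) by auto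
  ultimately have "C * (norm (\<epsilon> *\<^sub>R w))\<^sup>2 < \<epsilon> * s"
    by (simp add: power_mult_distrib power2_eq_square algebra_simps)
  then have "mgf (\<theta> + \<epsilon> *\<^sub>R w) < 1"
    using q(4)[OF n] assms(1) by (simp add: s_def K_iff)
  then show thesis using that[OF \<epsilon>] interior_K q(3)[OF n] by blast
qed

lemma interior_K_scale:
  assumes "\<theta> \<in> interior K"
  obtains \<epsilon> where "0 < \<epsilon>" "\<theta> + \<epsilon> *\<^sub>R w \<in> K"
proof -
  obtain e where e: "0 < e" "ball \<theta> e \<subseteq> K" using assms mem_interior by blast
  define \<epsilon> where "\<epsilon> = e / (norm w + 1)"
  have nw: "0 < norm w + 1" by (simp add: add_nonneg_pos)
  have \<epsilon>: "0 < \<epsilon>" using e nw by (simp add: \<epsilon>_def)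
  have "\<epsilon> * norm w < \<epsilon> * (norm w + 1)" using \<epsilon> by (intro mult_strict_left_mono) auto
  also have "\<dots> = e" using nw by (simp add: \<epsilon>_def)
  finally have "\<theta> + \<epsilon> *\<^sub>R w \<in> ball \<theta> e" using \<epsilon> by (simp add: dist_norm)
  then show thesis using that \<epsilon> e by blast
qed

lemma mgf_eq_one_if_not_interior: "\<theta> \<in> K \<Longrightarrow> \<theta> \<notin> interior K \<Longrightarrow> mgf \<theta> = 1"
  using interior_K[of \<theta>] by (force simp: K_iff)

end

section \<open>Nondegeneracy, strict convexity of K, and the supporting functional beta\<close>

locale hitting_setup = mgf_rv M Y for M :: "'a measure" and Y :: "'a \<Rightarrow> real^'n::finite" +
  fixes L :: nat
  assumes L_pos: "1 \<le> L" and L_le: "L \<le> CARD('n)"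
    and mean_neg: "\<And>k. expectation (\<lambda>\<omega>. Y \<omega> $ k) < 0"
    and interior_meets_target: "\<And>A. A \<in> card_ge_sets L \<Longrightarrow>
      interior {x. rate (log_mgf M Y) x < \<infinity>} \<inter> target L A \<noteq> {}"
begin

lemma UNIV_card_ge: "(UNIV :: 'n set) \<in> card_ge_sets L"
  using L_le by (simp add: card_ge_sets_def)

text \<open>Otherwise K would contain the whole line through u, a finite rate would force x to be
  orthogonal to u, and the set of finite rate could have no interior.\<close>

lemma not_AE_hyperplane:
  assumes "u \<noteq> 0"
  shows "\<not> (AE \<omega> in M. u \<bullet> Y \<omega> = 0)"
proof
  assume ae: "AE \<omega> in M. u \<bullet> Y \<omega> = 0"
  have K: "t *\<^sub>R u \<in> K" for t
  proof -
    have "(\<integral>\<^sup>+\<omega>. ennreal (exp ((t *\<^sub>R u) \<bullet> Y \<omega>)) \<partial>M) = (\<integral>\<^sup>+\<omega>. 1 \<partial>M)"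
      by (rule nn_integral_cong_AE) (use ae in eventually_elim, simp)
    then show ?thesis by (simp add: K_iff_nn emeasure_space_1)
  qed
  have orth: "u \<bullet> x = 0" if x: "I x < \<infinity>" for x
  proof (rule ccontr)
    assume ux: "u \<bullet> x \<noteq> 0"
    obtain c where "\<forall>\<theta>\<in>K. \<theta> \<bullet> x \<le> c" using x unfolding rate_finite_iff by auto
    then have "(((c + 1) / (u \<bullet> x)) *\<^sub>R u) \<bullet> x \<le> c" using K by blast
    then show False using ux by simp
  qed
  obtain x e where x: "x \<in> interior {x. I x < \<infinity>}" and e: "0 < e" "ball x e \<subseteq> {x. I x < \<infinity>}"
    using interior_meets_target[OF UNIV_card_ge] mem_interior by blast
  define y where "y = x + (e / (2 * norm u)) *\<^sub>R u"
  have "y \<in> ball x e" using e assms by (simp add: y_def dist_norm)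
  moreover have "x \<in> ball x e" using e by simp
  ultimately have "u \<bullet> y = 0" "u \<bullet> x = 0" using e orth by blast+
  then show False using e assms by (simp add: y_def inner_add_right)
qed

text \<open>Strict convexity of K, the source of uniqueness for both \<open>beta\<close> and
  \<open>gamma_opt\<close>.\<close>

lemma midpoint_interior:
  assumes "a \<in> K" "b \<in> K" "a \<noteq> b"
  shows "midpoint a b \<in> interior K"
  using mgf_midpoint_less[OF assms(1,2) not_AE_hyperplane] assms K_subset_dom
  by (intro interior_K) auto

text \<open>With zero gradient, \<theta> would be a global minimizer with value 1, but the midpoint
  of \<theta> and 0 has a smaller value.\<close>

lemma tilted_mean_neq_0:
  assumes "\<theta> \<in> K" "mgf \<theta> = 1" "\<theta> \<noteq> 0"
  shows "tilted_mean \<theta> \<noteq> 0"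
proof
  assume "tilted_mean \<theta> = 0"
  moreover have "midpoint \<theta> 0 \<in> dom_fun (log_mgf M Y)" "mgf (midpoint \<theta> 0) < 1"
    using mgf_midpoint_less[OF assms(1) zero_in_K not_AE_hyperplane] assms K_subset_dom by auto
  ultimately show False
    using mgf_tangent[of \<theta> "midpoint \<theta> 0"] assms K_subset_dom by auto
qed

lemma tilted_mean_zero: "tilted_mean 0 $ k < 0"
proof -
  have "integrable M Y" using integrable_tilted[OF zero_dom] by simp
  then have "expectation (\<lambda>\<omega>. Y \<omega> \<bullet> axis k 1) = tilted_mean 0 \<bullet> axis k 1"
    by (subst integral_inner_left) (auto simp: tilted_mean_def)
  then show ?thesis using mean_neg[of k] by (simp add: inner_axis)
qed

text \<open>The negative drift enters here: from 0, a short step along the indicator vector of B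
  decreases \<open>mgf\<close> and stays in K, while that vector has inner product above 1 with
  every point of the target.\<close>

lemma rate_pos_on_target:
  assumes "A \<in> card_ge_sets L"
  obtains \<epsilon> where "0 < \<epsilon>" "\<And>x. x \<in> target L A \<Longrightarrow> ereal \<epsilon> \<le> I x"
proof -
  obtain B where B: "B \<subseteq> A" "card B = L"
    using assms obtain_subset_with_card_n[of L A] by (auto simp: card_ge_sets_def)
  define w :: "real^'n" where "w = (\<chi> k. if k \<in> B then 1 else 0)"
  have w: "w \<bullet> x = (\<Sum>k\<in>B. x $ k)" for x
    by (simp add: w_def inner_vec_def if_distrib[of "\<lambda>c. c * _"] sum.If_cases)
  have "B \<noteq> {}" using B L_pos by auto
  then have "w \<bullet> tilted_mean 0 < 0"
    unfolding w using tilted_mean_zero by (intro sum_strict_mono[where g = "\<lambda>_. 0", simplified]) auto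
  then obtain \<epsilon> where \<epsilon>: "0 < \<epsilon>" "\<epsilon> *\<^sub>R w \<in> K"
    using descent_interior_K[OF zero_in_K, of w] interior_subset by (metis add_0 subsetD)
  show thesis
  proof (rule that[OF \<epsilon>(1)])
    fix x assume "x \<in> target L A"
    then have "\<epsilon> * 1 \<le> \<epsilon> * (w \<bullet> x)"
      using target_sum_gt[OF _ B(2,1)] \<epsilon>(1) unfolding w by (intro mult_left_mono) (auto intro: less_imp_le)
    then show "ereal \<epsilon> \<le> I x"
      using rate_upper[OF \<epsilon>(2), of x] by (auto intro: order_trans[rotated])
  qed
qed

lemma r_val_real:
  assumes "A \<in> card_ge_sets L"
  obtains r where "r_val (log_mgf M Y) L A = ereal r" "0 < r"
proof -
  obtain \<epsilon> where \<epsilon>: "0 < \<epsilon>" "\<And>x. x \<in> target L A \<Longrightarrow> ereal \<epsilon> \<le> I x"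
    using rate_pos_on_target[OF assms] by blast
  obtain x where x: "x \<in> target L A" "I x < \<infinity>"
    using interior_meets_target[OF assms] interior_subset by fastforce
  have "ereal \<epsilon> \<le> r_val (log_mgf M Y) L A"
    unfolding r_val_def by (intro INF_greatest \<epsilon>(2))
  moreover have "r_val (log_mgf M Y) L A < \<infinity>"
    unfolding r_val_def using INF_lower[OF x(1), of I] x(2) by (auto intro: le_less_trans)
  ultimately show thesis
    using that \<epsilon>(1) by (cases "r_val (log_mgf M Y) L A") auto
qed

text \<open>A supporting functional from \<open>K\<close> lies on the boundary of \<open>K\<close>: otherwise it could be
  scaled up, which would raise the infimum of the rate over the target.\<close>

lemma supporting_not_interior:
  assumes r: "r_val (log_mgf M Y) L A = ereal r" "0 < r"
    and supp: "\<And>v. v \<in> target L A \<Longrightarrow> r \<le> \<beta> \<bullet> v"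
  shows "\<beta> \<notin> interior K"
proof
  assume "\<beta> \<in> interior K"
  then obtain \<epsilon> where \<epsilon>: "0 < \<epsilon>" "\<beta> + \<epsilon> *\<^sub>R \<beta> \<in> K" using interior_K_scale by blast
  have "ereal ((1 + \<epsilon>) * r) \<le> I v" if "v \<in> target L A" for v
  proof -
    have "(1 + \<epsilon>) * r \<le> (1 + \<epsilon>) * (\<beta> \<bullet> v)" using supp[OF that] \<epsilon>(1) by (intro mult_left_mono) auto
    also have "\<dots> = (\<beta> + \<epsilon> *\<^sub>R \<beta>) \<bullet> v" by (simp add: inner_add_left distrib_right)
    finally show ?thesis using rate_upper[OF \<epsilon>(2), of v] by (auto intro: order_trans[rotated])
  qed
  then have "ereal ((1 + \<epsilon>) * r) \<le> ereal r"
    unfolding r(1)[symmetric] by (auto simp: r_val_def intro: INF_greatest)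
  then show False using r(2) \<epsilon>(1) by simp
qed

text \<open>Separate the convex set of points with rate below r from the target and rescale the
  functional to level r. That it lies in K is a bipolar argument: a hyperplane cutting it off from K
  would yield a point v with rate at most r but \<open>r < \<beta> \<bullet> v\<close>.\<close>

lemma supporting_exists:
  assumes A: "A \<in> card_ge_sets L" and r: "r_val (log_mgf M Y) L A = ereal r" "0 < r"
  obtains \<beta> where "\<beta> \<in> K" "\<And>v. v \<in> target L A \<Longrightarrow> r \<le> \<beta> \<bullet> v"
proof -
  let ?U = "{x. \<exists>c<r. \<forall>\<theta>\<in>K. \<theta> \<bullet> x \<le> c}"
  obtain x0 where x0: "x0 \<in> interior {x. I x < \<infinity>}" "x0 \<in> target L A"
    using interior_meets_target[OF A] by blast
  have cU: "convex ?U"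
  proof (rule convexI)
    fix x y :: "real^'n" and u v :: real
    assume "x \<in> ?U" "y \<in> ?U" and uv: "0 \<le> u" "0 \<le> v" "u + v = 1"
    then obtain c d where cd: "c < r" "d < r" "\<forall>\<theta>\<in>K. \<theta> \<bullet> x \<le> c" "\<forall>\<theta>\<in>K. \<theta> \<bullet> y \<le> d" by auto
    have "\<forall>\<theta>\<in>K. \<theta> \<bullet> (u *\<^sub>R x + v *\<^sub>R y) \<le> u * c + v * d"
      using uv cd by (auto simp: inner_add_right intro!: add_mono mult_left_mono)
    moreover have "u * c + v * d < r" using convex_bound_lt[OF cd(1,2) uv] .
    ultimately show "u *\<^sub>R x + v *\<^sub>R y \<in> ?U" by blast
  qed
  have zero: "0 \<in> ?U" using r(2) by (auto intro: exI[of _ 0])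
  have disj: "?U \<inter> target L A = {}"
  proof (rule ccontr)
    assume "?U \<inter> target L A \<noteq> {}"
    then obtain x c where x: "x \<in> target L A" "c < r" "\<forall>\<theta>\<in>K. \<theta> \<bullet> x \<le> c" by auto
    then have "ereal r \<le> I x" "I x \<le> ereal c"
      unfolding r(1)[symmetric] r_val_def rate_le_iff by (auto intro: INF_lower)
    then have "ereal r \<le> ereal c" by (rule order_trans)
    then show False using x(2) by simp
  qed
  have ne: "target L A \<noteq> {}" "?U \<noteq> {}" using x0 zero by blast+
  obtain a b where ab: "a \<noteq> 0" "\<forall>x\<in>?U. a \<bullet> x \<le> b" "\<forall>x\<in>target L A. b \<le> a \<bullet> x"
    using separating_hyperplane_sets[OF cU convex_target ne(2,1) disj] by blast
  have "0 \<le> b" using bspec[OF ab(2) zero] by simp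
  \<comment> \<open>At level 0 the functional would vanish on a ball: it is nonnegative on the
    target, and nonpositive wherever the rate is finite because small multiples of such points lie
    in \<open>?U\<close>.\<close>
  have "b \<noteq> 0"
  proof
    assume b: "b = 0"
    have "open (interior {x. I x < \<infinity>} \<inter> target L A)" by (intro open_Int open_interior open_target)
    then obtain e where e: "0 < e" "ball x0 e \<subseteq> interior {x. I x < \<infinity>} \<inter> target L A"
      using x0 open_contains_ball by blast
    have orth: "a \<bullet> y = 0" if "y \<in> ball x0 e" for y
    proof -
      have y: "I y < \<infinity>" "y \<in> target L A" using that e interior_subset by blast+
      obtain c where c: "\<forall>\<theta>\<in>K. \<theta> \<bullet> y \<le> c" using y unfolding rate_finite_iff by auto
      then have c0: "0 \<le> c" using zero_in_K by force
      define t where "t = r / (2 * (c + 1))"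
      have t: "0 < t" using r(2) c0 by (simp add: t_def)
      have "\<forall>\<theta>\<in>K. \<theta> \<bullet> (t *\<^sub>R y) \<le> t * c" using c t by (auto intro: mult_left_mono)
      moreover have "t * c < r"
        using r(2) c0 by (simp add: t_def field_simps) (smt (verit) mult_nonneg_nonneg)
      ultimately have "t *\<^sub>R y \<in> ?U" by blast
      then have "a \<bullet> (t *\<^sub>R y) \<le> 0" using ab(2) b by blast
      then have "a \<bullet> y \<le> 0" using t by (simp add: mult_le_0_iff)
      moreover have "0 \<le> a \<bullet> y" using ab(3) y b by blast
      ultimately show ?thesis by simp
    qed
    define y where "y = x0 + (e / (2 * norm a)) *\<^sub>R a"
    have "y \<in> ball x0 e" "x0 \<in> ball x0 e" using e ab(1) by (simp_all add: y_def dist_norm)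
    then have "a \<bullet> y = 0" "a \<bullet> x0 = 0" using orth by blast+
    then show False using e ab(1) by (simp add: y_def inner_add_right)
  qed
  then have b: "0 < b" using \<open>0 \<le> b\<close> by simp
  define \<beta> where "\<beta> = (r / b) *\<^sub>R a"
  have "\<beta> \<in> K"
  proof (rule ccontr)
    assume "\<beta> \<notin> K"
    then obtain w s where w: "w \<bullet> \<beta> < s" "\<forall>\<theta>\<in>K. s < w \<bullet> \<theta>"
      using separating_hyperplane_closed_point[OF convex_K closed_K] by blast
    have s: "s < 0" using bspec[OF w(2) zero_in_K] by simp
    \<comment> \<open>s is negative, so this factor reverses the separating inequality and places K
      below level r.\<close>
    define v where "v = (r / s) *\<^sub>R w"
    have v: "\<forall>\<theta>\<in>K. \<theta> \<bullet> v \<le> r"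
    proof
      fix \<theta> assume "\<theta> \<in> K"
      then have "s < w \<bullet> \<theta>" using w(2) by blast
      then have "r / s * (w \<bullet> \<theta>) \<le> r / s * s"
        using s r(2) by (intro mult_left_mono_neg) (auto simp: divide_nonneg_neg divide_le_0_iff)
      then show "\<theta> \<bullet> v \<le> r" using s by (simp add: v_def inner_commute)
    qed
    have "r / s * s < r / s * (w \<bullet> \<beta>)"
      using w(1) s r(2) by (intro mult_strict_left_mono_neg) (auto simp: divide_less_0_iff)
    then have bv: "r < \<beta> \<bullet> v" using s by (simp add: v_def inner_commute)
    \<comment> \<open>\<open>?U\<close> demands a rate strictly below r, so v has to be shrunk. At
      the factor t the inner product with \<beta> equals r; a factor between t and 1 meets the
      strict bound and still exceeds r.\<close>
    define t where "t = r / (\<beta> \<bullet> v)"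
    have t: "0 < t" "t < 1" using bv r(2) by (simp_all add: t_def)
    have "\<forall>\<theta>\<in>K. \<theta> \<bullet> (((t + 1) / 2) *\<^sub>R v) \<le> ((t + 1) / 2) * r"
      using v t by (auto intro!: mult_left_mono)
    moreover have "((t + 1) / 2) * r < r" using t r(2) by simp
    ultimately have "((t + 1) / 2) *\<^sub>R v \<in> ?U" by blast
    then have "a \<bullet> (((t + 1) / 2) *\<^sub>R v) \<le> b" using ab(2) by blast
    then have "r / b * (a \<bullet> (((t + 1) / 2) *\<^sub>R v)) \<le> r / b * b"
      using r(2) b by (intro mult_left_mono) auto
    then have "((t + 1) / 2) * (\<beta> \<bullet> v) \<le> r" using b by (simp add: \<beta>_def mult_ac)
    moreover have "t * (\<beta> \<bullet> v) = r" using bv r(2) by (simp add: t_def)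
    moreover have "t * (\<beta> \<bullet> v) < ((t + 1) / 2) * (\<beta> \<bullet> v)" using t bv r(2) by (intro mult_strict_right_mono) auto
    ultimately show False by simp
  qed
  moreover have "r \<le> \<beta> \<bullet> v" if "v \<in> target L A" for v
  proof -
    have "r / b * b \<le> r / b * (a \<bullet> v)" using ab(3) that r(2) b by (intro mult_left_mono) auto
    then show ?thesis using b by (simp add: \<beta>_def)
  qed
  ultimately show thesis by (rule that)
qed

text \<open>The definite description is justified by strict convexity: the midpoint of two
  candidates would lie in the interior of K and still support the target, contrary to
  \<open>supporting_not_interior\<close>.\<close>

lemma beta_supporting:
  assumes A: "A \<in> card_ge_sets L" and r: "r_val (log_mgf M Y) L A = ereal r" "0 < r"
  shows "beta (log_mgf M Y) L A \<in> K" "\<And>v. v \<in> target L A \<Longrightarrow> r \<le> beta (log_mgf M Y) L A \<bullet> v"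
proof -
  define Q where "Q \<beta> \<longleftrightarrow> log_mgf M Y \<beta> = 0 \<and>
      target L A \<subseteq> {v. r_val (log_mgf M Y) L A \<le> ereal (\<beta> \<bullet> v)} \<and>
      {x. I x \<le> r_val (log_mgf M Y) L A} \<subseteq> {v. ereal (\<beta> \<bullet> v) \<le> r_val (log_mgf M Y) L A}" for \<beta>
  have supp: "\<beta> \<in> K" "\<And>v. v \<in> target L A \<Longrightarrow> r \<le> \<beta> \<bullet> v" if "Q \<beta>" for \<beta>
    using that by (auto simp: Q_def K_def r)
  obtain \<beta> where \<beta>: "\<beta> \<in> K" "\<And>v. v \<in> target L A \<Longrightarrow> r \<le> \<beta> \<bullet> v"
    using supporting_exists[OF A r] by blast
  have "mgf \<beta> = 1"
    using mgf_eq_one_if_not_interior[OF \<beta>(1) supporting_not_interior[OF r \<beta>(2)]] .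
  then have "Q \<beta>"
    using \<beta> K_subset_dom by (auto simp: Q_def log_mgf_eq r rate_le_iff)
  moreover have "\<beta>' = \<beta>" if "Q \<beta>'" for \<beta>'
  proof (rule ccontr)
    assume "\<beta>' \<noteq> \<beta>"
    then have "midpoint \<beta>' \<beta> \<in> interior K" using supp[OF that] \<beta> by (intro midpoint_interior)
    moreover have "r \<le> midpoint \<beta>' \<beta> \<bullet> v" if v: "v \<in> target L A" for v
      using supp(2)[OF \<open>Q \<beta>'\<close> v] \<beta>(2)[OF v] by (simp add: midpoint_def inner_add_left)
    ultimately show False using supporting_not_interior[OF r] by blast
  qed
  ultimately have "Q (THE \<beta>. Q \<beta>)" by (rule theI)
  then have "Q (beta (log_mgf M Y) L A)" by (simp add: beta_def Q_def[abs_def])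
  then show "beta (log_mgf M Y) L A \<in> K" "\<And>v. v \<in> target L A \<Longrightarrow> r \<le> beta (log_mgf M Y) L A \<bullet> v"
    using supp by blast+
qed

end

section \<open>The optimization problems for gamma and s, and maximizers of linear functionals over
  K\<close>

lemma continuous_on_Min:
  fixes f :: "'i \<Rightarrow> 'b::topological_space \<Rightarrow> real"
  assumes "finite A" "A \<noteq> {}" "\<And>k. k \<in> A \<Longrightarrow> continuous_on S (f k)"
  shows "continuous_on S (\<lambda>x. MIN k\<in>A. f k x)"
  using assms by (induction A rule: finite_ne_induct) (auto intro!: continuous_on_min)

text \<open>Two nonnegative numbers that reach the same positive thresholds are equal. On the
  feasible set this turns the order statistic into a continuous minimum of coordinates.\<close>

lemma dec_abs_eq_Min:
  fixes \<theta> :: "real^'n::finite"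
  assumes "card A = L" "1 \<le> L" "\<And>k. k \<in> A \<Longrightarrow> 0 \<le> \<theta> $ k" "\<And>k. k \<notin> A \<Longrightarrow> \<theta> $ k = 0"
  shows "dec_abs \<theta> L = (MIN k\<in>A. \<theta> $ k)"
proof -
  have A: "A \<noteq> {}" "finite A" using assms(1,2) by auto
  have "L \<le> CARD('n)" using assms(1) card_mono[of UNIV A] by simp
  then have nn: "0 \<le> dec_abs \<theta> L" "0 \<le> (MIN k\<in>A. \<theta> $ k)"
    using dec_abs_nonneg[OF assms(2)] A assms(3) by auto
  have iff: "t \<le> dec_abs \<theta> L \<longleftrightarrow> t \<le> (MIN k\<in>A. \<theta> $ k)" if "0 < t" for t
    using dec_abs_ge_iff_support[OF assms(1,2,4) that] A assms(3) by auto
  show ?thesis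
    using iff[of "dec_abs \<theta> L"] iff[of "MIN k\<in>A. \<theta> $ k"] nn
    by (cases "dec_abs \<theta> L = 0"; cases "(MIN k\<in>A. \<theta> $ k) = 0") auto
qed

context hitting_setup
begin

lemma feasible_eq:
  "feasible (log_mgf M Y) A = K \<inter> {\<theta>. (\<forall>k\<in>A. 0 \<le> \<theta> $ k) \<and> (\<forall>k\<in>-A. \<theta> $ k = 0)}"
  by (auto simp: feasible_def K_def)

text \<open>K itself may be unbounded. A target point x of finite rate bounds
  \<open>\<theta> \<bullet> x\<close> on K, and on the feasible set all summands of this inner
  product are nonnegative, so each is bounded separately.\<close>

lemma compact_feasible:
  assumes "A \<in> card_ge_sets L"
  shows "compact (feasible (log_mgf M Y) A)"
proof -
  obtain x where x: "x \<in> target L A" "I x < \<infinity>"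
    using interior_meets_target[OF assms] interior_subset by fastforce
  obtain c where c: "\<forall>\<theta>\<in>K. \<theta> \<bullet> x \<le> c" using x(2) unfolding rate_finite_iff by auto
  have "norm \<theta> \<le> (\<Sum>k\<in>UNIV. \<bar>c\<bar> / \<bar>x $ k\<bar>)" if \<theta>: "\<theta> \<in> feasible (log_mgf M Y) A" for \<theta>
  proof -
    have xk: "\<And>k. k \<in> A \<Longrightarrow> 0 < x $ k" using x by (auto simp: target_def)
    have pos: "0 \<le> \<theta> $ k * x $ k" for k
      using \<theta> xk[of k] by (cases "k \<in> A") (auto simp: feasible_eq)
    have "\<bar>\<theta> $ k\<bar> \<le> \<bar>c\<bar> / \<bar>x $ k\<bar>" for k
    proof (cases "k \<in> A")
      case True
      have "\<theta> $ k * x $ k \<le> \<theta> \<bullet> x"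
        unfolding inner_vec_def inner_real_def using pos by (intro member_le_sum) auto
      also have "\<dots> \<le> c" using c \<theta> by (auto simp: feasible_eq)
      finally show ?thesis using xk[OF True] True \<theta> by (auto simp: feasible_eq field_simps)
    next
      case False
      then show ?thesis using \<theta> by (auto simp: feasible_eq)
    qed
    then have "(\<Sum>k\<in>UNIV. \<bar>\<theta> $ k\<bar>) \<le> (\<Sum>k\<in>UNIV. \<bar>c\<bar> / \<bar>x $ k\<bar>)" by (intro sum_mono)
    then show ?thesis using norm_le_l1_cart[of \<theta>] by linarith
  qed
  then have "bounded (feasible (log_mgf M Y) A)" by (auto simp: bounded_iff)
  moreover have "closed (feasible (log_mgf M Y) A)"
  proof -
    have "{\<theta>. (\<forall>k\<in>A. 0 \<le> \<theta> $ k) \<and> (\<forall>k\<in>-A. \<theta> $ k = 0)} =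
        (\<Inter>k\<in>A. {\<theta>::real^'n. 0 \<le> \<theta> $ k}) \<inter> (\<Inter>k\<in>-A. {\<theta>. \<theta> $ k = 0})" by auto
    then show ?thesis
      unfolding feasible_eq by (simp only:)
        (intro closed_Int closed_K closed_INT ballI closed_Collect_le closed_Collect_eq continuous_intros)
  qed
  ultimately show ?thesis by (simp add: compact_eq_bounded_closed)
qed

lemma gamma_is_arg_max:
  assumes "A \<in> card_eq_sets L"
  shows "is_arg_max (\<lambda>\<theta>. dec_abs \<theta> L) (\<lambda>\<theta>. \<theta> \<in> feasible (log_mgf M Y) A) (gamma_opt (log_mgf M Y) L A)"
proof -
  let ?F = "feasible (log_mgf M Y) A"
  define f where "f \<theta> = (MIN k\<in>A. \<theta> $ k)" for \<theta> :: "real^'n"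
  have A: "card A = L" "finite A" "A \<noteq> {}" "A \<in> card_ge_sets L"
    using assms L_pos by (auto simp: card_eq_sets_def card_ge_sets_def)
  have eq: "dec_abs \<theta> L = f \<theta>" if "\<theta> \<in> ?F" for \<theta>
    unfolding f_def using that by (intro dec_abs_eq_Min A L_pos) (auto simp: feasible_eq)
  have ne: "?F \<noteq> {}" using zero_in_K by (auto simp: feasible_eq intro!: exI[of _ 0])
  have cont: "continuous_on ?F f" unfolding f_def using A by (intro continuous_on_Min continuous_intros)
  obtain \<gamma> where \<gamma>: "\<gamma> \<in> ?F" "\<And>\<theta>. \<theta> \<in> ?F \<Longrightarrow> f \<theta> \<le> f \<gamma>"
    using continuous_attains_sup[OF compact_feasible[OF A(4)] ne cont] by blast
  have max: "is_arg_max (\<lambda>\<theta>. dec_abs \<theta> L) (\<lambda>\<theta>. \<theta> \<in> ?F) \<gamma>"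
    using \<gamma> eq by (auto simp: is_arg_max_def not_less)
  have "\<gamma>' = \<gamma>" if "is_arg_max (\<lambda>\<theta>. dec_abs \<theta> L) (\<lambda>\<theta>. \<theta> \<in> ?F) \<gamma>'" for \<gamma>'
  proof (rule ccontr)
    assume neq: "\<gamma>' \<noteq> \<gamma>"
    have \<gamma>': "\<gamma>' \<in> ?F" "f \<gamma>' = f \<gamma>"
      using that \<gamma> eq by (auto simp: is_arg_max_def not_less intro: antisym)
    \<comment> \<open>The midpoint of two distinct maximizers is interior to K, which leaves room to
      raise all coordinates in A, and hence their minimum, at once.\<close>
    define w :: "real^'n" where "w = (\<chi> k. if k \<in> A then 1 else 0)"
    have "midpoint \<gamma>' \<gamma> \<in> interior K"
      using \<gamma>' \<gamma> neq by (intro midpoint_interior) (auto simp: feasible_eq)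
    then obtain \<epsilon> where \<epsilon>: "0 < \<epsilon>" "midpoint \<gamma>' \<gamma> + \<epsilon> *\<^sub>R w \<in> K" using interior_K_scale by blast
    let ?\<theta> = "midpoint \<gamma>' \<gamma> + \<epsilon> *\<^sub>R w"
    have "?\<theta> \<in> ?F"
      using \<gamma>(1) \<gamma>'(1) \<epsilon> by (auto simp: feasible_eq midpoint_def w_def)
    moreover have "f \<gamma> + \<epsilon> \<le> f ?\<theta>"
    proof -
      have "f \<gamma> + \<epsilon> \<le> ?\<theta> $ k" if k: "k \<in> A" for k
      proof -
        have "f \<gamma> \<le> \<gamma> $ k" "f \<gamma>' \<le> \<gamma>' $ k" using A k by (auto simp: f_def)
        moreover have "?\<theta> $ k = \<gamma>' $ k / 2 + \<gamma> $ k / 2 + \<epsilon>" using k by (simp add: midpoint_def w_def)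
        ultimately show ?thesis using \<gamma>'(2) by linarith
      qed
      then show ?thesis unfolding f_def[of ?\<theta>] using A by (subst Min_ge_iff) auto
    qed
    ultimately show False using \<gamma>(2)[of ?\<theta>] \<epsilon>(1) by linarith
  qed
  with max show ?thesis unfolding gamma_opt_def by (rule theI)
qed

text \<open>The coordinates of the optimizer on A are at least z and vanish elsewhere, while the
  coordinates of x on A sum to more than 1. Admitting every superset B is what lets an L-set serve
  larger targets.\<close>

lemma gamma_supporting:
  assumes "A \<in> card_eq_sets L"
  obtains z where "z_val (log_mgf M Y) L A = ereal z" "gamma_opt (log_mgf M Y) L A \<in> K"
    "\<And>B x. A \<subseteq> B \<Longrightarrow> x \<in> target L B \<Longrightarrow> z \<le> gamma_opt (log_mgf M Y) L A \<bullet> x"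
proof -
  let ?F = "feasible (log_mgf M Y) A"
  let ?\<gamma> = "gamma_opt (log_mgf M Y) L A"
  define z where "z = dec_abs ?\<gamma> L"
  have A: "card A = L" "finite A" "A \<noteq> {}"
    using assms L_pos by (auto simp: card_eq_sets_def)
  have \<gamma>: "?\<gamma> \<in> ?F" "\<And>\<theta>. \<theta> \<in> ?F \<Longrightarrow> dec_abs \<theta> L \<le> z"
    using gamma_is_arg_max[OF assms] by (auto simp: is_arg_max_def z_def not_less)
  have "z_val (log_mgf M Y) L A = ereal z"
    unfolding z_val_def using \<gamma> by (intro antisym SUP_least SUP_upper2[OF \<gamma>(1)]) (auto simp: z_def)
  moreover have "?\<gamma> \<in> K" using \<gamma> by (simp add: feasible_eq)
  moreover have "z \<le> ?\<gamma> \<bullet> x" if "A \<subseteq> B" "x \<in> target L B" for B x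
  proof -
    have zk: "z \<le> ?\<gamma> $ k" if "k \<in> A" for k
    proof -
      have "z = (MIN k\<in>A. ?\<gamma> $ k)"
        unfolding z_def using \<gamma>(1) by (intro dec_abs_eq_Min A L_pos) (auto simp: feasible_eq)
      then show ?thesis using A that by simp
    qed
    have "0 \<le> z" unfolding z_def by (rule dec_abs_nonneg[OF L_pos L_le])
    then have "z * 1 \<le> z * (\<Sum>k\<in>A. x $ k)"
      using target_sum_gt[OF that(2) A(1) that(1)] by (intro mult_left_mono) auto
    also have "\<dots> \<le> (\<Sum>k\<in>A. ?\<gamma> $ k * x $ k)"
      unfolding sum_distrib_left using that zk
      by (intro sum_mono mult_right_mono) (auto simp: target_def less_imp_le subset_iff)
    also have "\<dots> = ?\<gamma> \<bullet> x"
      unfolding inner_vec_def inner_real_def using \<gamma>(1)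
      by (intro sum.mono_neutral_left) (auto simp: feasible_eq)
    finally show ?thesis by simp
  qed
  ultimately show thesis by (rule that)
qed

text \<open>For t strictly below the supremum, a suitable feasible point exists by definition; the
  small loss is charged to \<epsilon> in \<open>supporting_pair\<close>.\<close>

lemma s_val_supporting:
  assumes B: "card B = L + 1" and t: "ereal t < s_val (log_mgf M Y) L B"
  obtains \<phi> where "\<phi> \<in> K" "\<And>A x. B \<subseteq> A \<Longrightarrow> x \<in> target L A \<Longrightarrow> t \<le> \<phi> \<bullet> x"
proof -
  obtain \<phi> where \<phi>: "\<phi> \<in> feasible (log_mgf M Y) B"
    "t < (MIN l\<in>{1..L}. (1 / real l) * (\<Sum>i = L - l + 1..L + 1. dec_abs \<phi> i))"
    using t unfolding s_val_def less_SUP_iff by auto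
  show thesis
  proof (rule that)
    show "\<phi> \<in> K" using \<phi>(1) by (simp add: feasible_eq)
    fix A x assume "B \<subseteq> A" "x \<in> target L A"
    then have "(MIN l\<in>{1..L}. (1 / real l) * (\<Sum>i = L - l + 1..L + 1. dec_abs \<phi> i)) \<le> \<phi> \<bullet> x"
      using \<phi>(1) by (intro target_inner_ge[OF L_pos B]) (auto simp: feasible_eq)
    then show "t \<le> \<phi> \<bullet> x" using \<phi>(2) by linarith
  qed
qed

text \<open>A near-optimal point may lie on the boundary of the set of finite rate, where the rate
  need not be attained. A small move towards an interior point of the target costs little by
  convexity.\<close>

lemma near_optimal_interior_point:
  assumes A: "A \<in> card_ge_sets L" and r: "r_val (log_mgf M Y) L A = ereal r" and \<epsilon>: "0 < \<epsilon>"
  obtains x where "x \<in> target L A" "x \<in> interior {x. I x < \<infinity>}" "I x \<le> ereal (r + \<epsilon>)"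
proof -
  obtain x0 where x0: "x0 \<in> interior {x. I x < \<infinity>}" "x0 \<in> target L A"
    using interior_meets_target[OF A] by blast
  then have "I x0 < \<infinity>" using interior_subset by blast
  then obtain b where b: "\<forall>\<theta>\<in>K. \<theta> \<bullet> x0 \<le> b" unfolding rate_finite_iff by auto
  have "r_val (log_mgf M Y) L A < ereal (r + \<epsilon>)" using r \<epsilon> by simp
  then obtain x1 where x1: "x1 \<in> target L A" "I x1 < ereal (r + \<epsilon>)"
    unfolding r_val_def INF_less_iff by blast
  then obtain a where a: "I x1 = ereal a" "a < r + \<epsilon>"
    using rate_nonneg[of x1] by (cases "I x1") auto
  then have a': "\<forall>\<theta>\<in>K. \<theta> \<bullet> x1 \<le> a" unfolding rate_le_iff[symmetric] by simp
  define t where "t = min 1 ((r + \<epsilon> - a) / (\<bar>b - a\<bar> + 1))"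
  have den: "0 < \<bar>b - a\<bar> + 1" by simp
  have t: "0 < t" "t \<le> 1" using a den by (auto simp: t_def)
  have "t * (\<bar>b - a\<bar> + 1) \<le> r + \<epsilon> - a"
    using den by (subst pos_le_divide_eq[symmetric]) (auto simp: t_def)
  moreover have "t * (b - a) \<le> t * (\<bar>b - a\<bar> + 1)" using t by (intro mult_left_mono) auto
  ultimately have bnd: "(1 - t) * a + t * b \<le> r + \<epsilon>" by (simp add: algebra_simps)
  define x where "x = (1 - t) *\<^sub>R x1 + t *\<^sub>R x0"
  have "x \<in> target L A" unfolding x_def using x1 x0 t by (intro convexD[OF convex_target]) auto
  moreover have "x \<in> interior {x. I x < \<infinity>}"
  proof -
    have "x1 \<in> {x. I x < \<infinity>}" using a by simp
    then have "x1 - t *\<^sub>R (x1 - x0) \<in> interior {x. I x < \<infinity>}"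
      by (rule mem_interior_convex_shrink[OF convex_rate_finite x0(1) _ t])
    moreover have "x = x1 - t *\<^sub>R (x1 - x0)" by (simp add: x_def algebra_simps)
    ultimately show ?thesis by simp
  qed
  moreover have "I x \<le> ereal (r + \<epsilon>)"
    unfolding rate_le_iff
  proof
    fix \<theta> assume \<theta>: "\<theta> \<in> K"
    have "\<theta> \<bullet> x = (1 - t) * (\<theta> \<bullet> x1) + t * (\<theta> \<bullet> x0)" by (simp add: x_def inner_add_right)
    also have "\<dots> \<le> (1 - t) * a + t * b"
      using \<theta> a' b t by (intro add_mono mult_left_mono) auto
    finally show "\<theta> \<bullet> x \<le> r + \<epsilon>" using bnd by linarith
  qed
  ultimately show thesis by (rule that)
qed

text \<open>Since 0 lies in K, only \<theta> with nonnegative \<open>\<theta> \<bullet> x\<close>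
  compete. For these, finiteness of the rate at x plus and minus e times each unit vector bounds
  every coordinate, so the maximization is over a compact set.\<close>

lemma rate_attained:
  assumes "x \<in> interior {x. I x < \<infinity>}"
  obtains \<theta> where "\<theta> \<in> K" "\<And>\<phi>. \<phi> \<in> K \<Longrightarrow> \<phi> \<bullet> x \<le> \<theta> \<bullet> x"
proof -
  obtain e where e: "0 < e" "cball x e \<subseteq> {x. I x < \<infinity>}"
    using assms by (auto simp: mem_interior_cball)
  have "\<exists>c. \<forall>\<theta>\<in>K. \<theta> \<bullet> y \<le> c" if "y \<in> cball x e" for y
    using e(2) that unfolding rate_finite_iff[symmetric] by blast
  then obtain c where c: "\<And>y \<theta>. y \<in> cball x e \<Longrightarrow> \<theta> \<in> K \<Longrightarrow> \<theta> \<bullet> y \<le> c y" by metis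
  let ?K = "K \<inter> {\<theta>. 0 \<le> \<theta> \<bullet> x}"
  define g where "g k = \<bar>c (x + e *\<^sub>R axis k 1)\<bar> + \<bar>c (x - e *\<^sub>R axis k 1)\<bar>" for k
  have "norm \<theta> \<le> (\<Sum>k\<in>UNIV. g k / e)" if \<theta>: "\<theta> \<in> ?K" for \<theta>
  proof -
    have "\<bar>\<theta> $ k\<bar> \<le> g k / e" for k
    proof -
      have "x + e *\<^sub>R axis k 1 \<in> cball x e" "x - e *\<^sub>R axis k 1 \<in> cball x e"
        using e by (auto simp: dist_norm)
      then have "\<theta> \<bullet> (x + e *\<^sub>R axis k 1) \<le> c (x + e *\<^sub>R axis k 1)"
        "\<theta> \<bullet> (x - e *\<^sub>R axis k 1) \<le> c (x - e *\<^sub>R axis k 1)"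
        using c \<theta> by blast+
      then have "e * \<theta> $ k \<le> g k" "- (e * \<theta> $ k) \<le> g k"
        using \<theta> by (auto simp: g_def inner_add_right inner_diff_right inner_axis)
      then have "e * \<bar>\<theta> $ k\<bar> \<le> g k" using e by (auto simp: abs_if)
      then show ?thesis using e by (simp add: field_simps)
    qed
    then have "(\<Sum>k\<in>UNIV. \<bar>\<theta> $ k\<bar>) \<le> (\<Sum>k\<in>UNIV. g k / e)" by (intro sum_mono)
    then show ?thesis using norm_le_l1_cart[of \<theta>] by linarith
  qed
  then have "bounded ?K" by (auto simp: bounded_iff)
  moreover have "closed ?K"
    by (intro closed_Int closed_K closed_Collect_le continuous_intros)
  ultimately have "compact ?K" by (simp add: compact_eq_bounded_closed)
  moreover have "0 \<in> ?K" by (simp add: zero_in_K)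
  then have "?K \<noteq> {}" by blast
  moreover have "continuous_on ?K (\<lambda>\<theta>. \<theta> \<bullet> x)" by (intro continuous_intros)
  ultimately obtain \<theta> where \<theta>: "\<theta> \<in> ?K" "\<And>\<phi>. \<phi> \<in> ?K \<Longrightarrow> \<phi> \<bullet> x \<le> \<theta> \<bullet> x"
    using continuous_attains_sup[of ?K "\<lambda>\<theta>. \<theta> \<bullet> x"] by blast
  show thesis
  proof (rule that)
    show "\<theta> \<in> K" using \<theta> by simp
    fix \<phi> assume "\<phi> \<in> K"
    then show "\<phi> \<bullet> x \<le> \<theta> \<bullet> x" using \<theta> by (cases "0 \<le> \<phi> \<bullet> x") auto
  qed
qed

text \<open>Lagrange multipliers: a maximizer of a linear functional \<open>x\<close> over the sublevel set \<open>K\<close> has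
  gradient proportional to \<open>x\<close>, so the walk tilted by it drifts in direction \<open>x\<close>.\<close>

lemma optimal_tilt:
  assumes A: "A \<in> card_ge_sets L" and r: "r_val (log_mgf M Y) L A = ereal r" "0 < r" and \<epsilon>: "0 < \<epsilon>"
  obtains \<theta> c where "\<theta> \<in> K" "mgf \<theta> = 1" "0 < c" "c *\<^sub>R tilted_mean \<theta> \<in> target L A"
    "\<theta> \<bullet> (c *\<^sub>R tilted_mean \<theta>) \<le> r + \<epsilon>"
proof -
  obtain x where x: "x \<in> target L A" "x \<in> interior {x. I x < \<infinity>}" "I x \<le> ereal (r + \<epsilon>)"
    using near_optimal_interior_point[OF A r(1) \<epsilon>] by blast
  obtain \<theta> where \<theta>: "\<theta> \<in> K" "\<And>\<phi>. \<phi> \<in> K \<Longrightarrow> \<phi> \<bullet> x \<le> \<theta> \<bullet> x"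
    using rate_attained[OF x(2)] by blast
  have le: "\<theta> \<bullet> x \<le> r + \<epsilon>" using x(3) \<theta>(1) unfolding rate_le_iff by blast
  have "I x \<le> ereal (\<theta> \<bullet> x)" unfolding rate_le_iff using \<theta>(2) by blast
  moreover have "ereal r \<le> I x" unfolding r(1)[symmetric] r_val_def using x(1) by (rule INF_lower)
  ultimately have "ereal r \<le> ereal (\<theta> \<bullet> x)" by (rule order_trans[rotated])
  then have pos: "0 < \<theta> \<bullet> x" using r(2) by simp
  have "\<theta> \<notin> interior K"
  proof
    assume "\<theta> \<in> interior K"
    then obtain \<delta> where "0 < \<delta>" "\<theta> + \<delta> *\<^sub>R \<theta> \<in> K" using interior_K_scale by blast
    then show False using \<theta>(2)[of "\<theta> + \<delta> *\<^sub>R \<theta>"] pos by (auto simp: inner_add_left mult_le_0_iff)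
  qed
  then have one: "mgf \<theta> = 1" using mgf_eq_one_if_not_interior \<theta>(1) by blast
  have nz: "\<theta> \<noteq> 0" "x \<noteq> 0" using pos by auto
  have "w \<bullet> x \<le> 0" if w: "w \<bullet> tilted_mean \<theta> < 0" for w
  proof -
    obtain \<delta> where \<delta>: "0 < \<delta>" "\<theta> + \<delta> *\<^sub>R w \<in> interior K" using descent_interior_K[OF \<theta>(1) w] by blast
    then have "\<theta> + \<delta> *\<^sub>R w \<in> K" using interior_subset by blast
    then have "\<delta> * (w \<bullet> x) \<le> 0" using \<theta>(2)[of "\<theta> + \<delta> *\<^sub>R w"] by (simp add: inner_add_left)
    then show ?thesis using \<delta>(1) by (simp add: mult_le_0_iff)
  qed
  then obtain c where "0 < c" "x = c *\<^sub>R tilted_mean \<theta>"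
    using parallel_if_halfspace_subset[OF tilted_mean_neq_0[OF \<theta>(1) one nz(1)] nz(2)] by blast
  then show thesis using that \<theta>(1) one x(1) le by blast
qed

end

section \<open>Tilted measures and stopping events\<close>

lemma sets_gen_sigma:
  "sets (gen_sigma M X I) = sigma_sets (space M) (\<Union>i\<in>I. {X i -` B \<inter> space M | B. B \<in> sets borel})"
  unfolding gen_sigma_def by (rule sets_measure_of) auto

lemma space_gen_sigma [simp]: "space (gen_sigma M X I) = space M"
  unfolding gen_sigma_def by (rule space_measure_of) auto

lemma measurable_gen_sigma:
  fixes X :: "nat \<Rightarrow> 'a \<Rightarrow> real^'n"
  assumes "i \<in> I"
  shows "X i \<in> borel_measurable (gen_sigma M X I)"
proof (rule measurableI)
  fix B :: "(real^'n) set" assume "B \<in> sets borel"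
  then show "X i -` B \<inter> space (gen_sigma M X I) \<in> sets (gen_sigma M X I)"
    unfolding sets_gen_sigma using assms by (intro sigma_sets.Basic) auto
qed simp

lemma sets_gen_sigma_mono: "I \<subseteq> J \<Longrightarrow> sets (gen_sigma M X I) \<subseteq> sets (gen_sigma M X J)"
  unfolding sets_gen_sigma by (intro sigma_sets_mono') auto

lemma sets_gen_sigma_subset:
  assumes "\<And>i. i \<in> I \<Longrightarrow> X i \<in> borel_measurable M"
  shows "sets (gen_sigma M X I) \<subseteq> sets M"
  unfolding sets_gen_sigma using assms by (intro sets.sigma_sets_subset) (auto intro: measurable_sets)

lemma measurable_walk:
  assumes "n \<le> m"
  shows "walk X n \<in> borel_measurable (gen_sigma M X {..<m})"
  unfolding walk_def[abs_def] using assms by (intro borel_measurable_sum measurable_gen_sigma) auto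

lemma mem_scaled_target_iff:
  fixes x :: "real^'n::finite"
  assumes "0 < b"
  shows "x \<in> (\<lambda>x. b *\<^sub>R x) ` target L A \<longleftrightarrow> (1 / b) *\<^sub>R x \<in> target L A"
  using assms by (auto simp: image_iff intro!: bexI[of _ "(1 / b) *\<^sub>R x"])

text \<open>Reduces measurability and path arguments about the stopping times to finitely many
  positions of the walk. A finite bound excludes the empty infimum, and a nonempty infimum in
  \<open>enat\<close> is attained.\<close>

lemma Min_hit_time_le_iff:
  fixes \<A> :: "'n::finite set set"
  assumes "\<A> \<noteq> {}"
  shows "(MIN A\<in>\<A>. hit_time X L b A \<omega>) \<le> enat n \<longleftrightarrow>
    (\<exists>A\<in>\<A>. \<exists>m\<le>n. walk X m \<omega> \<in> (\<lambda>x. b *\<^sub>R x) ` target L A)"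
proof -
  have "hit_time X L b A \<omega> \<le> enat n \<longleftrightarrow> (\<exists>m\<le>n. walk X m \<omega> \<in> (\<lambda>x. b *\<^sub>R x) ` target L A)" for A
  proof
    assume le: "hit_time X L b A \<omega> \<le> enat n"
    let ?N = "enat ` {n. walk X n \<omega> \<in> (\<lambda>x. b *\<^sub>R x) ` target L A}"
    have "?N \<noteq> {}" using le unfolding hit_time_def Inf_enat_def by (auto split: if_splits)
    then obtain k where "k \<in> ?N" by blast
    then have "(LEAST k. k \<in> ?N) \<in> ?N" by (rule LeastI)
    then have "Inf ?N \<in> ?N" using \<open>?N \<noteq> {}\<close> unfolding Inf_enat_def by presburger
    then show "\<exists>m\<le>n. walk X m \<omega> \<in> (\<lambda>x. b *\<^sub>R x) ` target L A"
      using le unfolding hit_time_def by auto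
  next
    assume "\<exists>m\<le>n. walk X m \<omega> \<in> (\<lambda>x. b *\<^sub>R x) ` target L A"
    then obtain m where m: "m \<le> n" "walk X m \<omega> \<in> (\<lambda>x. b *\<^sub>R x) ` target L A" by blast
    then have "hit_time X L b A \<omega> \<le> enat m" unfolding hit_time_def by (intro Inf_lower) auto
    also have "\<dots> \<le> enat n" using m by simp
    finally show "hit_time X L b A \<omega> \<le> enat n" .
  qed
  then show ?thesis using assms by (subst Min_le_iff) auto
qed

text \<open>The only access to a tilted measure: events decided by a fixed time n are evaluated by
  an integral under M.\<close>

lemma exp_tilted_restr:
  assumes "exp_tilted M X \<theta> Q" and X: "\<And>i. X i \<in> borel_measurable M"
  shows "subalgebra Q (gen_sigma M X {..<n})"
    and "E \<in> sets (gen_sigma M X {..<n}) \<Longrightarrow> emeasure Q E =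
      (\<integral>\<^sup>+\<omega>. ennreal (exp (\<theta> \<bullet> walk X n \<omega> - real n * real_of_ereal (log_mgf M (X 0) \<theta>))) * indicator E \<omega> \<partial>M)"
proof -
  let ?F = "gen_sigma M X {..<n}"
  let ?g = "\<lambda>\<omega>. ennreal (exp (\<theta> \<bullet> walk X n \<omega> - real n * real_of_ereal (log_mgf M (X 0) \<theta>)))"
  have Q: "sets Q = sets (gen_sigma M X UNIV)"
    "restr_to_subalg Q ?F = density (restr_to_subalg M ?F) ?g"
    using assms(1) by (auto simp: exp_tilted_def)
  have "space Q = space M" using sets_eq_imp_space_eq[OF Q(1)] by simp
  then show sQ: "subalgebra Q ?F"
    using Q(1) sets_gen_sigma_mono[of "{..<n}" UNIV M X] by (auto simp: subalgebra_def)
  have sM: "subalgebra M ?F"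
    using sets_gen_sigma_subset[of "{..<n}" X M] X by (auto simp: subalgebra_def)
  have [measurable]: "walk X n \<in> borel_measurable ?F" by (rule measurable_walk) simp
  assume E[measurable]: "E \<in> sets ?F"
  have "emeasure Q E = emeasure (density (restr_to_subalg M ?F) ?g) E"
    unfolding Q(2)[symmetric] by (rule emeasure_restr_to_subalg[OF sQ E, symmetric])
  also have "\<dots> = (\<integral>\<^sup>+\<omega>. ?g \<omega> * indicator E \<omega> \<partial>restr_to_subalg M ?F)"
    using E by (intro emeasure_density measurable_in_subalg[OF sM]) (auto simp: sets_restr_to_subalg[OF sM])
  also have "\<dots> = (\<integral>\<^sup>+\<omega>. ?g \<omega> * indicator E \<omega> \<partial>M)"
    by (rule nn_integral_subalgebra2[OF sM]) measurable
  finally show "emeasure Q E = (\<integral>\<^sup>+\<omega>. ?g \<omega> * indicator E \<omega> \<partial>M)" .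
qed

locale tilted_walk = hitting_setup M "X 0" L
  for M :: "'a measure" and X :: "nat \<Rightarrow> 'a \<Rightarrow> real^'n::finite" and L :: nat +
  fixes P :: "real^'n \<Rightarrow> 'a measure"
  assumes X_measurable: "\<And>i. X i \<in> borel_measurable M"
    and tilted: "\<And>\<theta>. \<theta> \<in> dom_fun (log_mgf M (X 0)) \<Longrightarrow> exp_tilted M X \<theta> (P \<theta>)"
begin

abbreviation F :: "nat \<Rightarrow> 'a measure" where "F n \<equiv> gen_sigma M X {..<n}"

text \<open>The log-likelihood ratio on \<open>F n\<close>. For \<theta> in the domain
  \<open>real_of_ereal\<close> loses nothing; at infinity it would return 0.\<close>

definition llr :: "real^'n \<Rightarrow> nat \<Rightarrow> 'a \<Rightarrow> real" where
  "llr \<theta> n \<omega> = \<theta> \<bullet> walk X n \<omega> - real n * real_of_ereal (log_mgf M (X 0) \<theta>)"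

lemma measurable_llr: "llr \<theta> n \<in> borel_measurable (F n)"
proof -
  have [measurable]: "walk X n \<in> borel_measurable (F n)" by (rule measurable_walk) simp
  show ?thesis unfolding llr_def[abs_def] by measurable
qed

lemma subalgebra_F: "subalgebra M (F n)"
  using sets_gen_sigma_subset[of "{..<n}" X M] X_measurable by (auto simp: subalgebra_def)

lemma F_sets_M: "E \<in> sets (F n) \<Longrightarrow> E \<in> sets M"
  using subalgebra_F by (auto simp: subalgebra_def)

lemma F_measurable_M: "f \<in> borel_measurable (F n) \<Longrightarrow> f \<in> borel_measurable M"
  by (rule measurable_from_subalg[OF subalgebra_F])

lemma tilted_props:
  assumes "\<theta> \<in> dom_fun (log_mgf M (X 0))"
  shows "prob_space (P \<theta>)" "sets (P \<theta>) = sets (gen_sigma M X UNIV)" "subalgebra (P \<theta>) (F n)"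
    "E \<in> sets (F n) \<Longrightarrow> emeasure (P \<theta>) E = (\<integral>\<^sup>+\<omega>. ennreal (exp (llr \<theta> n \<omega>)) * indicator E \<omega> \<partial>M)"
  using tilted[OF assms] exp_tilted_restr[OF tilted[OF assms] X_measurable]
  by (auto simp: exp_tilted_def llr_def)

text \<open>All exponential estimates of probabilities come from here: the upper bound under M, the
  Chernoff bound, and the lower bound, where c is negative.\<close>

lemma tilted_compare:
  assumes "\<theta> \<in> dom_fun (log_mgf M (X 0))" "\<phi> \<in> dom_fun (log_mgf M (X 0))" "E \<in> sets (F n)"
    and le: "\<And>\<omega>. \<omega> \<in> E \<Longrightarrow> c + llr \<theta> n \<omega> \<le> llr \<phi> n \<omega>"
  shows "emeasure (P \<theta>) E \<le> ennreal (exp (- c)) * emeasure (P \<phi>) E"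
proof -
  note [measurable] = F_measurable_M[OF measurable_llr] F_sets_M[OF assms(3)]
  have "emeasure (P \<theta>) E = (\<integral>\<^sup>+\<omega>. ennreal (exp (llr \<theta> n \<omega>)) * indicator E \<omega> \<partial>M)"
    by (rule tilted_props(4)[OF assms(1,3)])
  also have "\<dots> \<le> (\<integral>\<^sup>+\<omega>. ennreal (exp (- c)) * (ennreal (exp (llr \<phi> n \<omega>)) * indicator E \<omega>) \<partial>M)"
  proof (intro nn_integral_mono)
    fix \<omega>
    have "ennreal (exp (llr \<theta> n \<omega>)) \<le> ennreal (exp (- c)) * ennreal (exp (llr \<phi> n \<omega>))" if "\<omega> \<in> E"
      using le[OF that] by (subst ennreal_mult[symmetric]) (auto simp: mult_exp_exp intro!: ennreal_leI)
    then show "ennreal (exp (llr \<theta> n \<omega>)) * indicator E \<omega> \<le>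
        ennreal (exp (- c)) * (ennreal (exp (llr \<phi> n \<omega>)) * indicator E \<omega>)"
      by (auto simp: indicator_def)
  qed
  also have "\<dots> = ennreal (exp (- c)) * (\<integral>\<^sup>+\<omega>. ennreal (exp (llr \<phi> n \<omega>)) * indicator E \<omega> \<partial>M)"
    by (rule nn_integral_cmult) measurable
  also have "\<dots> = ennreal (exp (- c)) * emeasure (P \<phi>) E"
    using tilted_props(4)[OF assms(2,3)] by simp
  finally show ?thesis .
qed

lemma llr_zero: "llr 0 n \<omega> = 0"
  by (simp add: llr_def log_mgf_eq[OF zero_dom] mgf_zero)

text \<open>Makes M an instance of \<open>tilted_compare\<close>, as the tilt by 0.\<close>

lemma emeasure_P_zero: "E \<in> sets (F n) \<Longrightarrow> emeasure (P 0) E = emeasure M E"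
  using F_sets_M by (simp add: tilted_props(4)[OF zero_dom] llr_zero)

text \<open>A bound on the inner product alone, such as b times a constant on a scaled target, thus
  bounds the likelihood ratio uniformly in n.\<close>

lemma llr_K: "\<theta> \<in> K \<Longrightarrow> \<theta> \<bullet> walk X n \<omega> \<le> llr \<theta> n \<omega>"
  using K_subset_dom mgf_pos[of \<theta>]
  by (auto simp: llr_def log_mgf_eq K_iff mult_le_0_iff ln_le_zero_iff subset_iff)

text \<open>Slicing the event by the value of the stopping time puts each piece into some
  \<open>F n\<close>, where the densities are known.\<close>

definition stop :: "real \<Rightarrow> nat \<Rightarrow> 'a set" where
  "stop b n = {\<omega>\<in>space M. tau_star X L b \<omega> = enat n \<and> enat n < tau_zero X L b \<omega>}"

definition hits :: "real \<Rightarrow> nat \<Rightarrow> 'n set \<Rightarrow> 'a set" where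
  "hits b n A = {\<omega>\<in>space M. walk X n \<omega> \<in> (\<lambda>x. b *\<^sub>R x) ` target L A}"

lemma hits_sets:
  assumes "0 < b" "m \<le> n"
  shows "hits b m A \<in> sets (F n)"
proof -
  have [measurable]: "walk X m \<in> borel_measurable (F n)" by (rule measurable_walk[OF assms(2)])
  have [measurable]: "target L A \<in> sets borel" by (rule borel_open[OF open_target])
  have "hits b m A = {\<omega>\<in>space (F n). (1 / b) *\<^sub>R walk X m \<omega> \<in> target L A}"
    unfolding hits_def mem_scaled_target_iff[OF assms(1)] by simp
  also have "\<dots> \<in> sets (F n)" by measurable
  finally show ?thesis .
qed

lemma card_ge_sets_nonempty: "card_ge_sets L \<noteq> ({} :: 'n set set)"
  using UNIV_card_ge by blast

lemma not_card_ge_sets_nonempty: "- card_ge_sets L \<noteq> ({} :: 'n set set)"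
proof -
  have "{} \<in> (- card_ge_sets L :: 'n set set)" using L_pos by (simp add: card_ge_sets_def)
  then show ?thesis by blast
qed

lemma tau_star_le_iff:
  "tau_star X L b \<omega> \<le> enat n \<longleftrightarrow> (\<exists>A\<in>card_ge_sets L. \<exists>m\<le>n. walk X m \<omega> \<in> (\<lambda>x. b *\<^sub>R x) ` target L A)"
  unfolding tau_star_def by (rule Min_hit_time_le_iff[OF card_ge_sets_nonempty])

lemma tau_zero_le_iff:
  "tau_zero X L b \<omega> \<le> enat n \<longleftrightarrow> (\<exists>A\<in>-card_ge_sets L. \<exists>m\<le>n. walk X m \<omega> \<in> (\<lambda>x. b *\<^sub>R x) ` target L A)"
  unfolding tau_zero_def by (rule Min_hit_time_le_iff[OF not_card_ge_sets_nonempty])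

lemma enat_eq_iff_le: "t = enat n \<longleftrightarrow> t \<le> enat n \<and> (\<forall>m<n. \<not> t \<le> enat m)"
  by (cases t) (auto simp: le_less)

lemma stop_subset_hits: "stop b n \<subseteq> (\<Union>A\<in>card_ge_sets L. hits b n A)"
proof
  fix \<omega> assume \<omega>: "\<omega> \<in> stop b n"
  then have t: "tau_star X L b \<omega> \<le> enat n" "\<forall>m<n. \<not> tau_star X L b \<omega> \<le> enat m"
    by (auto simp: stop_def)
  obtain A m where A: "A \<in> card_ge_sets L" "m \<le> n" "walk X m \<omega> \<in> (\<lambda>x. b *\<^sub>R x) ` target L A"
    using t(1) unfolding tau_star_le_iff by blast
  have "tau_star X L b \<omega> \<le> enat m" unfolding tau_star_le_iff using A by blast
  then have "m = n" using t(2) A(2) by (metis le_neq_implies_less)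
  then show "\<omega> \<in> (\<Union>A\<in>card_ge_sets L. hits b n A)" using A \<omega> by (auto simp: hits_def stop_def)
qed

lemma stop_sets:
  assumes "0 < b"
  shows "stop b n \<in> sets (F n)"
proof -
  let ?S = "\<lambda>m. \<Union>A\<in>card_ge_sets L. \<Union>i\<in>{..m}. hits b i A"
  let ?Z = "\<Union>A\<in>- card_ge_sets L. \<Union>i\<in>{..n}. hits b i A"
  have "stop b n = (?S n - (\<Union>m\<in>{..<n}. ?S m)) - ?Z"
  proof -
    have S: "\<omega> \<in> ?S m \<longleftrightarrow> tau_star X L b \<omega> \<le> enat m" and Z: "\<omega> \<in> ?Z \<longleftrightarrow> tau_zero X L b \<omega> \<le> enat n"
      if "\<omega> \<in> space M" for \<omega> m
      unfolding tau_star_le_iff tau_zero_le_iff using that by (simp_all only: hits_def UN_iff mem_Collect_eq) blast+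
    show ?thesis
    proof (intro set_eqI)
      fix \<omega>
      show "\<omega> \<in> stop b n \<longleftrightarrow> \<omega> \<in> (?S n - (\<Union>m\<in>{..<n}. ?S m)) - ?Z"
      proof (cases "\<omega> \<in> space M")
        case True
        show ?thesis
          unfolding Diff_iff UN_iff[of \<omega> ?S] S[OF True] Z[OF True] stop_def
          using True enat_eq_iff_le[of "tau_star X L b \<omega>" n] by (auto simp: not_le)
      next
        case False
        then show ?thesis by (auto simp: stop_def hits_def)
      qed
    qed
  qed
  also have "\<dots> \<in> sets (F n)"
    using assms by (intro sets.Diff sets.finite_UN hits_sets) auto
  finally show ?thesis .
qed

lemma disjoint_stop: "disjoint_family (stop b)"
  by (auto simp: disjoint_family_on_def stop_def)

lemma UN_stop: "(\<Union>n. stop b n) = {\<omega>\<in>space M. tau_star X L b \<omega> < tau_zero X L b \<omega>}"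
proof (intro equalityI subsetI)
  fix \<omega> assume \<omega>: "\<omega> \<in> {\<omega>\<in>space M. tau_star X L b \<omega> < tau_zero X L b \<omega>}"
  then obtain n where "tau_star X L b \<omega> = enat n" by (cases "tau_star X L b \<omega>") auto
  then show "\<omega> \<in> (\<Union>n. stop b n)" using \<omega> by (auto simp: stop_def intro!: exI[of _ n])
qed (auto simp: stop_def)

end

section \<open>The second moment of the estimator\<close>

context tilted_walk
begin

definition mix_density :: "(real^'n) set \<Rightarrow> nat \<Rightarrow> 'a \<Rightarrow> real" where
  "mix_density \<Theta> n \<omega> = 1 / real (card \<Theta>) * (\<Sum>\<theta>\<in>\<Theta>. exp (llr \<theta> n \<omega>))"

lemma mix_density_pos: "finite \<Theta> \<Longrightarrow> \<Theta> \<noteq> {} \<Longrightarrow> 0 < mix_density \<Theta> n \<omega>"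
  unfolding mix_density_def by (intro mult_pos_pos sum_pos) (auto simp: card_gt_0_iff)

lemma measurable_mix_density: "mix_density \<Theta> n \<in> borel_measurable (F n)"
proof -
  note [measurable] = measurable_llr
  show ?thesis unfolding mix_density_def[abs_def] by measurable
qed

abbreviation mix :: "(real^'n) set \<Rightarrow> 'a measure" where
  "mix \<equiv> mixture (gen_sigma M X UNIV) P"

lemma subalgebra_mix: "subalgebra (mix \<Theta>) (F n)"
  using sets_gen_sigma_mono[of "{..<n}" UNIV M X] by (auto simp: subalgebra_def)

lemma restr_mix:
  assumes "finite \<Theta>" "\<Theta> \<noteq> {}" "\<Theta> \<subseteq> dom_fun (log_mgf M (X 0))"
  shows "restr_to_subalg (mix \<Theta>) (F n) =
    density (restr_to_subalg M (F n)) (\<lambda>\<omega>. ennreal (mix_density \<Theta> n \<omega>))"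
proof (rule measure_eqI)
  show "sets (restr_to_subalg (mix \<Theta>) (F n)) =
      sets (density (restr_to_subalg M (F n)) (\<lambda>\<omega>. ennreal (mix_density \<Theta> n \<omega>)))"
    by (simp add: sets_restr_to_subalg subalgebra_mix subalgebra_F)
  fix E assume "E \<in> sets (restr_to_subalg (mix \<Theta>) (F n))"
  then have E: "E \<in> sets (F n)" by (simp add: sets_restr_to_subalg subalgebra_mix)
  have E': "E \<in> sets (gen_sigma M X UNIV)" using E sets_gen_sigma_mono[of "{..<n}" UNIV M X] by auto
  note [measurable] = E F_sets_M[OF E] measurable_mix_density F_measurable_M[OF measurable_llr]
  have card: "0 < real (card \<Theta>)" using assms by (simp add: card_gt_0_iff)
  have dens: "ennreal (mix_density \<Theta> n \<omega>) = (\<Sum>\<theta>\<in>\<Theta>. ennreal (exp (llr \<theta> n \<omega>))) / of_nat (card \<Theta>)" for \<omega>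
    using card by (simp add: mix_density_def divide_ennreal sum_nonneg ennreal_of_nat_eq_real_of_nat
        flip: divide_ennreal)
  have "emeasure (restr_to_subalg (mix \<Theta>) (F n)) E = emeasure (mix \<Theta>) E"
    by (rule emeasure_restr_to_subalg[OF subalgebra_mix E])
  also have "\<dots> = (\<Sum>\<theta>\<in>\<Theta>. emeasure (P \<theta>) E) / of_nat (card \<Theta>)"
    using assms(3) tilted_props(2) by (intro emeasure_mixture E') auto
  also have "\<dots> = (\<Sum>\<theta>\<in>\<Theta>. \<integral>\<^sup>+\<omega>. ennreal (exp (llr \<theta> n \<omega>)) * indicator E \<omega> \<partial>M) / of_nat (card \<Theta>)"
    using assms(3) by (intro arg_cong2[where f = "(/)"] sum.cong refl tilted_props(4)[OF _ E]) auto
  also have "\<dots> = (\<integral>\<^sup>+\<omega>. (\<Sum>\<theta>\<in>\<Theta>. ennreal (exp (llr \<theta> n \<omega>)) * indicator E \<omega>) / of_nat (card \<Theta>) \<partial>M)"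
    by (simp add: nn_integral_divide nn_integral_sum)
  also have "\<dots> = (\<integral>\<^sup>+\<omega>. ennreal (mix_density \<Theta> n \<omega>) * indicator E \<omega> \<partial>M)"
    by (intro nn_integral_cong) (simp only: dens sum_distrib_right[symmetric] ennreal_times_divide mult.commute[of _ "indicator E _"] sum_distrib_left[symmetric])
  also have "\<dots> = (\<integral>\<^sup>+\<omega>. ennreal (mix_density \<Theta> n \<omega>) * indicator E \<omega> \<partial>restr_to_subalg M (F n))"
    by (rule nn_integral_subalgebra2[OF subalgebra_F, symmetric]) measurable
  also have "\<dots> = emeasure (density (restr_to_subalg M (F n)) (\<lambda>\<omega>. ennreal (mix_density \<Theta> n \<omega>))) E"
    by (rule emeasure_density[symmetric])
      (auto simp: sets_restr_to_subalg[OF subalgebra_F] E intro!: measurable_in_subalg[OF subalgebra_F])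
  finally show "emeasure (restr_to_subalg (mix \<Theta>) (F n)) E =
      emeasure (density (restr_to_subalg M (F n)) (\<lambda>\<omega>. ennreal (mix_density \<Theta> n \<omega>))) E" .
qed

lemma nn_integral_mix:
  assumes \<Theta>: "finite \<Theta>" "\<Theta> \<noteq> {}" "\<Theta> \<subseteq> dom_fun (log_mgf M (X 0))"
    and f: "f \<in> borel_measurable (F n)"
  shows "(\<integral>\<^sup>+\<omega>. f \<omega> \<partial>mix \<Theta>) = (\<integral>\<^sup>+\<omega>. ennreal (mix_density \<Theta> n \<omega>) * f \<omega> \<partial>M)"
proof -
  note [measurable] = f measurable_mix_density
  have "(\<integral>\<^sup>+\<omega>. f \<omega> \<partial>mix \<Theta>) = (\<integral>\<^sup>+\<omega>. f \<omega> \<partial>restr_to_subalg (mix \<Theta>) (F n))"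
    by (rule nn_integral_subalgebra2[OF subalgebra_mix f, symmetric])
  also have "\<dots> = (\<integral>\<^sup>+\<omega>. ennreal (mix_density \<Theta> n \<omega>) * f \<omega> \<partial>restr_to_subalg M (F n))"
    unfolding restr_mix[OF \<Theta>] by (rule nn_integral_density) (auto intro!: measurable_in_subalg[OF subalgebra_F])
  also have "\<dots> = (\<integral>\<^sup>+\<omega>. ennreal (mix_density \<Theta> n \<omega>) * f \<omega> \<partial>M)"
    by (rule nn_integral_subalgebra2[OF subalgebra_F]) measurable
  finally show ?thesis .
qed

text \<open>Back under M, the mixture density cancels one of the two inverse densities in the
  squared estimator. Values in \<open>ennreal\<close> allow infinity until the exponential bound
  rules it out.\<close>

definition second_moment :: "(real^'n) set \<Rightarrow> real \<Rightarrow> ennreal" where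
  "second_moment \<Theta> b = (\<Sum>n. \<integral>\<^sup>+\<omega>. ennreal (inverse (mix_density \<Theta> n \<omega>)) * indicator (stop b n) \<omega> \<partial>M)"

lemma IS_estimator_sq:
  assumes "\<omega> \<in> space M"
  shows "ennreal ((IS_estimator M X L b \<Theta> \<omega>)\<^sup>2) =
    (\<Sum>n. ennreal ((inverse (mix_density \<Theta> n \<omega>))\<^sup>2) * indicator (stop b n) \<omega>)"
proof (cases "tau_star X L b \<omega> < tau_zero X L b \<omega>")
  case True
  then obtain n where n: "\<omega> \<in> stop b n" using assms UN_stop[of b] by blast
  then have t: "tau_star X L b \<omega> = enat n" by (simp add: stop_def)
  have "IS_estimator M X L b \<Theta> \<omega> = inverse (mix_density \<Theta> n \<omega>)"
    using True by (simp add: IS_estimator_def t mix_density_def llr_def Let_def)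
  then show ?thesis
    using suminf_cmult_indicator[OF disjoint_stop n, of "\<lambda>n. ennreal ((inverse (mix_density \<Theta> n \<omega>))\<^sup>2)"] by simp
next
  case False
  then have "\<omega> \<notin> stop b n" for n by (auto simp: stop_def)
  then show ?thesis using False by (simp add: IS_estimator_def Let_def)
qed

text \<open>Consistent even if the moment is infinite: the Bochner integral and
  \<open>enn2real\<close> then both return 0, so finiteness must be supplied separately.\<close>

lemma integral_IS_estimator_sq:
  assumes b: "0 < b" and \<Theta>: "finite \<Theta>" "\<Theta> \<noteq> {}" "\<Theta> \<subseteq> dom_fun (log_mgf M (X 0))"
  shows "(\<integral>\<omega>. (IS_estimator M X L b \<Theta> \<omega>)\<^sup>2 \<partial>mix \<Theta>) = enn2real (second_moment \<Theta> b)"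
proof -
  let ?g = "\<lambda>n \<omega>. ennreal ((inverse (mix_density \<Theta> n \<omega>))\<^sup>2) * indicator (stop b n) \<omega>"
  have gF: "?g n \<in> borel_measurable (F n)" for n
  proof -
    note [measurable] = measurable_mix_density stop_sets[OF b]
    show ?thesis by measurable
  qed
  have g[measurable]: "?g n \<in> borel_measurable (mix \<Theta>)" for n
    by (rule measurable_from_subalg[OF subalgebra_mix gF])
  have sq: "\<omega> \<in> space (mix \<Theta>) \<Longrightarrow> ennreal ((IS_estimator M X L b \<Theta> \<omega>)\<^sup>2) = (\<Sum>n. ?g n \<omega>)" for \<omega>
    using IS_estimator_sq[of \<omega>] by simp
  \<comment> \<open>Measurability is inherited from the series over slices, which avoids the random
    index \<open>the_enat (tau_star X L b \<omega>)\<close>.\<close>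
  have "(\<lambda>\<omega>. (IS_estimator M X L b \<Theta> \<omega>)\<^sup>2) \<in> borel_measurable (mix \<Theta>) \<longleftrightarrow>
      (\<lambda>\<omega>. enn2real (\<Sum>n. ?g n \<omega>)) \<in> borel_measurable (mix \<Theta>)"
    by (rule measurable_cong) (simp flip: sq)
  then have "(\<lambda>\<omega>. (IS_estimator M X L b \<Theta> \<omega>)\<^sup>2) \<in> borel_measurable (mix \<Theta>)" by simp
  then have "(\<integral>\<omega>. (IS_estimator M X L b \<Theta> \<omega>)\<^sup>2 \<partial>mix \<Theta>) =
      enn2real (\<integral>\<^sup>+\<omega>. ennreal ((IS_estimator M X L b \<Theta> \<omega>)\<^sup>2) \<partial>mix \<Theta>)"
    by (intro integral_eq_nn_integral) auto
  also have "(\<integral>\<^sup>+\<omega>. ennreal ((IS_estimator M X L b \<Theta> \<omega>)\<^sup>2) \<partial>mix \<Theta>) = (\<integral>\<^sup>+\<omega>. (\<Sum>n. ?g n \<omega>) \<partial>mix \<Theta>)"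
    by (intro nn_integral_cong sq)
  also have "\<dots> = (\<Sum>n. \<integral>\<^sup>+\<omega>. ?g n \<omega> \<partial>mix \<Theta>)" by (rule nn_integral_suminf[OF g])
  also have "\<dots> = second_moment \<Theta> b"
    unfolding second_moment_def nn_integral_mix[OF \<Theta> gF]
  proof (intro suminf_cong nn_integral_cong)
    fix n \<omega>
    have "0 < mix_density \<Theta> n \<omega>" by (rule mix_density_pos[OF \<Theta>(1,2)])
    then have "ennreal (mix_density \<Theta> n \<omega>) * ennreal ((inverse (mix_density \<Theta> n \<omega>))\<^sup>2) =
        ennreal (inverse (mix_density \<Theta> n \<omega>))"
      by (subst ennreal_mult[symmetric]) (auto simp: power2_eq_square)
    then show "ennreal (mix_density \<Theta> n \<omega>) * (ennreal ((inverse (mix_density \<Theta> n \<omega>))\<^sup>2) * indicator (stop b n) \<omega>) =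
        ennreal (inverse (mix_density \<Theta> n \<omega>)) * indicator (stop b n) \<omega>"
      by (simp add: mult.assoc[symmetric])
  qed
  finally show ?thesis .
qed

definition error_prob :: "real \<Rightarrow> real" where
  "error_prob b = measure M {\<omega>\<in>space M. tau_star X L b \<omega> < tau_zero X L b \<omega>}"

text \<open>Cauchy--Schwarz, in the form \<open>2 p \<le> 1 / D + p\<^sup>2 D\<close> integrated over the event.\<close>

lemma error_prob_sq_le:
  assumes b: "0 < b" and \<Theta>: "finite \<Theta>" "\<Theta> \<noteq> {}" "\<Theta> \<subseteq> dom_fun (log_mgf M (X 0))"
    and fin: "second_moment \<Theta> b < \<infinity>"
  shows "(error_prob b)\<^sup>2 \<le> enn2real (second_moment \<Theta> b)"
proof -
  define p where "p = error_prob b"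
  have p: "0 \<le> p" by (simp add: p_def error_prob_def)
  note [measurable] = F_sets_M[OF stop_sets[OF b]] F_measurable_M[OF measurable_mix_density]
  have ind: "(\<lambda>\<omega>. indicator (stop b n) \<omega> :: ennreal) \<in> borel_measurable (F n)" for n
    by (rule borel_measurable_indicator[OF stop_sets[OF b]])
  have emp: "(\<Sum>n. emeasure M (stop b n)) = ennreal p"
    by (subst suminf_emeasure) (auto simp: UN_stop p_def error_prob_def emeasure_eq_measure disjoint_stop)
  have le: "2 * ennreal p * emeasure M (stop b n) \<le>
     (\<integral>\<^sup>+\<omega>. ennreal (inverse (mix_density \<Theta> n \<omega>)) * indicator (stop b n) \<omega> \<partial>M)
       + ennreal (p\<^sup>2) * emeasure (mix \<Theta>) (stop b n)" for n
  proof -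
    have "2 * ennreal p * emeasure M (stop b n) = (\<integral>\<^sup>+\<omega>. 2 * ennreal p * indicator (stop b n) \<omega> \<partial>M)"
      by (simp add: nn_integral_cmult)
    also have "\<dots> \<le> (\<integral>\<^sup>+\<omega>. ennreal (inverse (mix_density \<Theta> n \<omega>)) * indicator (stop b n) \<omega>
        + ennreal (p\<^sup>2) * (ennreal (mix_density \<Theta> n \<omega>) * indicator (stop b n) \<omega>) \<partial>M)"
    proof (intro nn_integral_mono)
      fix \<omega>
      define D where "D = mix_density \<Theta> n \<omega>"
      have D: "0 < D" unfolding D_def by (rule mix_density_pos[OF \<Theta>(1,2)])
      have "0 \<le> (1 - p * D)\<^sup>2 / D" using D by simp
      also have "\<dots> = inverse D + p\<^sup>2 * D - 2 * p"
        using D by (simp add: field_simps power2_eq_square)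
      finally have "ennreal (2 * p) \<le> ennreal (inverse D + p\<^sup>2 * D)" by (intro ennreal_leI) simp
      also have "\<dots> = ennreal (inverse D) + ennreal (p\<^sup>2) * ennreal D"
        using D by (simp add: ennreal_mult ennreal_plus)
      finally have "2 * ennreal p \<le> ennreal (inverse D) + ennreal (p\<^sup>2) * ennreal D"
        using p by (simp add: ennreal_mult)
      then show "2 * ennreal p * indicator (stop b n) \<omega> \<le> ennreal (inverse (mix_density \<Theta> n \<omega>)) * indicator (stop b n) \<omega>
        + ennreal (p\<^sup>2) * (ennreal (mix_density \<Theta> n \<omega>) * indicator (stop b n) \<omega>)"
        by (simp add: D_def[symmetric] indicator_def)
    qed
    also have "\<dots> = (\<integral>\<^sup>+\<omega>. ennreal (inverse (mix_density \<Theta> n \<omega>)) * indicator (stop b n) \<omega> \<partial>M)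
       + ennreal (p\<^sup>2) * (\<integral>\<^sup>+\<omega>. ennreal (mix_density \<Theta> n \<omega>) * indicator (stop b n) \<omega> \<partial>M)"
      by (simp add: nn_integral_add nn_integral_cmult)
    also have "(\<integral>\<^sup>+\<omega>. ennreal (mix_density \<Theta> n \<omega>) * indicator (stop b n) \<omega> \<partial>M) = emeasure (mix \<Theta>) (stop b n)"
      unfolding nn_integral_mix[OF \<Theta> ind, symmetric] using subalgebra_mix[of \<Theta> n] stop_sets[OF b, of n]
      by (intro nn_integral_indicator) (auto simp: subalgebra_def)
    finally show ?thesis .
  qed
  have stop_mix: "stop b n \<in> sets (mix \<Theta>)" for n
    using subalgebra_mix[of \<Theta> n] stop_sets[OF b, of n] by (auto simp: subalgebra_def)
  have "(\<Sum>n. emeasure (mix \<Theta>) (stop b n)) = emeasure (mix \<Theta>) (\<Union>n. stop b n)"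
    by (rule suminf_emeasure) (use stop_mix disjoint_stop in auto)
  also have "\<dots> \<le> emeasure (mix \<Theta>) (space (mix \<Theta>))" by (rule emeasure_space)
  also have "\<dots> = (\<integral>\<^sup>+\<omega>. 1 \<partial>mix \<Theta>)" by simp
  \<comment> \<open>At time 0 the walk is 0 and the density is 1, which gives the total mass of the
    mixture.\<close>
  also have "\<dots> = (\<integral>\<^sup>+\<omega>. ennreal (mix_density \<Theta> 0 \<omega>) * 1 \<partial>M)" by (rule nn_integral_mix[OF \<Theta>]) simp
  also have "\<dots> = 1"
    using \<Theta> by (simp add: mix_density_def llr_def walk_def emeasure_space_1)
  finally have mix1: "(\<Sum>n. emeasure (mix \<Theta>) (stop b n)) \<le> 1" .
  have "ennreal (2 * p\<^sup>2) = 2 * ennreal p * (\<Sum>n. emeasure M (stop b n))"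
    using p by (simp add: emp ennreal_mult power2_eq_square mult.assoc)
  also have "\<dots> = (\<Sum>n. 2 * ennreal p * emeasure M (stop b n))" by (rule ennreal_suminf_cmult[symmetric])
  also have "\<dots> \<le> (\<Sum>n. (\<integral>\<^sup>+\<omega>. ennreal (inverse (mix_density \<Theta> n \<omega>)) * indicator (stop b n) \<omega> \<partial>M)
       + ennreal (p\<^sup>2) * emeasure (mix \<Theta>) (stop b n))"
    by (intro suminf_le le) auto
  also have "\<dots> = second_moment \<Theta> b + (\<Sum>n. ennreal (p\<^sup>2) * emeasure (mix \<Theta>) (stop b n))"
    unfolding second_moment_def by (rule suminf_add[symmetric]) auto
  also have "\<dots> = second_moment \<Theta> b + ennreal (p\<^sup>2) * (\<Sum>n. emeasure (mix \<Theta>) (stop b n))"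
    by (simp add: ennreal_suminf_cmult)
  also have "\<dots> \<le> second_moment \<Theta> b + ennreal (p\<^sup>2) * 1"
    by (intro add_left_mono mult_left_mono mix1) auto
  also have "\<dots> = ennreal (enn2real (second_moment \<Theta> b) + p\<^sup>2)"
    using fin by (simp add: ennreal_plus)
  finally have "2 * p\<^sup>2 \<le> enn2real (second_moment \<Theta> b) + p\<^sup>2"
    by (subst (asm) ennreal_le_iff) auto
  then show ?thesis by (simp add: p_def)
qed

text \<open>On \<open>{S\<^sub>n \<in> b W\<^sup>A}\<close> the weight is controlled by the component \<open>\<theta> A\<close> of the mixture, and the
  probability of that event by a change of measure to \<open>\<phi> A\<close>.\<close>

lemma second_moment_le:
  assumes b: "0 < b" and \<Theta>: "finite \<Theta>" "\<Theta> \<noteq> {}"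
    and bound: "\<And>A. A \<in> card_ge_sets L \<Longrightarrow> \<theta> A \<in> \<Theta> \<and> \<theta> A \<in> K \<and> \<phi> A \<in> K"
      "\<And>A x. A \<in> card_ge_sets L \<Longrightarrow> x \<in> target L A \<Longrightarrow> p A \<le> \<theta> A \<bullet> x \<and> q A \<le> \<phi> A \<bullet> x"
  shows "second_moment \<Theta> b \<le> ennreal (\<Sum>A\<in>card_ge_sets L. real (card \<Theta>) * exp (- (b * (p A + q A))))"
proof -
  note [measurable] = F_sets_M[OF stop_sets[OF b]] F_sets_M[OF hits_sets[OF b order_refl]]
    F_measurable_M[OF measurable_mix_density]
  let ?E = "\<lambda>n A. stop b n \<inter> hits b n A"
  let ?c = "\<lambda>A. ennreal (real (card \<Theta>) * exp (- (b * p A)))"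
  have EF: "?E n A \<in> sets (F n)" for n A using stop_sets[OF b] hits_sets[OF b order_refl] by auto
  have inner: "b * a \<le> \<psi> \<bullet> walk X n \<omega>"
    if "\<omega> \<in> hits b n A" "\<And>x. x \<in> target L A \<Longrightarrow> a \<le> \<psi> \<bullet> x" for a \<psi> n \<omega> A
    using that b by (auto simp: hits_def)
  have weight: "ennreal (inverse (mix_density \<Theta> n \<omega>)) \<le> ?c A"
    if A: "A \<in> card_ge_sets L" and \<omega>: "\<omega> \<in> ?E n A" for n A \<omega>
  proof (rule ennreal_leI)
    have card: "0 < real (card \<Theta>)" using \<Theta> by (simp add: card_gt_0_iff)
    have "b * p A \<le> \<theta> A \<bullet> walk X n \<omega>" using bound(2)[OF A] \<omega> by (intro inner) auto
    also have "\<dots> \<le> llr (\<theta> A) n \<omega>" using bound(1)[OF A] by (intro llr_K) auto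
    finally have "exp (b * p A) \<le> exp (llr (\<theta> A) n \<omega>)" by simp
    also have "\<dots> \<le> (\<Sum>\<theta>\<in>\<Theta>. exp (llr \<theta> n \<omega>))"
      using bound(1)[OF A] \<Theta> by (intro member_le_sum) auto
    finally have "1 / real (card \<Theta>) * exp (b * p A) \<le> mix_density \<Theta> n \<omega>"
      unfolding mix_density_def by (intro mult_left_mono) auto
    then have "inverse (mix_density \<Theta> n \<omega>) \<le> inverse (1 / real (card \<Theta>) * exp (b * p A))"
      using card by (intro le_imp_inverse_le) auto
    then show "inverse (mix_density \<Theta> n \<omega>) \<le> real (card \<Theta>) * exp (- (b * p A))"
      by (simp add: exp_minus divide_inverse)
  qed
  have prob: "(\<Sum>n. emeasure M (?E n A)) \<le> ennreal (exp (- (b * q A)))" if A: "A \<in> card_ge_sets L" for A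
  proof -
    have \<phi>: "\<phi> A \<in> K" "\<phi> A \<in> dom_fun (log_mgf M (X 0))" using bound(1)[OF A] K_subset_dom by auto
    interpret P: prob_space "P (\<phi> A)" by (rule tilted_props(1)[OF \<phi>(2)])
    have "emeasure M (?E n A) \<le> ennreal (exp (- (b * q A))) * emeasure (P (\<phi> A)) (?E n A)" for n
      unfolding emeasure_P_zero[OF EF, symmetric]
    proof (rule tilted_compare[OF zero_dom \<phi>(2) EF])
      fix \<omega> assume \<omega>: "\<omega> \<in> ?E n A"
      have "b * q A \<le> \<phi> A \<bullet> walk X n \<omega>" using bound(2)[OF A] \<omega> by (intro inner) auto
      also have "\<dots> \<le> llr (\<phi> A) n \<omega>" using \<phi>(1) by (rule llr_K)
      finally show "b * q A + llr 0 n \<omega> \<le> llr (\<phi> A) n \<omega>" by (simp add: llr_zero)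
    qed
    then have "(\<Sum>n. emeasure M (?E n A)) \<le> (\<Sum>n. ennreal (exp (- (b * q A))) * emeasure (P (\<phi> A)) (?E n A))"
      by (intro suminf_le) auto
    also have "\<dots> = ennreal (exp (- (b * q A))) * (\<Sum>n. emeasure (P (\<phi> A)) (?E n A))"
      by (rule ennreal_suminf_cmult)
    \<comment> \<open>Disjointness of the slices makes the sum over all times a single probability,
      so no factor for the number of times appears.\<close>
    also have "(\<Sum>n. emeasure (P (\<phi> A)) (?E n A)) = emeasure (P (\<phi> A)) (\<Union>n. ?E n A)"
    proof (rule suminf_emeasure)
      show "range (\<lambda>n. ?E n A) \<subseteq> sets (P (\<phi> A))"
        using EF tilted_props(3)[OF \<phi>(2)] unfolding subalgebra_def by blast
      show "disjoint_family (\<lambda>n. ?E n A)"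
        using disjoint_stop[of b] unfolding disjoint_family_on_def by blast
    qed
    also have "\<dots> \<le> 1" by (rule P.emeasure_le_1)
    finally show ?thesis by (simp add: mult_left_mono)
  qed
  have "(\<integral>\<^sup>+\<omega>. ennreal (inverse (mix_density \<Theta> n \<omega>)) * indicator (stop b n) \<omega> \<partial>M)
      \<le> (\<Sum>A\<in>card_ge_sets L. ?c A * emeasure M (?E n A))" for n
  proof -
    have "(\<integral>\<^sup>+\<omega>. ennreal (inverse (mix_density \<Theta> n \<omega>)) * indicator (stop b n) \<omega> \<partial>M)
        \<le> (\<integral>\<^sup>+\<omega>. (\<Sum>A\<in>card_ge_sets L. ?c A * indicator (?E n A) \<omega>) \<partial>M)"
    proof (intro nn_integral_mono)
      fix \<omega>
      show "ennreal (inverse (mix_density \<Theta> n \<omega>)) * indicator (stop b n) \<omega>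
          \<le> (\<Sum>A\<in>card_ge_sets L. ?c A * indicator (?E n A) \<omega>)"
      proof (cases "\<omega> \<in> stop b n")
        case True
        then obtain A where A: "A \<in> card_ge_sets L" "\<omega> \<in> hits b n A" using stop_subset_hits by blast
        have "ennreal (inverse (mix_density \<Theta> n \<omega>)) * indicator (stop b n) \<omega> \<le> ?c A * indicator (?E n A) \<omega>"
          using weight[OF A(1), of \<omega> n] True A by simp
        also have "\<dots> \<le> (\<Sum>A\<in>card_ge_sets L. ?c A * indicator (?E n A) \<omega>)"
          using A(1) by (intro member_le_sum) auto
        finally show ?thesis .
      qed simp
    qed
    also have "\<dots> = (\<Sum>A\<in>card_ge_sets L. ?c A * emeasure M (?E n A))"
      by (subst nn_integral_sum) (auto simp: nn_integral_cmult)
    finally show ?thesis .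
  qed
  then have "second_moment \<Theta> b \<le> (\<Sum>n. \<Sum>A\<in>card_ge_sets L. ?c A * emeasure M (?E n A))"
    unfolding second_moment_def by (intro suminf_le) auto
  also have "\<dots> = (\<Sum>A\<in>card_ge_sets L. \<Sum>n. ?c A * emeasure M (?E n A))"
    by (rule suminf_sum) auto
  also have "\<dots> = (\<Sum>A\<in>card_ge_sets L. ?c A * (\<Sum>n. emeasure M (?E n A)))"
    by (simp add: ennreal_suminf_cmult)
  also have "\<dots> \<le> (\<Sum>A\<in>card_ge_sets L. ?c A * ennreal (exp (- (b * q A))))"
    by (intro sum_mono mult_left_mono prob) auto
  also have "\<dots> = (\<Sum>A\<in>card_ge_sets L. ennreal (real (card \<Theta>) * exp (- (b * (p A + q A)))))"
    by (intro sum.cong refl) (simp add: ennreal_mult[symmetric] mult_exp_exp mult.assoc algebra_simps)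
  also have "\<dots> = ennreal (\<Sum>A\<in>card_ge_sets L. real (card \<Theta>) * exp (- (b * (p A + q A))))"
    by (rule sum_ennreal) auto
  finally show ?thesis .
qed

end

section \<open>Lower bound for the error probability\<close>

context tilted_walk
begin

text \<open>Chernoff bound by comparing the tilt \<theta> with the tilt moved by \<eta> in direction
  e: the deviation gains \<open>\<eta> * t\<close>, and the log-mgf beyond its linear part costs at
  most C \<eta>^2 per step.\<close>

lemma tilted_deviation:
  assumes \<theta>: "\<theta> \<in> K" "mgf \<theta> = 1"
    and \<eta>: "0 < \<eta>" "norm e = 1" "\<theta> + \<eta> *\<^sub>R e \<in> dom_fun (log_mgf M (X 0))"
      "mgf (\<theta> + \<eta> *\<^sub>R e) \<le> 1 + \<eta> * (e \<bullet> tilted_mean \<theta>) + C * \<eta>\<^sup>2"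
    and n: "n \<le> N"
    and C: "0 \<le> C"
  shows "emeasure (P \<theta>) {\<omega>\<in>space M. t < e \<bullet> walk X n \<omega> - real n * (e \<bullet> tilted_mean \<theta>)}
    \<le> ennreal (exp (real N * C * \<eta>\<^sup>2 - \<eta> * t))"
proof -
  let ?m = "e \<bullet> tilted_mean \<theta>"
  let ?\<phi> = "\<theta> + \<eta> *\<^sub>R e"
  let ?E = "{\<omega>\<in>space M. t < e \<bullet> walk X n \<omega> - real n * ?m}"
  have \<theta>d: "\<theta> \<in> dom_fun (log_mgf M (X 0))" using \<theta> K_subset_dom by auto
  interpret P: prob_space "P ?\<phi>" by (rule tilted_props(1)[OF \<eta>(3)])
  have [measurable]: "walk X n \<in> borel_measurable (F n)" by (rule measurable_walk) simp
  have E: "?E \<in> sets (F n)"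
  proof -
    have "?E = {\<omega>\<in>space (F n). t < e \<bullet> walk X n \<omega> - real n * ?m}" by simp
    also have "\<dots> \<in> sets (F n)" by measurable
    finally show ?thesis .
  qed
  have ln: "ln (mgf ?\<phi>) \<le> \<eta> * ?m + C * \<eta>\<^sup>2"
    using ln_le_minus_one[OF mgf_pos[OF \<eta>(3)]] \<eta>(4) by linarith
  have "emeasure (P \<theta>) ?E \<le> ennreal (exp (- (\<eta> * t - real N * C * \<eta>\<^sup>2))) * emeasure (P ?\<phi>) ?E"
  proof (rule tilted_compare[OF \<theta>d \<eta>(3) E])
    fix \<omega> assume "\<omega> \<in> ?E"
    then have "\<eta> * t \<le> \<eta> * (e \<bullet> walk X n \<omega> - real n * ?m)"
      using \<eta>(1) by (intro mult_left_mono) auto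
    moreover have "real n * ln (mgf ?\<phi>) \<le> real n * (\<eta> * ?m + C * \<eta>\<^sup>2)"
      using ln by (intro mult_left_mono) auto
    moreover have "real n * (C * \<eta>\<^sup>2) \<le> real N * (C * \<eta>\<^sup>2)"
      using n C by (intro mult_right_mono) auto
    ultimately show "\<eta> * t - real N * C * \<eta>\<^sup>2 + llr \<theta> n \<omega> \<le> llr ?\<phi> n \<omega>"
      using \<theta> by (simp add: llr_def log_mgf_eq[OF \<theta>d] log_mgf_eq[OF \<eta>(3)] inner_add_left algebra_simps)
  qed
  also have "\<dots> \<le> ennreal (exp (- (\<eta> * t - real N * C * \<eta>\<^sup>2))) * 1"
    by (intro mult_left_mono P.emeasure_le_1) auto
  finally show ?thesis by (simp add: minus_diff_eq)
qed

definition tube :: "real^'n \<Rightarrow> real \<Rightarrow> nat \<Rightarrow> 'a set" where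
  "tube m t N = {\<omega>\<in>space M. \<forall>n\<le>N. \<forall>k. \<bar>walk X n \<omega> $ k - real n * m $ k\<bar> \<le> t}"

lemma tube_sets: "tube m t N \<in> sets (F N)"
proof -
  have *: "walk X n \<in> borel_measurable (F N)" if "n \<le> N" for n by (rule measurable_walk[OF that])
  have "tube m t N = (\<Inter>n\<in>{..N}. \<Inter>k\<in>UNIV. {\<omega>\<in>space (F N). \<bar>walk X n \<omega> \<bullet> axis k 1 - real n * m $ k\<bar> \<le> t})"
    by (auto simp: tube_def inner_axis)
  also have "\<dots> \<in> sets (F N)"
  proof (intro sets.finite_INT)
    fix n k assume "n \<in> {..N}"
    then have [measurable]: "walk X n \<in> borel_measurable (F N)" using * by simp
    show "{\<omega>\<in>space (F N). \<bar>walk X n \<omega> \<bullet> axis k 1 - real n * m $ k\<bar> \<le> t} \<in> sets (F N)" by measurable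
  qed auto
  finally show ?thesis .
qed

text \<open>Union bound over the times 0, ..., N and the two signs of each unit vector, whence the
  factors \<open>N + 1\<close> and \<open>2 * CARD('n)\<close>.\<close>

lemma tube_prob:
  assumes \<theta>: "\<theta> \<in> K" "mgf \<theta> = 1"
    and \<eta>: "0 < \<eta>" "0 \<le> C" "\<And>h. norm h \<le> \<eta> \<Longrightarrow> \<theta> + h \<in> dom_fun (log_mgf M (X 0))"
      "\<And>h. norm h \<le> \<eta> \<Longrightarrow> mgf (\<theta> + h) \<le> mgf \<theta> + h \<bullet> tilted_mean \<theta> + C * (norm h)\<^sup>2"
  shows "1 - real (N + 1) * (2 * real CARD('n) * exp (real N * C * \<eta>\<^sup>2 - \<eta> * t))
    \<le> measure (P \<theta>) (tube (tilted_mean \<theta>) t N)"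
proof -
  let ?m = "tilted_mean \<theta>"
  let ?x = "exp (real N * C * \<eta>\<^sup>2 - \<eta> * t)"
  let ?dev = "\<lambda>e n. {\<omega>\<in>space M. t < e \<bullet> walk X n \<omega> - real n * (e \<bullet> ?m)}"
  have \<theta>d: "\<theta> \<in> dom_fun (log_mgf M (X 0))" using \<theta> K_subset_dom by auto
  interpret P: prob_space "P \<theta>" by (rule tilted_props(1)[OF \<theta>d])
  have sF: "E \<in> sets (F n) \<Longrightarrow> E \<in> sets (P \<theta>)" for E n
    using tilted_props(3)[OF \<theta>d, of n] by (auto simp: subalgebra_def)
  have spc: "space (P \<theta>) = space M" using tilted_props(3)[OF \<theta>d, of 0] by (simp add: subalgebra_def)
  have dev: "?dev e n \<in> sets (P \<theta>)" "measure (P \<theta>) (?dev e n) \<le> ?x" if e: "norm e = 1" and n: "n \<le> N" for e n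
  proof -
    have [measurable]: "walk X n \<in> borel_measurable (F n)" by (rule measurable_walk) simp
    have "?dev e n = {\<omega>\<in>space (F n). t < e \<bullet> walk X n \<omega> - real n * (e \<bullet> ?m)}" by simp
    also have "\<dots> \<in> sets (F n)" by measurable
    finally show "?dev e n \<in> sets (P \<theta>)" by (rule sF)
    have "emeasure (P \<theta>) (?dev e n) \<le> ennreal ?x"
      using \<eta>(1,2) \<eta>(3,4)[of "\<eta> *\<^sub>R e"] e \<theta> by (intro tilted_deviation[OF \<theta> _ e _ _ n]) auto
    then show "measure (P \<theta>) (?dev e n) \<le> ?x" by (simp add: P.emeasure_eq_measure)
  qed
  let ?D = "\<lambda>n k. ?dev (axis k 1) n \<union> ?dev (- axis k 1) n"
  have dk: "?dev (axis k 1) n \<in> sets (P \<theta>)" "?dev (- axis k 1) n \<in> sets (P \<theta>)" if "n \<le> N" for n k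
    by (intro dev(1) that; simp)+
  then have D: "?D n k \<in> sets (P \<theta>)" if "n \<le> N" for n k
    using that by (intro sets.Un)
  have UD: "(\<Union>k\<in>UNIV. ?D n k) \<in> sets (P \<theta>)" if "n \<le> N" for n
    using D[OF that] by (intro sets.finite_UN) auto
  have "space (P \<theta>) - tube ?m t N \<subseteq> (\<Union>n\<in>{..N}. \<Union>k\<in>UNIV. ?D n k)"
  proof
    fix \<omega> assume "\<omega> \<in> space (P \<theta>) - tube ?m t N"
    then obtain n k where \<omega>: "\<omega> \<in> space M" "n \<le> N" "t < \<bar>walk X n \<omega> $ k - real n * ?m $ k\<bar>"
      by (auto simp: tube_def spc not_le)
    then have "\<omega> \<in> ?D n k" by (auto simp: inner_axis' abs_if split: if_splits)
    then show "\<omega> \<in> (\<Union>n\<in>{..N}. \<Union>k\<in>UNIV. ?D n k)" using \<omega>(2) by blast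
  qed
  then have "measure (P \<theta>) (space (P \<theta>) - tube ?m t N) \<le> measure (P \<theta>) (\<Union>n\<in>{..N}. \<Union>k\<in>UNIV. ?D n k)"
    using UD by (intro P.finite_measure_mono sets.finite_UN[of "{..N}"]) (auto simp only: finite_atMost atMost_iff)
  also have "\<dots> \<le> (\<Sum>n\<in>{..N}. measure (P \<theta>) (\<Union>k\<in>UNIV. ?D n k))"
    by (rule P.finite_measure_subadditive_finite[OF finite_atMost]) (use UD in blast)
  also have "\<dots> \<le> (\<Sum>n\<in>{..N}. 2 * real CARD('n) * ?x)"
  proof (intro sum_mono)
    fix n assume n: "n \<in> {..N}"
    have "measure (P \<theta>) (\<Union>k\<in>UNIV. ?D n k) \<le> (\<Sum>k\<in>(UNIV::'n set). measure (P \<theta>) (?D n k))"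
      by (rule P.finite_measure_subadditive_finite[OF finite_class.finite_UNIV]) (use D n in blast)
    also have "\<dots> \<le> (\<Sum>k\<in>(UNIV::'n set). 2 * ?x)"
    proof (intro sum_mono)
      fix k :: 'n
      have "measure (P \<theta>) (?D n k) \<le> measure (P \<theta>) (?dev (axis k 1) n) + measure (P \<theta>) (?dev (- axis k 1) n)"
        using n by (intro measure_Un_le dk) auto
      then show "measure (P \<theta>) (?D n k) \<le> 2 * ?x"
        using dev(2)[of "axis k 1" n] dev(2)[of "- axis k 1" n] n by auto
    qed
    finally show "measure (P \<theta>) (\<Union>k\<in>UNIV. ?D n k) \<le> 2 * real CARD('n) * ?x" by simp
  qed
  finally have "measure (P \<theta>) (space (P \<theta>) - tube ?m t N) \<le> real (N + 1) * (2 * real CARD('n) * ?x)" by simp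
  moreover have "measure (P \<theta>) (space (P \<theta>) - tube ?m t N) = 1 - measure (P \<theta>) (tube ?m t N)"
    by (rule P.prob_compl[OF sF[OF tube_sets]])
  ultimately show ?thesis by linarith
qed

text \<open>A path that stays close to the ray through \<open>m\<close> hits \<open>b W\<^sup>A\<close> at time \<open>N\<close>; before, it is either
  too close to the origin to meet any target or already positive on all of \<open>A\<close>.\<close>

lemma tube_subset_event:
  assumes A: "A \<in> card_ge_sets L" and b: "0 < b" and \<delta>: "0 < \<delta>"
    and small: "\<And>k. k \<in> A \<Longrightarrow> 2 * (\<Sum>j\<in>UNIV. \<bar>m $ j\<bar>) * \<delta> \<le> m $ k" "real CARD('n) * \<delta> \<le> 1 / 2"
    and ball: "ball (c *\<^sub>R m) \<rho> \<subseteq> target L A" "real CARD('n) * \<delta> + norm (((real N / b) - c) *\<^sub>R m) < \<rho>"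
  shows "tube m (\<delta> * b) N \<subseteq> {\<omega>\<in>space M. tau_star X L b \<omega> < tau_zero X L b \<omega>}"
proof
  fix \<omega> assume \<omega>: "\<omega> \<in> tube m (\<delta> * b) N"
  then have dev: "\<bar>walk X n \<omega> $ k - real n * m $ k\<bar> \<le> \<delta> * b" if "n \<le> N" for n k
    using that by (auto simp: tube_def)
  have "norm (walk X N \<omega> - real N *\<^sub>R m) \<le> (\<Sum>k\<in>UNIV. \<bar>(walk X N \<omega> - real N *\<^sub>R m) $ k\<bar>)"
    by (rule norm_le_l1_cart)
  also have "\<dots> \<le> (\<Sum>k\<in>(UNIV::'n set). \<delta> * b)" using dev[of N] by (intro sum_mono) simp
  finally have "norm (walk X N \<omega> - real N *\<^sub>R m) / b \<le> real CARD('n) * \<delta>"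
    using b by (simp add: field_simps)
  then have "norm ((1 / b) *\<^sub>R (walk X N \<omega> - real N *\<^sub>R m)) \<le> real CARD('n) * \<delta>"
    using b by (simp only: norm_scaleR) simp
  then have "norm ((1 / b) *\<^sub>R (walk X N \<omega> - real N *\<^sub>R m) + ((real N / b) - c) *\<^sub>R m) < \<rho>"
    using ball(2) norm_triangle_ineq[of "(1 / b) *\<^sub>R (walk X N \<omega> - real N *\<^sub>R m)" "((real N / b) - c) *\<^sub>R m"] by linarith
  moreover have "(1 / b) *\<^sub>R walk X N \<omega> - c *\<^sub>R m =
      (1 / b) *\<^sub>R (walk X N \<omega> - real N *\<^sub>R m) + ((real N / b) - c) *\<^sub>R m"
    by (simp add: algebra_simps)
  ultimately have "(1 / b) *\<^sub>R walk X N \<omega> \<in> ball (c *\<^sub>R m) \<rho>"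
    by (simp only: mem_ball dist_norm norm_minus_commute[of "c *\<^sub>R m"])
  then have "(1 / b) *\<^sub>R walk X N \<omega> \<in> target L A" using ball(1) by blast
  then have star: "tau_star X L b \<omega> \<le> enat N"
    unfolding tau_star_le_iff mem_scaled_target_iff[OF b] using A by blast
  have "walk X n \<omega> \<notin> (\<lambda>x. b *\<^sub>R x) ` target L A'" if A': "A' \<notin> card_ge_sets L" and n: "n \<le> N" for A' n
  proof
    assume "walk X n \<omega> \<in> (\<lambda>x. b *\<^sub>R x) ` target L A'"
    then have W: "(1 / b) *\<^sub>R walk X n \<omega> \<in> target L A'" unfolding mem_scaled_target_iff[OF b] .
    define s where "s = (\<Sum>j\<in>UNIV. \<bar>m $ j\<bar>)"
    show False
    \<comment> \<open>Up to this time the drift and the tube width each contribute at most b/2 to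
      the sum of absolute coordinates; afterwards the drift of each coordinate in A exceeds the
      width \<open>\<delta> * b\<close>.\<close>
    proof (cases "real n * s \<le> b / 2")
      case True
      obtain B where B: "card B = L" "B \<subseteq> (UNIV :: 'n set)" using obtain_subset_with_card_n[OF L_le] by blast
      then have "1 < (\<Sum>k\<in>B. \<bar>((1 / b) *\<^sub>R walk X n \<omega>) $ k\<bar>)" using W by (auto simp: target_def card_eq_sets_def)
      also have "\<dots> = (\<Sum>k\<in>B. \<bar>walk X n \<omega> $ k\<bar>) / b" using b by (simp add: abs_mult sum_divide_distrib)
      finally have "b < (\<Sum>k\<in>B. \<bar>walk X n \<omega> $ k\<bar>)" using b by (simp add: field_simps)
      also have "\<dots> \<le> (\<Sum>k\<in>UNIV. \<bar>walk X n \<omega> $ k\<bar>)" by (intro sum_mono2) auto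
      also have "\<dots> \<le> (\<Sum>k\<in>UNIV. real n * \<bar>m $ k\<bar> + \<delta> * b)"
      proof (intro sum_mono)
        fix k
        have "\<bar>walk X n \<omega> $ k\<bar> \<le> \<bar>real n * m $ k\<bar> + \<bar>walk X n \<omega> $ k - real n * m $ k\<bar>" by linarith
        then show "\<bar>walk X n \<omega> $ k\<bar> \<le> real n * \<bar>m $ k\<bar> + \<delta> * b" using dev[OF n, of k] by (simp add: abs_mult)
      qed
      also have "\<dots> = real n * s + (real CARD('n) * \<delta>) * b" by (simp add: sum.distrib sum_distrib_left s_def)
      also have "\<dots> \<le> b / 2 + 1 / 2 * b" using True small(2) b by (intro add_mono mult_right_mono) auto
      finally show False by simp
    next
      case False
      have "A \<subseteq> A'"
      proof
        fix k assume k: "k \<in> A"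
        have s0: "0 \<le> s" by (simp add: s_def sum_nonneg)
        have "\<delta> * b < \<delta> * (2 * (real n * s))" using False \<delta> by (intro mult_strict_left_mono) auto
        also have "\<dots> = real n * (2 * s * \<delta>)" by simp
        also have "\<dots> \<le> real n * m $ k" using small(1)[OF k] unfolding s_def by (intro mult_left_mono) auto
        finally have "0 < walk X n \<omega> $ k" using dev[OF n, of k] by linarith
        then have "0 < ((1 / b) *\<^sub>R walk X n \<omega>) $ k" using b by simp
        then show "k \<in> A'" using W by (force simp: target_def)
      qed
      then have "card A \<le> card A'" by (intro card_mono) auto
      then show False using A A' by (simp add: card_ge_sets_def)
    qed
  qed
  then have "\<not> tau_zero X L b \<omega> \<le> enat N" unfolding tau_zero_le_iff by blast
  then show "\<omega> \<in> {\<omega>\<in>space M. tau_star X L b \<omega> < tau_zero X L b \<omega>}"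
    using star \<omega> by (auto simp: tube_def)
qed

end

section \<open>Comparison of exponents\<close>

text \<open>The ratio is squeezed between (r - \<epsilon>) / (r + \<epsilon>) and 1. The bound 1
  comes from \<open>jensen\<close>; the inequality reverses because both logarithms are
  negative.\<close>

lemma log_ratio_tendsto:
  fixes E p :: "real \<Rightarrow> real"
  assumes r: "0 < r"
    and upper: "\<And>\<epsilon>. 0 < \<epsilon> \<Longrightarrow> \<exists>C>0. \<forall>b>0. E b \<le> C * exp (- (b * (2 * r - \<epsilon>)))"
    and jensen: "\<And>b. 0 < b \<Longrightarrow> (p b)\<^sup>2 \<le> E b"
    and lower: "\<And>\<epsilon>. 0 < \<epsilon> \<Longrightarrow> eventually (\<lambda>b. exp (- (b * (r + \<epsilon>))) \<le> p b) at_top"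
  shows "((\<lambda>b. ln (E b) / (2 * ln (p b))) \<longlongrightarrow> 1) at_top"
proof -
  have bounds: "eventually (\<lambda>b. (r - \<epsilon>) / (r + \<epsilon>) \<le> ln (E b) / (2 * ln (p b)) \<and> ln (E b) / (2 * ln (p b)) \<le> 1) at_top"
    if \<epsilon>: "0 < \<epsilon>" "\<epsilon> < r" for \<epsilon>
  proof -
    obtain C where C: "0 < C" "\<And>b. 0 < b \<Longrightarrow> E b \<le> C * exp (- (b * (2 * r - \<epsilon>)))" using upper[OF \<epsilon>(1)] by blast
    show ?thesis
      \<comment> \<open>Past the last threshold the constant C costs at most a second \<epsilon> in
        the exponent.\<close>
      using lower[OF \<epsilon>(1)] eventually_gt_at_top[of 0] eventually_ge_at_top[of "ln C / \<epsilon>"]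
    proof eventually_elim
      case (elim b)
      have p: "0 < p b" using elim(1) exp_gt_zero[of "- (b * (r + \<epsilon>))"] by linarith
      then have E: "0 < E b" using jensen[OF elim(2)] zero_less_power[OF p, of 2] by linarith
      have "ln (E b) \<le> ln (C * exp (- (b * (2 * r - \<epsilon>))))" using C(2)[OF elim(2)] E C(1) by (subst ln_le_cancel_iff) auto
      also have "\<dots> = ln C - b * (2 * r - \<epsilon>)" using C(1) by (simp add: ln_mult)
      also have "\<dots> \<le> - (b * (2 * r - 2 * \<epsilon>))" using elim(3) \<epsilon>(1) by (simp add: field_simps)
      finally have lE: "ln (E b) \<le> - (b * (2 * r - 2 * \<epsilon>))" .
      have "ln (exp (- (b * (r + \<epsilon>)))) \<le> ln (p b)" using elim(1) p by (subst ln_le_cancel_iff) auto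
      then have lp: "- (b * (r + \<epsilon>)) \<le> ln (p b)" by simp
      have "ln ((p b)\<^sup>2) \<le> ln (E b)" using jensen[OF elim(2)] p E by (subst ln_le_cancel_iff) auto
      then have pE: "2 * ln (p b) \<le> ln (E b)" using p by (simp add: ln_realpow)
      have pos: "0 < b * (2 * r - 2 * \<epsilon>)" using elim(2) \<epsilon>(2) by simp
      then have neg: "2 * ln (p b) < 0" using lE pE by linarith
      have scale: "b * (2 * r - 2 * \<epsilon>) = (2 * b) * (r - \<epsilon>)" "2 * (b * (r + \<epsilon>)) = (2 * b) * (r + \<epsilon>)"
        by (simp_all add: algebra_simps)
      have "(r - \<epsilon>) / (r + \<epsilon>) = (b * (2 * r - 2 * \<epsilon>)) / (2 * (b * (r + \<epsilon>)))"
        unfolding scale using elim(2) by simp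
      also have "\<dots> \<le> (- ln (E b)) / (- (2 * ln (p b)))"
        using lE lp neg pos by (intro frac_le) auto
      finally have "(r - \<epsilon>) / (r + \<epsilon>) \<le> ln (E b) / (2 * ln (p b))" by simp
      moreover have "ln (E b) / (2 * ln (p b)) \<le> 1" using pE neg by (simp add: divide_le_eq)
      ultimately show ?case by simp
    qed
  qed
  show ?thesis
  proof (rule order_tendstoI)
    fix a :: real assume a: "a < 1"
    have "((\<lambda>\<epsilon>. (r - \<epsilon>) / (r + \<epsilon>)) \<longlongrightarrow> (r - 0) / (r + 0)) (at_right 0)"
      using r by (intro tendsto_intros) auto
    then have "eventually (\<lambda>\<epsilon>. a < (r - \<epsilon>) / (r + \<epsilon>)) (at_right 0)"
      by (rule order_tendstoD(1)) (use r a in auto)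
    moreover have "eventually (\<lambda>\<epsilon>. \<epsilon> < r) (at_right 0)" "eventually (\<lambda>\<epsilon>. 0 < \<epsilon>) (at_right (0::real))"
      using eventually_at_right_real[OF r] by (auto elim!: eventually_mono)
    ultimately have "eventually (\<lambda>\<epsilon>. a < (r - \<epsilon>) / (r + \<epsilon>) \<and> 0 < \<epsilon> \<and> \<epsilon> < r) (at_right 0)"
      by eventually_elim simp
    then obtain \<epsilon> where \<epsilon>: "a < (r - \<epsilon>) / (r + \<epsilon>)" "0 < \<epsilon>" "\<epsilon> < r"
      using eventually_happens'[of "at_right (0::real)"] by force
    show "eventually (\<lambda>b. a < ln (E b) / (2 * ln (p b))) at_top"
      using bounds[OF \<epsilon>(2,3)] \<epsilon>(1) by (auto elim!: eventually_mono)
  next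
    fix a :: real assume a: "1 < a"
    show "eventually (\<lambda>b. ln (E b) / (2 * ln (p b)) < a) at_top"
      using bounds[of "r / 2"] r a by (auto elim!: eventually_mono)
  qed
qed

lemma rate_comparison:
  fixes E p :: "real \<Rightarrow> real"
  assumes upper: "\<And>\<epsilon>. 0 < \<epsilon> \<Longrightarrow> \<exists>C>0. \<forall>b>0. E b \<le> C * exp (- (b * (2 * r - \<epsilon>)))"
    and jensen: "\<And>b. 0 < b \<Longrightarrow> (p b)\<^sup>2 \<le> E b"
    and lower: "\<And>\<epsilon>. 0 < \<epsilon> \<Longrightarrow> eventually (\<lambda>b. exp (- (b * (s + \<epsilon>))) \<le> p b) at_top"
  shows "r \<le> s"
proof (rule ccontr)
  assume "\<not> r \<le> s"
  \<comment> \<open>With r = s + 4 \<epsilon> the exponents 2 r - \<epsilon> and 2 (s + \<epsilon>)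
    differ by 5 \<epsilon>, which eventually beats the constant C.\<close>
  define \<epsilon> where "\<epsilon> = (r - s) / 4"
  have "4 * \<epsilon> = r - s" by (simp add: \<epsilon>_def)
  then have \<epsilon>: "0 < \<epsilon>" "r = s + 4 * \<epsilon>" using \<open>\<not> r \<le> s\<close> by linarith+
  obtain C where C: "0 < C" "\<And>b. 0 < b \<Longrightarrow> E b \<le> C * exp (- (b * (2 * r - \<epsilon>)))" using upper[OF \<epsilon>(1)] by blast
  have "eventually (\<lambda>b::real. False) at_top"
    using lower[OF \<epsilon>(1)] eventually_gt_at_top[of 0] eventually_gt_at_top[of "ln C / (5 * \<epsilon>)"]
  proof eventually_elim
    case (elim b)
    have "exp (- (2 * (b * (s + \<epsilon>)))) = (exp (- (b * (s + \<epsilon>))))\<^sup>2" by (simp add: exp_double[symmetric])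
    also have "\<dots> \<le> (p b)\<^sup>2" using elim(1) by (intro power_mono) auto
    also have "\<dots> \<le> C * exp (- (b * (2 * r - \<epsilon>)))" using jensen[OF elim(2)] C(2)[OF elim(2)] by linarith
    also have "\<dots> = exp (ln C - b * (2 * r - \<epsilon>))" using C(1) by (simp add: exp_diff exp_minus divide_inverse)
    finally have "- (2 * (b * (s + \<epsilon>))) \<le> ln C - b * (2 * r - \<epsilon>)" by simp
    then have "b * (5 * \<epsilon>) \<le> ln C" unfolding \<epsilon>(2) by (simp add: algebra_simps)
    then show ?case using elim(3) \<epsilon>(1) by (simp add: field_simps)
  qed
  then show False by simp
qed

context tilted_walk
begin

text \<open>Under a near-optimal tilt the tube has probability at least 1/2, and on it the
  likelihood ratio is at most \<open>exp x\<close>; changing back to M then loses only this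
  factor.\<close>

lemma error_prob_lower:
  assumes A: "A \<in> card_ge_sets L" and r: "r_val (log_mgf M (X 0)) L A = ereal r" "0 < r" and \<epsilon>: "0 < \<epsilon>"
  shows "eventually (\<lambda>b. exp (- (b * (r + \<epsilon>))) \<le> error_prob b) at_top"
proof -
  \<comment> \<open>Two of the four parts of \<epsilon> are spent in x below; the other two absorb
    the constants \<open>\<bar>\<theta> \<bullet> m\<bar>\<close> and \<open>ln 2\<close>.\<close>
  define e where "e = \<epsilon> / 4"
  have e: "0 < e" using \<epsilon> by (simp add: e_def)
  obtain \<theta> c where \<theta>: "\<theta> \<in> K" "mgf \<theta> = 1" and c: "0 < c" "c *\<^sub>R tilted_mean \<theta> \<in> target L A"
    "\<theta> \<bullet> (c *\<^sub>R tilted_mean \<theta>) \<le> r + e"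
    using optimal_tilt[OF A r e] by blast
  define m where "m = tilted_mean \<theta>"
  define d where "d = real CARD('n)"
  have d: "0 < d" by (simp add: d_def)
  have \<theta>d: "\<theta> \<in> dom_fun (log_mgf M (X 0))" using \<theta> K_subset_dom by auto
  interpret P: prob_space "P \<theta>" by (rule tilted_props(1)[OF \<theta>d])
  obtain \<rho> where \<rho>: "0 < \<rho>" "ball (c *\<^sub>R m) \<rho> \<subseteq> target L A"
    using c(2) open_target[of L A] open_contains_ball unfolding m_def by blast
  obtain \<eta>0 C where q: "0 < \<eta>0" "0 \<le> C"
    "\<And>h. norm h \<le> \<eta>0 \<Longrightarrow> \<theta> + h \<in> dom_fun (log_mgf M (X 0))"
    "\<And>h. norm h \<le> \<eta>0 \<Longrightarrow> mgf (\<theta> + h) \<le> mgf \<theta> + h \<bullet> tilted_mean \<theta> + C * (norm h)\<^sup>2"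
    using mgf_quadratic_bound[OF \<theta>d] by blast
  define s where "s = (\<Sum>j\<in>UNIV. \<bar>m $ j\<bar>)"
  have mk: "0 < m $ k" if "k \<in> A" for k
    using c(1,2) that by (auto simp: target_def m_def zero_less_mult_iff)
  have small: "eventually (\<lambda>\<delta>. a * \<delta> < x) (at_right 0)" if "0 < x" for a x :: real
  proof -
    have "((\<lambda>\<delta>. a * \<delta>) \<longlongrightarrow> a * 0) (at_right 0)" by (intro tendsto_intros)
    then show ?thesis by (rule order_tendstoD(2)) (use that in simp)
  qed
  \<comment> \<open>Requirements on the tube width: two are hypotheses of
    \<open>tube_subset_event\<close>, one leaves half of \<rho> for rounding the time, and one keeps
    the fluctuation of \<open>\<theta> \<bullet> walk\<close> below \<open>e * b\<close>.\<close>
  have "eventually (\<lambda>\<delta>. \<forall>k\<in>A. 2 * s * \<delta> < m $ k) (at_right 0)"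
    using mk small by (intro eventually_ball_finite) auto
  moreover have "eventually (\<lambda>\<delta>. d * \<delta> < 1 / 2) (at_right 0)" "eventually (\<lambda>\<delta>. d * \<delta> < \<rho> / 2) (at_right 0)"
    "eventually (\<lambda>\<delta>. (norm \<theta> * d) * \<delta> < e) (at_right 0)"
    using \<rho>(1) e by (intro small; simp)+
  moreover have "eventually (\<lambda>\<delta>. 0 < \<delta>) (at_right (0::real))" by (simp add: eventually_at_right_less)
  ultimately have "eventually (\<lambda>\<delta>. (\<forall>k\<in>A. 2 * s * \<delta> < m $ k) \<and> d * \<delta> < 1 / 2 \<and> d * \<delta> < \<rho> / 2 \<and>
      (norm \<theta> * d) * \<delta> < e \<and> 0 < \<delta>) (at_right 0)"
    by eventually_elim simp
  then obtain \<delta> where \<delta>: "\<And>k. k \<in> A \<Longrightarrow> 2 * s * \<delta> < m $ k" "d * \<delta> < 1 / 2" "d * \<delta> < \<rho> / 2"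
      "(norm \<theta> * d) * \<delta> < e" "0 < \<delta>"
    using eventually_happens'[of "at_right (0::real)"] by force
  \<comment> \<open>Chosen so that over about c b steps the quadratic cost takes at most half of the
    gain \<eta> \<delta> b.\<close>
  define \<eta> where "\<eta> = min \<eta>0 (\<delta> / (2 * c * (C + 1)))"
  have den: "0 < 2 * c * (C + 1)" using c(1) q(2) by simp
  have \<eta>: "0 < \<eta>" "\<eta> \<le> \<eta>0" using q(1) \<delta>(5) den by (auto simp: \<eta>_def)
  have "\<eta> * (2 * c * (C + 1)) \<le> \<delta>" using den by (subst pos_le_divide_eq[symmetric]) (auto simp: \<eta>_def)
  then have c\<eta>: "c * C * \<eta> \<le> \<delta> / 2"
    using mult_pos_pos[OF c(1) \<eta>(1)] by (simp add: algebra_simps)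
  \<comment> \<open>The integer time by which the drift has carried the walk to about
    \<open>b *\<^sub>R (c *\<^sub>R m)\<close>.\<close>
  define N where "N b = nat \<lceil>c * b\<rceil>" for b
  have N: "c * b \<le> real (N b)" "real (N b) \<le> c * b + 1" if "0 < b" for b
    using c(1) that mult_pos_pos[OF c(1) that] unfolding N_def by linarith+
  \<comment> \<open>The failure bound of \<open>tube_prob\<close>: c b + 2 dominates N + 1, rounding
    up costs exp (C \<eta>^2), and half of the exponent remains to beat the linear factor.\<close>
  have "((\<lambda>b. (c * b + 2) * (2 * d * (exp (C * \<eta>\<^sup>2) * exp (- (\<eta> * \<delta> / 2) * b)))) \<longlongrightarrow> 0) at_top"
  proof -
    define g where "g = \<eta> * \<delta> / 2"
    have "0 < g" using \<eta>(1) \<delta>(5) by (simp add: g_def)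
    define h where "h = 2 * d * exp (C * \<eta>\<^sup>2)"
    have pow: "((\<lambda>b. (g * b) ^ k / exp (g * b)) \<longlongrightarrow> 0) at_top" for k
      by (rule filterlim_compose[OF tendsto_power_div_exp_0])
        (intro filterlim_tendsto_pos_mult_at_top[OF tendsto_const \<open>0 < g\<close>] filterlim_ident)
    have "((\<lambda>b. h * (c / g * ((g * b) ^ 1 / exp (g * b)) + 2 * ((g * b) ^ 0 / exp (g * b))))
        \<longlongrightarrow> h * (c / g * 0 + 2 * 0)) at_top"
      by (intro tendsto_mult_left tendsto_add pow)
    moreover have "h * (c / g * ((g * b) ^ 1 / exp (g * b)) + 2 * ((g * b) ^ 0 / exp (g * b))) =
        (c * b + 2) * (2 * d * (exp (C * \<eta>\<^sup>2) * exp (- (\<eta> * \<delta> / 2) * b)))" for b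
    proof -
      define y where "y = exp (- (\<eta> * \<delta> / 2) * b)"
      have arg: "- (\<eta> * \<delta> / 2) * b = - (g * b)" by (simp add: g_def)
      have y: "u / exp (g * b) = u * y" for u
        unfolding y_def arg exp_minus by (rule divide_inverse)
      have "c / g * (g * b * y) = c * b * y" using \<open>0 < g\<close> by simp
      moreover have "h * (c / g * ((g * b) ^ 1 / exp (g * b)) + 2 * ((g * b) ^ 0 / exp (g * b))) =
          h * (c / g * (g * b * y) + 2 * y)"
        unfolding y by simp
      ultimately show ?thesis unfolding y_def[symmetric] by (simp add: h_def distrib_left distrib_right)
    qed
    ultimately show ?thesis by simp
  qed
  then have "eventually (\<lambda>b. (c * b + 2) * (2 * d * (exp (C * \<eta>\<^sup>2) * exp (- (\<eta> * \<delta> / 2) * b))) < 1 / 2) at_top"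
    by (rule order_tendstoD(2)) simp
  \<comment> \<open>The second threshold makes the rounding error of N / b harmless in the ball of
    radius \<rho>; the last one pays for the constants in x.\<close>
  then show ?thesis
    using eventually_gt_at_top[of 0] eventually_gt_at_top[of "2 * norm m / \<rho>"]
      eventually_ge_at_top[of "(\<bar>\<theta> \<bullet> m\<bar> + ln 2) / (2 * e)"]
  proof eventually_elim
    case (elim b)
    note b = elim(2)
    let ?T = "tube m (\<delta> * b) (N b)"
    have "exp (real (N b) * C * \<eta>\<^sup>2 - \<eta> * (\<delta> * b)) \<le> exp (C * \<eta>\<^sup>2 + (- (\<eta> * \<delta> / 2) * b))"
    proof -
      have "real (N b) * (C * \<eta>\<^sup>2) \<le> (c * b + 1) * (C * \<eta>\<^sup>2)"
        using N(2)[OF b] q(2) by (intro mult_right_mono) auto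
      moreover have "(b * \<eta>) * (c * C * \<eta>) \<le> (b * \<eta>) * (\<delta> / 2)"
        using b \<eta>(1) by (intro mult_left_mono c\<eta>) auto
      ultimately show ?thesis by (simp add: algebra_simps power2_eq_square)
    qed
    then have "real (N b + 1) * (2 * d * exp (real (N b) * C * \<eta>\<^sup>2 - \<eta> * (\<delta> * b)))
        \<le> (c * b + 2) * (2 * d * (exp (C * \<eta>\<^sup>2) * exp (- (\<eta> * \<delta> / 2) * b)))"
      using N(2)[OF b] d by (intro mult_mono mult_left_mono) (auto simp: exp_add[symmetric])
    also have "\<dots> < 1 / 2" by (rule elim(1))
    finally have half: "1 / 2 \<le> measure (P \<theta>) ?T"
      using tube_prob[OF \<theta> \<eta>(1) q(2), where t = "\<delta> * b" and N = "N b"] q(3,4) \<eta>(2) unfolding m_def d_def by force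
    have "?T \<subseteq> {\<omega>\<in>space M. tau_star X L b \<omega> < tau_zero X L b \<omega>}"
    proof (rule tube_subset_event[OF A b \<delta>(5) _ _ \<rho>(2)])
      show "2 * (\<Sum>j\<in>UNIV. \<bar>m $ j\<bar>) * \<delta> \<le> m $ k" if "k \<in> A" for k
        using \<delta>(1)[OF that] by (simp add: s_def)
      show "real CARD('n) * \<delta> \<le> 1 / 2" using \<delta>(2) by (simp add: d_def)
      have "real (N b) / b - c = (real (N b) - c * b) / b" using b by (simp add: field_simps)
      moreover have "\<bar>real (N b) - c * b\<bar> \<le> 1" using N[OF b] by linarith
      ultimately have "\<bar>real (N b) / b - c\<bar> \<le> 1 / b" using b by (simp add: abs_divide divide_right_mono)
      then have "norm ((real (N b) / b - c) *\<^sub>R m) \<le> 1 / b * norm m"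
        unfolding norm_scaleR by (rule mult_right_mono) simp
      also have "\<dots> < \<rho> / 2" using elim(3) b \<rho>(1) by (simp add: field_simps)
      finally show "real CARD('n) * \<delta> + norm ((real (N b) / b - c) *\<^sub>R m) < \<rho>"
        using \<delta>(3) by (simp add: d_def)
    qed
    moreover have "{\<omega>\<in>space M. tau_star X L b \<omega> < tau_zero X L b \<omega>} \<in> sets M"
      unfolding UN_stop[symmetric] using F_sets_M[OF stop_sets[OF b]] by auto
    ultimately have sub: "measure M ?T \<le> error_prob b"
      unfolding error_prob_def by (rule finite_measure_mono)
    \<comment> \<open>One e stems from the near-optimal tilt, one from the tube width, and the
      absolute value from rounding the time up to N.\<close>
    define x where "x = b * (r + 2 * e) + \<bar>\<theta> \<bullet> m\<bar>"
    have "emeasure (P \<theta>) ?T \<le> ennreal (exp (- (- x))) * emeasure (P 0) ?T"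
    proof (rule tilted_compare[OF \<theta>d zero_dom tube_sets])
      fix \<omega> assume \<omega>: "\<omega> \<in> ?T"
      let ?S = "walk X (N b) \<omega>"
      have "norm (?S - real (N b) *\<^sub>R m) \<le> (\<Sum>k\<in>UNIV. \<bar>(?S - real (N b) *\<^sub>R m) $ k\<bar>)"
        by (rule norm_le_l1_cart)
      also have "\<dots> \<le> (\<Sum>k\<in>(UNIV::'n set). \<delta> * b)" using \<omega> by (intro sum_mono) (simp add: tube_def)
      finally have dev: "norm (?S - real (N b) *\<^sub>R m) \<le> d * \<delta> * b" by (simp add: d_def)
      have "\<theta> \<bullet> ?S = real (N b) * (\<theta> \<bullet> m) + \<theta> \<bullet> (?S - real (N b) *\<^sub>R m)" by (simp add: inner_diff_right)
      moreover have "\<theta> \<bullet> (?S - real (N b) *\<^sub>R m) \<le> norm \<theta> * norm (?S - real (N b) *\<^sub>R m)"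
        by (rule norm_cauchy_schwarz)
      moreover have "norm \<theta> * norm (?S - real (N b) *\<^sub>R m) \<le> norm \<theta> * (d * \<delta> * b)"
        using dev by (intro mult_left_mono) auto
      moreover have "(norm \<theta> * d * \<delta>) * b \<le> e * b" using \<delta>(4) b by (intro mult_right_mono) auto
      moreover have "real (N b) * (\<theta> \<bullet> m) = b * (\<theta> \<bullet> (c *\<^sub>R m)) + (real (N b) - c * b) * (\<theta> \<bullet> m)"
        by (simp add: algebra_simps)
      moreover have "b * (\<theta> \<bullet> (c *\<^sub>R m)) \<le> b * (r + e)"
        using c(3) b unfolding m_def by (intro mult_left_mono) auto
      moreover have "(real (N b) - c * b) * (\<theta> \<bullet> m) \<le> (real (N b) - c * b) * \<bar>\<theta> \<bullet> m\<bar>"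
        using N[OF b] by (intro mult_left_mono) auto
      moreover have "(real (N b) - c * b) * \<bar>\<theta> \<bullet> m\<bar> \<le> 1 * \<bar>\<theta> \<bullet> m\<bar>"
        using N[OF b] by (intro mult_right_mono) auto
      ultimately have "\<theta> \<bullet> ?S \<le> x" by (simp add: x_def algebra_simps)
      then show "- x + llr \<theta> (N b) \<omega> \<le> llr 0 (N b) \<omega>"
        unfolding llr_zero using \<theta> by (simp add: llr_def log_mgf_eq[OF \<theta>d])
    qed
    then have "measure (P \<theta>) ?T \<le> exp x * measure M ?T"
      by (simp add: emeasure_P_zero[OF tube_sets] P.emeasure_eq_measure emeasure_eq_measure ennreal_mult[symmetric])
    moreover have "exp x * measure M ?T \<le> exp x * error_prob b" by (intro mult_left_mono sub) simp
    ultimately have "1 / 2 \<le> exp x * error_prob b" using half by linarith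
    then have "exp (- x) * (1 / 2) \<le> exp (- x) * (exp x * error_prob b)" by (intro mult_left_mono) auto
    also have "\<dots> = error_prob b" by (simp add: mult.assoc[symmetric] mult_exp_exp)
    finally have "exp (- x) * (1 / 2) \<le> error_prob b" .
    moreover have "exp (- (b * (r + \<epsilon>))) \<le> exp (- x) * (1 / 2)"
    proof -
      have "\<bar>\<theta> \<bullet> m\<bar> + ln 2 \<le> b * (2 * e)" using elim(4) e by (simp add: field_simps)
      then have "- (b * (r + \<epsilon>)) \<le> - x - ln 2" unfolding x_def e_def by (simp add: algebra_simps)
      then have "exp (- (b * (r + \<epsilon>))) \<le> exp (- x - ln 2)" by simp
      then show ?thesis by (simp add: exp_diff)
    qed
    ultimately show ?case by linarith
  qed
qed

end

section \<open>Efficiency of the sum-intersection mixture\<close>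

locale si_rule = tilted_walk M X L P
  for M :: "'a measure" and X :: "nat \<Rightarrow> 'a \<Rightarrow> real^'n::finite" and L and P +
  assumes condition: "(MIN A\<in>card_eq_sets L. 2 * r_val (log_mgf M (X 0)) L A) \<le>
    (MIN A\<in>card_eq_sets L. MIN k\<in>-A. z_val (log_mgf M (X 0)) L A + s_val (log_mgf M (X 0)) L (insert k A))"
begin

abbreviation "\<Lambda> \<equiv> log_mgf M (X 0)"

lemma card_eq_ge: "A \<in> card_eq_sets L \<Longrightarrow> A \<in> card_ge_sets L"
  by (simp add: card_eq_sets_def card_ge_sets_def)

lemma card_eq_sets_nonempty: "card_eq_sets L \<noteq> ({} :: 'n set set)"
  using obtain_subset_with_card_n[OF L_le] by (auto simp: card_eq_sets_def)

lemma min_r_val_real: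
  obtains r where "(MIN A\<in>card_eq_sets L. r_val \<Lambda> L A) = ereal r" "0 < r"
proof -
  have "(MIN A\<in>card_eq_sets L. r_val \<Lambda> L A) \<in> r_val \<Lambda> L ` card_eq_sets L"
    using card_eq_sets_nonempty by (intro Min_in) auto
  then obtain A where "A \<in> card_eq_sets L" "(MIN A\<in>card_eq_sets L. r_val \<Lambda> L A) = r_val \<Lambda> L A" by auto
  then show thesis using r_val_real[OF card_eq_ge] that by metis
qed

text \<open>The assumption comparing z + s with 2 r is used here, for targets with more than L
  positive coordinates. Only \<theta> is required to lie in \<open>Theta_SI\<close>.\<close>

lemma supporting_pair:
  assumes r: "(MIN A\<in>card_eq_sets L. r_val \<Lambda> L A) = ereal r" and A: "A \<in> card_ge_sets L" and \<epsilon>: "0 < \<epsilon>"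
  shows "\<exists>\<theta> \<phi> p q. \<theta> \<in> Theta_SI \<Lambda> L \<and> \<theta> \<in> K \<and> \<phi> \<in> K \<and>
    (\<forall>x\<in>target L A. p \<le> \<theta> \<bullet> x \<and> q \<le> \<phi> \<bullet> x) \<and> 2 * r - \<epsilon> \<le> p + q"
proof -
  have r_le: "ereal r \<le> r_val \<Lambda> L A" if "A \<in> card_eq_sets L" for A
    unfolding r[symmetric] using that by (intro Min_le) auto
  show ?thesis
  proof (cases "card A = L")
    case True
    then have A': "A \<in> card_eq_sets L" by (simp add: card_eq_sets_def)
    obtain ra where ra: "r_val \<Lambda> L A = ereal ra" "0 < ra" using r_val_real[OF A] by blast
    have "r \<le> ra" using r_le[OF A'] ra by simp
    moreover have "beta \<Lambda> L A \<in> Theta_SI \<Lambda> L" using A' by (simp add: Theta_SI_def)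
    moreover note beta_supporting[OF A ra]
    ultimately have "beta \<Lambda> L A \<in> Theta_SI \<Lambda> L \<and> beta \<Lambda> L A \<in> K \<and> beta \<Lambda> L A \<in> K \<and>
      (\<forall>x\<in>target L A. ra \<le> beta \<Lambda> L A \<bullet> x \<and> ra \<le> beta \<Lambda> L A \<bullet> x) \<and> 2 * r - \<epsilon> \<le> ra + ra"
      using \<epsilon> by auto
    then show ?thesis by blast
  next
    case False
    then have cA: "L < card A" using A by (simp add: card_ge_sets_def)
    \<comment> \<open>Any L-subset and any further element of A will do, since the assumption covers
      all such pairs.\<close>
    then obtain A' where A': "A' \<subseteq> A" "card A' = L" using obtain_subset_with_card_n[of L A] by auto
    then obtain k where k: "k \<in> A" "k \<notin> A'" using cA by (metis less_irrefl subsetI subset_antisym)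
    let ?B = "insert k A'"
    have A'e: "A' \<in> card_eq_sets L" using A' by (simp add: card_eq_sets_def)
    have B: "card ?B = L + 1" "?B \<subseteq> A" using A' k by auto
    obtain z where z: "z_val \<Lambda> L A' = ereal z" "gamma_opt \<Lambda> L A' \<in> K"
      "\<And>B x. A' \<subseteq> B \<Longrightarrow> x \<in> target L B \<Longrightarrow> z \<le> gamma_opt \<Lambda> L A' \<bullet> x"
      using gamma_supporting[OF A'e] by blast
    have "ereal (2 * r) \<le> (MIN A\<in>card_eq_sets L. 2 * r_val \<Lambda> L A)"
    proof (subst Min_ge_iff)
      show "\<forall>a\<in>(\<lambda>A. 2 * r_val \<Lambda> L A) ` card_eq_sets L. ereal (2 * r) \<le> a"
      proof
        fix a assume "a \<in> (\<lambda>A. 2 * r_val \<Lambda> L A) ` card_eq_sets L"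
        then obtain A where A: "A \<in> card_eq_sets L" "a = 2 * r_val \<Lambda> L A" by auto
        obtain ra where ra: "r_val \<Lambda> L A = ereal ra" using r_val_real[OF card_eq_ge[OF A(1)]] by blast
        have "2 * ereal ra = ereal (2 * ra)" by (simp only: numeral_eq_ereal times_ereal.simps(1))
        then show "ereal (2 * r) \<le> a" using r_le[OF A(1)] by (simp add: A(2) ra)
      qed
    qed (use card_eq_sets_nonempty in auto)
    also note condition
    also have "(MIN A\<in>card_eq_sets L. MIN k\<in>-A. z_val \<Lambda> L A + s_val \<Lambda> L (insert k A))
        \<le> (MIN k\<in>-A'. z_val \<Lambda> L A' + s_val \<Lambda> L (insert k A'))"
      using A'e by (intro Min_le) auto
    also have "\<dots> \<le> z_val \<Lambda> L A' + s_val \<Lambda> L ?B" using k by (intro Min_le) auto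
    finally have "ereal (2 * r) \<le> ereal z + s_val \<Lambda> L ?B" by (simp add: z)
    \<comment> \<open>Subtracting \<epsilon> gives the strict inequality that
      \<open>s_val_supporting\<close> requires.\<close>
    then have "ereal (2 * r - \<epsilon> - z) < s_val \<Lambda> L ?B"
      using \<epsilon> by (cases "s_val \<Lambda> L ?B") auto
    then obtain \<phi> where \<phi>: "\<phi> \<in> K" "\<And>A x. ?B \<subseteq> A \<Longrightarrow> x \<in> target L A \<Longrightarrow> 2 * r - \<epsilon> - z \<le> \<phi> \<bullet> x"
      using s_val_supporting[OF B(1)] by blast
    have "gamma_opt \<Lambda> L A' \<in> Theta_SI \<Lambda> L" using A'e by (simp add: Theta_SI_def)
    then have "gamma_opt \<Lambda> L A' \<in> Theta_SI \<Lambda> L \<and> gamma_opt \<Lambda> L A' \<in> K \<and> \<phi> \<in> K \<and>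
      (\<forall>x\<in>target L A. z \<le> gamma_opt \<Lambda> L A' \<bullet> x \<and> 2 * r - \<epsilon> - z \<le> \<phi> \<bullet> x) \<and> 2 * r - \<epsilon> \<le> z + (2 * r - \<epsilon> - z)"
      using z(2,3) \<phi> A'(1) B(2) by auto
    then show ?thesis by blast
  qed
qed

lemma Theta_SI_subset_dom: "Theta_SI \<Lambda> L \<subseteq> dom_fun \<Lambda>"
proof -
  have "beta \<Lambda> L A \<in> K" "gamma_opt \<Lambda> L A \<in> K" if "A \<in> card_eq_sets L" for A
    using beta_supporting(1)[OF card_eq_ge[OF that]] r_val_real[OF card_eq_ge[OF that]]
      gamma_supporting[OF that] by metis+
  then show ?thesis using K_subset_dom by (auto simp: Theta_SI_def)
qed

lemma Theta_SI_finite: "finite (Theta_SI \<Lambda> L)" "Theta_SI \<Lambda> L \<noteq> {}"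
  using card_eq_sets_nonempty by (auto simp: Theta_SI_def)

lemma second_moment_exponential_bound:
  assumes r: "(MIN A\<in>card_eq_sets L. r_val \<Lambda> L A) = ereal r" and \<epsilon>: "0 < \<epsilon>"
  shows "\<exists>C>0. \<forall>b>0. second_moment (Theta_SI \<Lambda> L) b \<le> ennreal (C * exp (- (b * (2 * r - \<epsilon>))))"
proof -
  let ?c = "real (card (Theta_SI \<Lambda> L))"
  have c: "0 < ?c" using Theta_SI_finite by (simp add: card_gt_0_iff)
  obtain \<theta> \<phi> p q where
    *: "\<And>A. A \<in> card_ge_sets L \<Longrightarrow> \<theta> A \<in> Theta_SI \<Lambda> L \<and> \<theta> A \<in> K \<and> \<phi> A \<in> K \<and>
      (\<forall>x\<in>target L A. p A \<le> \<theta> A \<bullet> x \<and> q A \<le> \<phi> A \<bullet> x) \<and> 2 * r - \<epsilon> \<le> p A + q A"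
    using supporting_pair[OF r _ \<epsilon>] by metis
  define C where "C = (\<Sum>A\<in>(card_ge_sets L :: 'n set set). ?c)"
  have "second_moment (Theta_SI \<Lambda> L) b \<le> ennreal (C * exp (- (b * (2 * r - \<epsilon>))))" if b: "0 < b" for b
  proof -
    have "second_moment (Theta_SI \<Lambda> L) b \<le> ennreal (\<Sum>A\<in>card_ge_sets L. ?c * exp (- (b * (p A + q A))))"
      using * by (intro second_moment_le[OF b Theta_SI_finite, of \<theta> \<phi>]) blast+
    also have "\<dots> \<le> ennreal (\<Sum>A\<in>(card_ge_sets L :: 'n set set). ?c * exp (- (b * (2 * r - \<epsilon>))))"
      using * b by (intro ennreal_leI sum_mono mult_left_mono) (auto intro!: mult_left_mono)
    also have "\<dots> = ennreal (C * exp (- (b * (2 * r - \<epsilon>))))" by (simp add: C_def)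
    finally show ?thesis .
  qed
  moreover have "0 < C" unfolding C_def using c card_ge_sets_nonempty by (intro sum_pos) auto
  ultimately show ?thesis by blast
qed

lemma si_rule_efficient:
  "(MIN A\<in>card_ge_sets L. r_val \<Lambda> L A) = (MIN A\<in>card_eq_sets L. r_val \<Lambda> L A)"
  "asymp_efficient M X L P (Theta_SI \<Lambda> L)"
proof -
  obtain r where r: "(MIN A\<in>card_eq_sets L. r_val \<Lambda> L A) = ereal r" "0 < r" using min_r_val_real by blast
  define E where "E b = enn2real (second_moment (Theta_SI \<Lambda> L) b)" for b
  note bound = second_moment_exponential_bound[OF r(1)]
  have upper: "\<exists>C>0. \<forall>b>0. E b \<le> C * exp (- (b * (2 * r - \<epsilon>)))" if \<epsilon>: "0 < \<epsilon>" for \<epsilon>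
  proof -
    obtain C where C: "0 < C" "\<And>b. 0 < b \<Longrightarrow> second_moment (Theta_SI \<Lambda> L) b \<le> ennreal (C * exp (- (b * (2 * r - \<epsilon>))))"
      using bound[OF \<epsilon>] by blast
    then have "\<forall>b>0. E b \<le> C * exp (- (b * (2 * r - \<epsilon>)))"
      unfolding E_def by (auto intro!: enn2real_leI)
    then show ?thesis using C(1) by blast
  qed
  \<comment> \<open>Any \<epsilon> would do; this excludes that \<open>enn2real\<close> returns its
    default 0 in E.\<close>
  have fin: "second_moment (Theta_SI \<Lambda> L) b < \<infinity>" if "0 < b" for b
    using bound[of 1] that by (auto intro: le_less_trans)
  have jensen: "(error_prob b)\<^sup>2 \<le> E b" if "0 < b" for b
    unfolding E_def by (rule error_prob_sq_le[OF that Theta_SI_finite Theta_SI_subset_dom fin[OF that]])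
  have r_le: "ereal r \<le> r_val \<Lambda> L A" if A: "A \<in> card_ge_sets L" for A
  proof -
    obtain ra where ra: "r_val \<Lambda> L A = ereal ra" "0 < ra" using r_val_real[OF A] by blast
    have "r \<le> ra" by (rule rate_comparison[OF upper jensen error_prob_lower[OF A ra]])
    then show ?thesis by (simp add: ra)
  qed
  \<comment> \<open>A minimizing L-set supplies a lower bound on the probability at the same rate r
    as the upper bound.\<close>
  have "(MIN A\<in>card_eq_sets L. r_val \<Lambda> L A) \<in> r_val \<Lambda> L ` card_eq_sets L"
    using card_eq_sets_nonempty by (intro Min_in) auto
  then obtain A0 where A0: "A0 \<in> card_eq_sets L" "r_val \<Lambda> L A0 = ereal r" using r(1) by auto
  show "(MIN A\<in>card_ge_sets L. r_val \<Lambda> L A) = (MIN A\<in>card_eq_sets L. r_val \<Lambda> L A)"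
    unfolding r(1) using A0 card_eq_ge[OF A0(1)] r_le by (intro Min_eqI) (auto intro: rev_image_eqI)
  have lim: "((\<lambda>b. ln (E b) / (2 * ln (error_prob b))) \<longlongrightarrow> 1) at_top"
    by (rule log_ratio_tendsto[OF r(2) upper jensen error_prob_lower[OF card_eq_ge[OF A0(1)] A0(2) r(2)]])
  show "asymp_efficient M X L P (Theta_SI \<Lambda> L)"
    unfolding asymp_efficient_def error_prob_def[symmetric]
  proof (rule Lim_transform_eventually[OF lim])
    show "eventually (\<lambda>b. ln (E b) / (2 * ln (error_prob b)) =
      ln (\<integral>\<omega>. (IS_estimator M X L b (Theta_SI \<Lambda> L) \<omega>)\<^sup>2 \<partial>mix (Theta_SI \<Lambda> L)) / (2 * ln (error_prob b))) at_top"
      using eventually_gt_at_top[of 0]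
      by eventually_elim (simp add: E_def integral_IS_estimator_sq[OF _ Theta_SI_finite Theta_SI_subset_dom])
  qed
qed

end

theorem theorem6p2:
  fixes M :: "'a measure"
    and X :: "nat \<Rightarrow> 'a \<Rightarrow> real^'n::finite"
    and P :: "real^'n \<Rightarrow> 'a measure"
    and L :: nat
    and \<Lambda> :: "real^'n \<Rightarrow> ereal"
  defines "\<Lambda> \<equiv> log_mgf M (X 0)"
  assumes "prob_space M"
    and "prob_space.indep_vars M (\<lambda>_. borel) X UNIV"
    and "\<And>i. distr M borel (X i) = distr M borel (X 0)"
    and "\<And>k. (\<integral>\<omega>. X 0 \<omega> $ k \<partial>M) < 0"
    and "2 \<le> L" and "L \<le> CARD('n) - 1"
    and "open (dom_fun \<Lambda>)"
    and "\<And>A. A \<in> card_ge_sets L \<Longrightarrow>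
           interior (pos_cone (dom_fun (conj_fun \<Lambda>))) \<inter> target L A \<noteq> {}"
    and "\<And>\<theta>. \<theta> \<in> dom_fun \<Lambda> \<Longrightarrow> exp_tilted M X \<theta> (P \<theta>)"
    and "(MIN A\<in>card_eq_sets L. MIN k\<in>-A. z_val \<Lambda> L A + s_val \<Lambda> L (insert k A))
           \<ge> (MIN A\<in>card_eq_sets L. 2 * r_val \<Lambda> L A)"
  shows "(MIN A\<in>card_ge_sets L. r_val \<Lambda> L A) = (MIN A\<in>card_eq_sets L. r_val \<Lambda> L A)
         \<and> asymp_efficient M X L P (Theta_SI \<Lambda> L)"
proof -
  have X: "X i \<in> borel_measurable M" for i
    using assms(3) unfolding prob_space.indep_vars_def[OF assms(2)] by blast
  have mgf: "mgf_rv M (X 0)"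
    using assms(2,8) X unfolding mgf_rv_def mgf_rv_axioms_def \<Lambda>_def by simp
  have int: "interior {x. rate (log_mgf M (X 0)) x < \<infinity>} \<inter> target L A \<noteq> {}" if "A \<in> card_ge_sets L" for A
    using assms(9)[OF that] interior_mono[OF mgf_rv.pos_cone_subset_rate_finite[OF mgf]] unfolding \<Lambda>_def by blast
  interpret si_rule M X L P
    unfolding si_rule_def tilted_walk_def hitting_setup_def si_rule_axioms_def tilted_walk_axioms_def hitting_setup_axioms_def
    using mgf X int assms(5-7,10,11) unfolding \<Lambda>_def by auto
  show ?thesis using si_rule_efficient unfolding \<Lambda>_def by blast
qed

end
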